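(* Let $E=\{0,1,\dots,K\}$ and let $X=(X_i)_{i\ge0}$ be an aperiodic, irreducible, stationary Markov chain on $E$. Let $Y_0,Y_1,\dots$ be integer-valued random variables, conditionally independent given $X$, such that the conditional law of $Y_i$ given $X$ depends only on $X_i$, and for each $k\in E$ the law $\mathcal{L}(Y_i\mid X_i=k)$ does not depend on $i$ and has finite variance. Let $W:=\sum_{i=1}^nY_i$. Assume that (i) the distribution of $\sum_{i=1}^{S_1}Y_i$, under $X_0=0$, is strongly aperiodic, and (ii) there is a positive integer-valued random variable $Z$ with $\mathbb{E}Z^3<\infty$ such that for all $r\ge0$ and all $l\in E$, \[ \max\{\mathbb{P}(Y_1\ge r\mid X_1=l),\ \mathbb{P}(Y_1\le -r\mid X_1=l)\}\le\mathbb{P}(Z\ge r). \] Then, if $\mathrm{Var}\,W>0$, \[ \|\mathcal{L}(W)-\mathrm{TP}(\mathbb{E}W,\mathrm{Var}\,W)\|\le 4\bigl(1+14\,n\,\varphi(n)\,\mathbb{E}\tau^2\,\mathbb{E}Z^3\bigr)/\mathrm{Var}\,W, \] where $\varphi(n):=\tilde\beta(n/4)+(C\vee\bar C)\,n\,\rho^{-n/4}$.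
   Context: $S_1:=\min\{m\ge1:X_m=0\}$ for the chain started at $X_0=0$. An integer-valued random variable $V$ is strongly aperiodic if $\gcd\{k+i:\mathbb{P}(V=i)>0\}=1$ for every integer $k$. Translated Poisson law: for $\mu\in\mathbb{R}$, $\sigma^2\ge0$, let $\gamma=\lfloor\mu-\sigma^2\rfloor$, $\lambda'=\sigma^2+(\mu-\sigma^2-\gamma)$, and $\mathrm{TP}(\mu,\sigma^2)\{j\}:=\mathrm{Po}(\lambda')\{j-\gamma\}$, $j\in\mathbb{Z}$, with $\mathrm{Po}(\lambda)$ the Poisson law of mean $\lambda$. For laws $Q,Q'$ on $\mathbb{Z}$, $\|Q-Q'\|:=\sum_i|Q(i)-Q'(i)|$. Let $\pi$ be the stationary law, $\bar X$ the time-reversed chain (transitions $\pi(j)p(j,k)/\pi(k)$), with associated $Y$-variables drawn from the same conditional laws. $\beta(n):=\bigl\|\mathbb{P}^0[(X_n,1+\sum_{i=1}^nY_i)\in\cdot]-\mathbb{P}^0[(X_n,\sum_{i=1}^nY_i)\in\cdot]\bigr\|$ (total variation norm on $E\times\mathbb{Z}$, chain started at $X_0=0$), $\bar\beta(n)$ the same for $\bar X$, $\tilde\beta(n):=\max\{\beta(n),\bar\beta(n)\}$, and $\tilde\beta(x):=\tilde\beta(\lfloor x\rfloor)$ for non-integer $x$. Let $X'$ be an independent copy of $X$; the pair chain $((X_i,X_i'))$ is an irreducible finite Markov chain on $E\times E$. For a Markov chain $X^*$ with reference state $s_0$, let $D_j:=\min\{m-j:m\ge j,\ X^*_m=s_0\}$.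 The constants $\rho>1$, $C$, $\bar C$ are such that $\max_{s}\mathbb{P}(D_j\ge m\mid X^*_j=s)\le C\rho^{-m}$ for all $m$ when $X^*$ is the pair chain $((X_i,X'_i))$ with reference state $(0,0)$, and $\le\bar C\rho^{-m}$ for the corresponding pair of time-reversed chains. Finally, extending the stationary independent chains $X,X'$ to all times $i\in\mathbb{Z}$, let $\tau:=\sigma^+-\sigma^-+1$ where $\sigma^-:=\max\{k\le0:X_k=X'_k=0\}$, $\sigma^+:=\min\{k\ge0:X_k=X'_k=0\}$. *)

theory Defs
  imports "HOL-Probability.Probability"
begin

text \<open>A transition kernel is P :: nat => nat pmf; the observation laws are
 Q :: nat => int pmf, i.e. Q k is the law of Y_i given X_i = k.\<close>

fun kstep :: "(nat \<Rightarrow> nat pmf) \<Rightarrow> nat \<Rightarrow> nat \<Rightarrow> nat pmf" where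
  "kstep P 0 s = return_pmf s"
| "kstep P (Suc n) s = bind_pmf (P s) (kstep P n)"

definition irreducible_on :: "nat set \<Rightarrow> (nat \<Rightarrow> nat pmf) \<Rightarrow> bool" where
  "irreducible_on E P \<longleftrightarrow> (\<forall>i\<in>E. \<forall>j\<in>E. \<exists>n. pmf (kstep P n i) j > 0)"

definition aperiodic_on :: "nat set \<Rightarrow> (nat \<Rightarrow> nat pmf) \<Rightarrow> bool" where
  "aperiodic_on E P \<longleftrightarrow> (\<forall>i\<in>E. Gcd {n::nat. n > 0 \<and> pmf (kstep P n i) i > 0} = 1)"

fun traj :: "(nat \<Rightarrow> nat pmf) \<Rightarrow> (nat \<Rightarrow> int pmf) \<Rightarrow> nat \<Rightarrow> nat \<Rightarrow> (nat \<times> int) list pmf" where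
  "traj P Q s 0 = return_pmf []"
| "traj P Q s (Suc n) =
     bind_pmf (P s) (\<lambda>x. bind_pmf (Q x) (\<lambda>y. map_pmf (\<lambda>l. (x, y) # l) (traj P Q x n)))"

definition joint_law :: "(nat \<Rightarrow> nat pmf) \<Rightarrow> (nat \<Rightarrow> int pmf) \<Rightarrow> nat \<Rightarrow> nat \<Rightarrow> (nat \<times> int) pmf" where
  "joint_law P Q s n =
     map_pmf (\<lambda>l. (if l = [] then s else fst (last l), sum_list (map snd l))) (traj P Q s n)"

definition W_law :: "nat pmf \<Rightarrow> (nat \<Rightarrow> nat pmf) \<Rightarrow> (nat \<Rightarrow> int pmf) \<Rightarrow> nat \<Rightarrow> int pmf" where
  "W_law \<pi> P Q n = bind_pmf \<pi> (\<lambda>s. map_pmf (\<lambda>l. sum_list (map snd l)) (traj P Q s n))"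

definition first_return_at :: "(nat \<times> int) list \<Rightarrow> bool" where
  "first_return_at l \<longleftrightarrow> l \<noteq> [] \<and> fst (last l) = 0 \<and> (\<forall>p \<in> set (butlast l). fst p \<noteq> 0)"

definition excursion_prob :: "(nat \<Rightarrow> nat pmf) \<Rightarrow> (nat \<Rightarrow> int pmf) \<Rightarrow> nat \<Rightarrow> int \<Rightarrow> real" where
  "excursion_prob P Q m i =
     measure_pmf.prob (traj P Q 0 m) {l. first_return_at l \<and> sum_list (map snd l) = i}"

text \<open>P^0(sum_{i=1}^{S_1} Y_i = i), summing over the (a.s. finite) values of S_1.\<close>
definition excursion_sum_pmf :: "(nat \<Rightarrow> nat pmf) \<Rightarrow> (nat \<Rightarrow> int pmf) \<Rightarrow> int \<Rightarrow> real" where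
  "excursion_sum_pmf P Q i = (\<Sum>m. excursion_prob P Q m i)"

definition strongly_aperiodic :: "(int \<Rightarrow> real) \<Rightarrow> bool" where
  "strongly_aperiodic p \<longleftrightarrow> (\<forall>k::int. Gcd ((\<lambda>i. k + i) ` {i. p i > 0}) = 1)"

definition tv_norm :: "'a pmf \<Rightarrow> 'a pmf \<Rightarrow> real" where
  "tv_norm p q = infsum (\<lambda>z. \<bar>pmf p z - pmf q z\<bar>) UNIV"

definition TP :: "real \<Rightarrow> real \<Rightarrow> int \<Rightarrow> real" where
  "TP \<mu> \<sigma>2 j =
     (let \<gamma> = \<lfloor>\<mu> - \<sigma>2\<rfloor>; lam = \<sigma>2 + (\<mu> - \<sigma>2 - of_int \<gamma>)
      in if \<gamma> \<le> j then exp (- lam) * lam ^ nat (j - \<gamma>) / fact (nat (j - \<gamma>)) else 0)"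

definition tv_norm_TP :: "int pmf \<Rightarrow> real \<Rightarrow> real \<Rightarrow> real" where
  "tv_norm_TP p \<mu> \<sigma>2 = infsum (\<lambda>j. \<bar>pmf p j - TP \<mu> \<sigma>2 j\<bar>) UNIV"

definition rev_kernel :: "nat pmf \<Rightarrow> (nat \<Rightarrow> nat pmf) \<Rightarrow> nat \<Rightarrow> nat pmf" where
  "rev_kernel \<pi> P k = embed_pmf (\<lambda>j. pmf \<pi> j * pmf (P j) k / pmf \<pi> k)"

definition beta :: "(nat \<Rightarrow> nat pmf) \<Rightarrow> (nat \<Rightarrow> int pmf) \<Rightarrow> nat \<Rightarrow> real" where
  "beta P Q n = tv_norm (map_pmf (\<lambda>(x, w). (x, 1 + w)) (joint_law P Q 0 n)) (joint_law P Q 0 n)"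

definition beta_tilde :: "nat pmf \<Rightarrow> (nat \<Rightarrow> nat pmf) \<Rightarrow> (nat \<Rightarrow> int pmf) \<Rightarrow> nat \<Rightarrow> real" where
  "beta_tilde \<pi> P Q n = max (beta P Q n) (beta (rev_kernel \<pi> P) Q n)"

definition pair_kernel :: "(nat \<Rightarrow> nat pmf) \<Rightarrow> nat \<times> nat \<Rightarrow> (nat \<times> nat) pmf" where
  "pair_kernel P s = pair_pmf (P (fst s)) (P (snd s))"

text \<open>avoid K s0 m s = P(D_j >= m | X*_j = s) for a homogeneous chain with kernel K,
  i.e. the probability that X*_j, ..., X*_(j+m-1) all differ from s0.\<close>
fun avoid :: "('a \<Rightarrow> 'a pmf) \<Rightarrow> 'a \<Rightarrow> nat \<Rightarrow> 'a \<Rightarrow> real" where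
  "avoid K s0 0 s = 1"
| "avoid K s0 (Suc m) s = (if s = s0 then 0 else measure_pmf.expectation (K s) (avoid K s0 m))"

text \<open>E tau^2 for tau = sigma^+ - sigma^- + 1 of the two-sided stationary pair chain:
  given (X_0, X'_0) = s (probability pi(s_1) pi(s_2)), sigma^+ is the hitting time of (0,0)
  of the pair chain from s, -sigma^- is the hitting time of (0,0) of the reversed pair chain
  from s, and the two are conditionally independent (Markov property).\<close>
definition E_tau_sq :: "nat pmf \<Rightarrow> (nat \<Rightarrow> nat pmf) \<Rightarrow> nat set \<Rightarrow> real" where
  "E_tau_sq \<pi> P E =
     (\<Sum>s\<in>E \<times> E. pmf \<pi> (fst s) * pmf \<pi> (snd s) *
        infsum (\<lambda>(a, b).
            (avoid (pair_kernel P) (0, 0) a s - avoid (pair_kernel P) (0, 0) (Suc a) s)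
          * (avoid (pair_kernel (rev_kernel \<pi> P)) (0, 0) b s
             - avoid (pair_kernel (rev_kernel \<pi> P)) (0, 0) (Suc b) s)
          * (real a + real b + 1) ^ 2) (UNIV :: (nat \<times> nat) set))"

end

theory Submission
  imports Defs
begin

text \<open>
  Stein's method reduces the claim to bounding \<open>E{\<sigma>\<^sup>2 \<Delta>g(W) - (W - \<mu>) g(W)}\<close> for functions \<open>g\<close> with
  \<open>|\<Delta>g| \<le> 1/\<sigma>\<^sup>2\<close>. Around a time \<open>i\<close>, exchange the segments of the chain and of an independent copy
  between the last time before \<open>i\<close> and the first time after \<open>i\<close> at which both are in state 0. With \<open>S\<close>, \<open>S'\<close>
  the sums over the two segments, \<open>W\<close> becomes \<open>W - S + S'\<close>, and symmetry gives
  \<open>E{(Y_i - EY_i) G(W)} = 1/2 E{(Y_i - Y_i')(G(W) - G(W - S + S'))}\<close>. Apply this to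
  \<open>G(w) = g(w) - w E\<Delta>g(W)\<close>. Given the segments, the rest of \<open>W\<close> is a sum of two independent pieces, one from
  the chain and one from the reversed chain, both started in 0; a piece with at least \<open>n/4\<close> steps makes
  second differences of smoothed functions of order \<open>\<beta>(n/4)\<close>. A second meeting argument compares the
  conditional mean of \<open>\<Delta>g\<close> with \<open>E\<Delta>g(W)\<close>.

  If both pieces are short, some \<open>n/2\<close> steps were lost to waiting for meetings, which has probability
  \<open>O(E\<tau>/n)\<close>. This is absorbed as well, because \<open>\<beta>(n/4)\<close> cannot be smaller than a constant
  multiple of \<open>1/n\<close>: a law whose point masses are all at most \<open>\<beta>/2\<close> has first absolute moment at least of
  order \<open>1/\<beta>\<close>.
\<close>

section \<open>Expectations and total variation of discrete laws\<close>

text \<open>Since E{(W - \<mu>) W} = \<sigma>^2, passing from g to G turns the Stein discrepancy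
  into -E{(W - \<mu>) G(W)}. It also centres \<Delta>G under the law of W, so the linear term of the
  expansion over an exchanged segment involves only the gap between two means of \<Delta>g, which
  smoothing makes small. The obstacle is that E Z^3 and E \<tau>^2 must suffice, while |Y_i - Y_i'|
  S^2 couples one observation with a sum of random length. Meeting times depend on the states alone,
  so conditioning on the states fixes the lengths; Cauchy-Schwarz and Young's inequality then leave
  cubes of single observations times squared lengths. No two-sided process is built: the past of a
  time is a reversed chain of finite length, and a search for a meeting that reaches the end of the
  observations stops with an empty remainder, so the exchange stays exact there. The constant 14:
  each time contributes a factor of at most 2 * 3.42 + 4.65 * (4.62 + 5.52) <= 56, halved by the
  exchange identity and doubled by the norm; 56 = 4 * 14.\<close>

abbreviation expect :: "'a pmf \<Rightarrow> ('a \<Rightarrow> real) \<Rightarrow> real" where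
  "expect p f \<equiv> measure_pmf.expectation p f"

abbreviation prob :: "'a pmf \<Rightarrow> 'a set \<Rightarrow> real" where
  "prob p A \<equiv> measure_pmf.prob p A"

text \<open>Callers need only bound the integral of the absolute value: if \<open>f\<close> is not
  integrable, its Bochner integral is 0 by convention.\<close>

lemma abs_integral_le:
  fixes f :: "'a \<Rightarrow> real"
  assumes "(\<integral>\<^sup>+x. ennreal \<bar>f x\<bar> \<partial>M) \<le> ennreal c" "0 \<le> c"
  shows "\<bar>integral\<^sup>L M f\<bar> \<le> c"
proof (cases "integrable M f")
  case True
  then have "ennreal \<bar>integral\<^sup>L M f\<bar> \<le> ennreal c"
    using integral_norm_bound_ennreal[OF True] assms(1) by (auto intro: order_trans)
  then show ?thesis using assms(2) by (simp add: ennreal_le_iff)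
qed (simp add: not_integrable_integral_eq assms)

lemma integrable_pmfI:
  fixes f :: "'a \<Rightarrow> real"
  assumes "(\<integral>\<^sup>+x. ennreal \<bar>f x\<bar> \<partial>measure_pmf p) < \<infinity>"
  shows "integrable (measure_pmf p) f"
  by (rule integrableI_bounded) (use assms in auto)

lemma integrable_pmfD:
  fixes f :: "'a \<Rightarrow> real"
  assumes "integrable (measure_pmf p) f"
  shows "(\<integral>\<^sup>+x. ennreal \<bar>f x\<bar> \<partial>measure_pmf p) < \<infinity>"
  using assms by (simp add: integrable_iff_bounded)

lemma integrable_bounded_pmf:
  fixes f :: "'a \<Rightarrow> real"
  assumes "\<And>x. \<bar>f x\<bar> \<le> B"
  shows "integrable (measure_pmf p) f"
  by (rule measure_pmf.integrable_const_bound[where B = B]) (use assms in auto)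

lemma abs_expectation_le_const:
  fixes f :: "'a \<Rightarrow> real"
  assumes "\<And>x. \<bar>f x\<bar> \<le> c"
  shows "\<bar>expect p f\<bar> \<le> c"
proof (rule abs_integral_le)
  have "(\<integral>\<^sup>+x. ennreal \<bar>f x\<bar> \<partial>measure_pmf p) \<le> (\<integral>\<^sup>+x. ennreal c \<partial>measure_pmf p)"
    by (intro nn_integral_mono ennreal_leI assms)
  then show "(\<integral>\<^sup>+x. ennreal \<bar>f x\<bar> \<partial>measure_pmf p) \<le> ennreal c" by simp
  show "0 \<le> c" using assms[of undefined] by simp
qed

text \<open>Mixing is exact for nonnegative integrals, so positive and negative parts are treated
  separately. Both are finite for almost every \<open>x\<close>, and there the inner expectation is
  their difference.\<close>

lemma integral_bind_pmf:
  fixes f :: "'b \<Rightarrow> real"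
  assumes int: "integrable (measure_pmf (bind_pmf p k)) f"
  shows "expect (bind_pmf p k) f
       = expect p (\<lambda>x. expect (k x) f)"
proof -
  define N where "N h x = (\<integral>\<^sup>+y. ennreal (h y) \<partial>measure_pmf (k x))" for h :: "'b \<Rightarrow> real" and x
  have fin: "(\<integral>\<^sup>+x. N (\<lambda>y. \<bar>f y\<bar>) x \<partial>measure_pmf p) < \<infinity>"
    using integrable_pmfD[OF int] by (simp add: N_def)
  have le: "N f x \<le> N (\<lambda>y. \<bar>f y\<bar>) x" "N (\<lambda>y. - f y) x \<le> N (\<lambda>y. \<bar>f y\<bar>) x" for x
    by (auto simp: N_def intro!: nn_integral_mono ennreal_leI)
  \<comment> \<open>Used with \<open>h = f\<close> and with \<open>h = - f\<close>: since
    \<open>ennreal\<close> cuts off at 0, these are the positive and the negative part.\<close>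
  have *: "integrable (measure_pmf p) (\<lambda>x. enn2real (N h x))
      \<and> (\<integral>x. enn2real (N h x) \<partial>measure_pmf p) = enn2real (\<integral>\<^sup>+x. N h x \<partial>measure_pmf p)"
    if "\<And>x. N h x \<le> N (\<lambda>y. \<bar>f y\<bar>) x" for h
  proof -
    have fin': "(\<integral>\<^sup>+x. N h x \<partial>measure_pmf p) < \<infinity>"
      by (rule le_less_trans[OF nn_integral_mono fin]) (rule that)
    then have ae: "AE x in measure_pmf p. N h x \<noteq> \<infinity>"
      by (intro nn_integral_PInf_AE) auto
    have eq: "(\<integral>\<^sup>+x. ennreal (enn2real (N h x)) \<partial>measure_pmf p) = (\<integral>\<^sup>+x. N h x \<partial>measure_pmf p)"
      using ae by (intro nn_integral_cong_AE) (auto simp: ennreal_enn2real_if top.not_eq_extremum)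
    show ?thesis
      using fin' eq by (auto intro!: integrable_pmfI simp: integral_eq_nn_integral)
  qed
  have "(\<integral>x. f x \<partial>bind_pmf p k) = enn2real (\<integral>\<^sup>+x. N f x \<partial>measure_pmf p)
        - enn2real (\<integral>\<^sup>+x. N (\<lambda>y. - f y) x \<partial>measure_pmf p)"
    using int by (simp add: real_lebesgue_integral_def N_def)
  also have "\<dots> = (\<integral>x. enn2real (N f x) \<partial>measure_pmf p)
      - (\<integral>x. enn2real (N (\<lambda>y. - f y) x) \<partial>measure_pmf p)"
    using *[of f] *[of "\<lambda>y. - f y"] le by simp
  also have "\<dots> = (\<integral>x. enn2real (N f x) - enn2real (N (\<lambda>y. - f y) x) \<partial>measure_pmf p)"
    using *[of f] *[of "\<lambda>y. - f y"] le by simp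
  also have "\<dots> = (\<integral>x. (\<integral>y. f y \<partial>measure_pmf (k x)) \<partial>measure_pmf p)"
  proof (rule integral_cong_AE)
    have "AE x in measure_pmf p. N (\<lambda>y. \<bar>f y\<bar>) x \<noteq> \<infinity>"
      using fin by (intro nn_integral_PInf_AE) auto
    then show "AE x in measure_pmf p. enn2real (N f x) - enn2real (N (\<lambda>y. - f y) x)
        = (\<integral>y. f y \<partial>measure_pmf (k x))"
    proof eventually_elim
      case (elim x)
      then have "integrable (measure_pmf (k x)) f"
        by (intro integrable_pmfI) (simp add: N_def top.not_eq_extremum)
      then show ?case by (simp add: real_lebesgue_integral_def N_def)
    qed
  qed auto
  finally show ?thesis .
qed

lemma expectation_pmf_count_space:
  fixes f :: "'a \<Rightarrow> real"
  shows "expect p f = (\<integral>z. pmf p z * f z \<partial>count_space UNIV)"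
  by (subst measure_pmf_eq_density, subst integral_density) (auto simp: pmf_nonneg)

lemma integrable_pmf_count_space_mult:
  fixes f :: "'a \<Rightarrow> real"
  assumes "\<And>x. \<bar>f x\<bar> \<le> B"
  shows "integrable (count_space UNIV) (\<lambda>z. pmf p z * f z)"
proof -
  have "integrable (density (count_space UNIV) (\<lambda>z. ennreal (pmf p z))) f"
    using integrable_bounded_pmf[OF assms, of p] unfolding measure_pmf_eq_density[of p] .
  then show ?thesis
    by (subst (asm) integrable_density) (auto simp: pmf_nonneg)
qed

lemma infsum_eq_count_space_integral:
  fixes f :: "'a \<Rightarrow> real"
  assumes "integrable (count_space UNIV) f"
  shows "infsum f UNIV = (\<integral>z. f z \<partial>count_space UNIV)"
  using assms infsetsum_infsum[of f UNIV] by (simp add: abs_summable_on_def infsetsum_def)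

lemma integrable_pmf_diff:
  "integrable (count_space UNIV) (\<lambda>z. \<bar>pmf p z - pmf q z\<bar>)"
  by (intro integrable_abs Bochner_Integration.integrable_diff)
     (auto simp: integrable_pmf)

lemma tv_norm_count_space:
  "tv_norm p q = (\<integral>z. \<bar>pmf p z - pmf q z\<bar> \<partial>count_space UNIV)"
  unfolding tv_norm_def by (rule infsum_eq_count_space_integral[OF integrable_pmf_diff])

lemma tv_norm_nonneg: "0 \<le> tv_norm p q"
  by (simp add: tv_norm_count_space)

lemma expectation_diff_le_tv_norm:
  fixes f :: "'a \<Rightarrow> real"
  assumes B: "\<And>x. \<bar>f x\<bar> \<le> B"
  shows "\<bar>expect p f - expect q f\<bar> \<le> B * tv_norm p q"
proof -
  have "expect p f - expect q f
      = (\<integral>z. (pmf p z - pmf q z) * f z \<partial>count_space UNIV)"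
    unfolding expectation_pmf_count_space
    by (subst Bochner_Integration.integral_diff[symmetric])
       (auto intro!: integrable_pmf_count_space_mult[of f, OF B] simp: left_diff_distrib)
  also have "\<bar>\<dots>\<bar> \<le> (\<integral>z. B * \<bar>pmf p z - pmf q z\<bar> \<partial>count_space UNIV)"
  proof -
    have i: "integrable (count_space UNIV) (\<lambda>z. (pmf p z - pmf q z) * f z)"
      using integrable_pmf_count_space_mult[of f, OF B, of p] integrable_pmf_count_space_mult[of f, OF B, of q]
      by (auto simp: left_diff_distrib)
    have "\<bar>\<integral>z. (pmf p z - pmf q z) * f z \<partial>count_space UNIV\<bar>
        \<le> (\<integral>z. \<bar>(pmf p z - pmf q z) * f z\<bar> \<partial>count_space UNIV)"
      by (rule integral_abs_bound)
    also have "\<dots> \<le> (\<integral>z. B * \<bar>pmf p z - pmf q z\<bar> \<partial>count_space UNIV)"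
      using B
      by (intro integral_mono integrable_abs integrable_mult_right i integrable_pmf_diff)
         (auto simp: abs_mult mult.commute intro: mult_right_mono)
    finally show ?thesis .
  qed
  finally show ?thesis by (simp add: tv_norm_count_space)
qed

lemma prob_eq_count_space_integral:
  "prob p A = (\<integral>z. pmf p z * indicator A z \<partial>count_space UNIV)"
  using expectation_pmf_count_space[of p "indicator A"] by simp

text \<open>Both laws have mass 1, so the positive and negative parts of their difference carry
  equal mass. It follows that one test set is enough for the Stein argument, at the price of a
  factor 2.\<close>

lemma tv_norm_eq_prob_diff:
  "tv_norm p q = 2 * (prob q {z. pmf q z > pmf p z} - prob p {z. pmf q z > pmf p z})"
proof -
  let ?A = "{z. pmf q z > pmf p z}"
  have i: "integrable (count_space UNIV) (\<lambda>z. pmf r z * indicator ?A z)" for r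
    by (rule integrable_pmf_count_space_mult[where B = 1]) (auto simp: indicator_def)
  have one: "(\<integral>z. pmf r z \<partial>count_space UNIV) = 1" for r :: "'a pmf"
    using prob_eq_count_space_integral[of r UNIV] by simp
  have "tv_norm p q = (\<integral>z. (2 * (pmf q z * indicator ?A z) - 2 * (pmf p z * indicator ?A z)) - (pmf q z - pmf p z) \<partial>count_space UNIV)"
    unfolding tv_norm_count_space by (intro Bochner_Integration.integral_cong) (auto simp: indicator_def)
  also have "\<dots> = 2 * (prob q ?A - prob p ?A)"
    using i by (simp add: prob_eq_count_space_integral integrable_pmf one)
  finally show ?thesis .
qed

section \<open>The Stein--Chen equation\<close>

lemma poisson_ratio:
  assumes "0 < l"
  shows "l * pmf (poisson_pmf l) k = real (Suc k) * pmf (poisson_pmf l) (Suc k)"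
  using assms by (simp add: field_simps del: of_nat_Suc)

text \<open>By \<open>poisson_ratio\<close>, the left side is the sum of j times the mass at j over
  j up to k, with every factor j at most k. Together with \<open>poisson_tail_ineq\<close> it fixes
  the signs in \<open>stein_chen_diff_le\<close>.\<close>

lemma poisson_cdf_ineq:
  assumes "0 < l"
  shows "l * prob (poisson_pmf l) {..<k} \<le> real k * prob (poisson_pmf l) {..k}"
proof -
  have "l * prob (poisson_pmf l) {..<k} = (\<Sum>j<k. l * pmf (poisson_pmf l) j)"
    by (simp add: measure_measure_pmf_finite sum_distrib_left)
  also have "\<dots> = (\<Sum>j<k. real (Suc j) * pmf (poisson_pmf l) (Suc j))"
    by (intro sum.cong poisson_ratio refl assms)
  also have "\<dots> \<le> (\<Sum>j<k. real k * pmf (poisson_pmf l) (Suc j))"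
    by (intro sum_mono mult_right_mono pmf_nonneg) auto
  also have "\<dots> \<le> (\<Sum>j\<le>k. real k * pmf (poisson_pmf l) j)"
    by (simp add: sum.atMost_shift del: pmf_poisson) 
  finally show ?thesis by (simp add: measure_measure_pmf_finite sum_distrib_left)
qed

lemma prob_nat_tail_suminf:
  fixes p :: "nat pmf"
  shows "(\<lambda>i. pmf p (k + i)) sums prob p {k..}"
proof -
  have "(\<lambda>i. prob p {k + i}) sums prob p (\<Union>i. {k + i})"
    by (rule measure_pmf.finite_measure_UNION) (auto simp: disjoint_family_on_def)
  moreover have "(\<Union>i. {k + i}) = {k..}" by (auto simp: le_iff_add)
  ultimately show ?thesis by (simp add: pmf.rep_eq)
qed

lemma poisson_tail_ineq:
  assumes "0 < l"
  shows "real k * prob (poisson_pmf l) {Suc k..} \<le> l * prob (poisson_pmf l) {k..}"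
proof (rule sums_le)
  show "real k * pmf (poisson_pmf l) (Suc k + i) \<le> l * pmf (poisson_pmf l) (k + i)" for i
    unfolding poisson_ratio[OF assms] by (simp del: pmf_poisson add: mult_right_mono pmf_nonneg)
  show "(\<lambda>i. real k * pmf (poisson_pmf l) (Suc k + i)) sums (real k * prob (poisson_pmf l) {Suc k..})"
    by (rule sums_mult[OF prob_nat_tail_suminf])
  show "(\<lambda>i. l * pmf (poisson_pmf l) (k + i)) sums (l * prob (poisson_pmf l) {k..})"
    by (rule sums_mult[OF prob_nat_tail_suminf])
qed

text \<open>The solution of the Stein-Chen equation for the indicator of \<open>A\<close>, solved
  upward from 0. The equation leaves the value at 0 free, because it enters with factor 0; the
  choice 0 allows the solution to be continued by 0 to the left.\<close>

definition stein_chen :: "real \<Rightarrow> nat set \<Rightarrow> nat \<Rightarrow> real" where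
  "stein_chen l A k = (case k of 0 \<Rightarrow> 0 | Suc j \<Rightarrow>
     (prob (poisson_pmf l) (A \<inter> {..j})
       - prob (poisson_pmf l) A * prob (poisson_pmf l) {..j})
     / (l * pmf (poisson_pmf l) j))"

lemma stein_chen_equation:
  assumes l: "0 < l"
  shows "l * stein_chen l A (Suc k) - real k * stein_chen l A k
       = indicator A k - prob (poisson_pmf l) A"
proof (cases k)
  case 0
  then show ?thesis using l
    by (auto simp: stein_chen_def measure_measure_pmf_finite indicator_def field_simps)
next
  case (Suc j)
  define p where "p = pmf (poisson_pmf l)"
  let ?P = "prob (poisson_pmf l)"
  have pos: "p i > 0" for i using l by (simp add: p_def)
  have r: "l * p j = real k * p k" using poisson_ratio[OF l, of j] Suc by (simp add: p_def)
  have i1: "?P (A \<inter> {..k}) = ?P (A \<inter> {..j}) + indicator A k * p k"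
  proof -
    have "A \<inter> {..k} = (A \<inter> {..j}) \<union> (A \<inter> {k})" using Suc by (auto simp: le_Suc_eq)
    then have "?P (A \<inter> {..k}) = ?P (A \<inter> {..j}) + ?P (A \<inter> {k})"
      using Suc by (simp add: measure_pmf.finite_measure_Union Int_def disjoint_iff)
    moreover have "?P (A \<inter> {k}) = indicator A k * p k"
      by (cases "k \<in> A") (simp_all add: p_def measure_pmf_single del: pmf_poisson)
    ultimately show ?thesis by simp
  qed
  have i2: "?P {..k} = ?P {..j} + p k"
    using Suc by (simp add: measure_measure_pmf_finite p_def del: pmf_poisson)
  have "l * stein_chen l A (Suc k) - real k * stein_chen l A k
      = (?P (A \<inter> {..k}) - ?P A * ?P {..k}) / p k - (?P (A \<inter> {..j}) - ?P A * ?P {..j}) / p k"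
    using l pos[of k] pos[of j] r Suc by (simp add: stein_chen_def p_def[symmetric])
  also have "\<dots> = indicator A k - ?P A"
    using pos[of k] unfolding i1 i2 by (simp add: field_simps)
  finally show ?thesis .
qed

text \<open>The right-hand side of the equation changes sign under complement. Applied to
  \<open>A\<close> and \<open>- A\<close>, a one-sided bound on the increments therefore becomes a
  two-sided one.\<close>

lemma stein_chen_compl:
  assumes l: "0 < l"
  shows "stein_chen l (- A) k = - stein_chen l A k"
proof -
  let ?P = "prob (poisson_pmf l)"
  have 1: "?P (- A \<inter> {..j}) = ?P {..j} - ?P (A \<inter> {..j})" for j
  proof -
    have "- A \<inter> {..j} = {..j} - (A \<inter> {..j})" by auto
    then show ?thesis by (simp add: measure_pmf.finite_measure_Diff)
  qed
  have 2: "?P (- A) = 1 - ?P A"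
    using measure_pmf.prob_compl[of A "poisson_pmf l"] by (simp add: Compl_eq_Diff_UNIV)
  show ?thesis
    unfolding stein_chen_def 1 2
    by (simp add: algebra_simps diff_divide_distrib add_divide_distrib del: pmf_poisson split: nat.split)
qed

text \<open>Only the atom of \<open>A\<close> at \<open>k\<close> can push the increment up: the
  parts of \<open>A\<close> below and above \<open>k\<close> enter with the nonpositive factors from
  \<open>poisson_tail_ineq\<close> and \<open>poisson_cdf_ineq\<close>. The contribution of the atom
  is at most 1 / l because the total mass is 1.\<close>

lemma stein_chen_diff_le:
  assumes l: "0 < l"
  shows "stein_chen l A (Suc k) - stein_chen l A k \<le> 1 / l"
proof (cases k)
  case 0
  have "l * stein_chen l A (Suc 0) \<le> 1"
    using stein_chen_equation[OF l, of A 0] measure_nonneg[of "measure_pmf (poisson_pmf l)" A]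
    by (auto simp: indicator_def simp del: measure_nonneg split: if_splits)
  then show ?thesis using l 0 by (simp add: stein_chen_def field_simps)
next
  case (Suc j)
  let ?P = "prob (poisson_pmf l)"
  define p where "p = pmf (poisson_pmf l) k"
  define a where "a = ?P (A \<inter> {..j})"
  define c where "c = ?P (A \<inter> {Suc k..})"
  define d :: real where "d = indicator A k"
  define F where "F = ?P {..j}"
  define T where "T = ?P {Suc k..}"
  have p: "p > 0" using l by (simp add: p_def)
  have k: "real k > 0" using Suc by simp
  have r: "l * pmf (poisson_pmf l) j = real k * p" using poisson_ratio[OF l, of j] Suc by (simp add: p_def)
  have sp: "?P (A \<inter> {k}) = d * p"
    by (cases "k \<in> A") (simp_all add: p_def d_def measure_pmf_single del: pmf_poisson)
  have Ak: "?P (A \<inter> {..k}) = a + d * p"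
  proof -
    have "A \<inter> {..k} = (A \<inter> {..j}) \<union> (A \<inter> {k})" using Suc by (auto simp: le_Suc_eq)
    then have "?P (A \<inter> {..k}) = ?P (A \<inter> {..j}) + ?P (A \<inter> {k})"
      using Suc by (simp add: measure_pmf.finite_measure_Union Int_def disjoint_iff)
    then show ?thesis by (simp add: sp a_def)
  qed
  have A: "?P A = a + d * p + c"
  proof -
    have "A = (A \<inter> {..k}) \<union> (A \<inter> {Suc k..})" by auto
    then have "?P A = ?P (A \<inter> {..k}) + ?P (A \<inter> {Suc k..})"
      by (metis (no_types, lifting) measure_pmf.finite_measure_Union sets_measure_pmf UNIV_I
          Int_assoc Int_commute Int_empty_right Suc_n_not_le_n atMost_iff atLeast_iff disjoint_iff order_trans)
    then show ?thesis by (simp add: Ak c_def)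
  qed
  have Fk: "?P {..k} = F + p"
    using Suc by (simp add: measure_measure_pmf_finite p_def F_def del: pmf_poisson)
  have tot: "F + p + T = 1"
  proof -
    have "?P ({..k} \<union> {Suc k..}) = ?P {..k} + ?P {Suc k..}"
      by (rule measure_pmf.finite_measure_Union) auto
    moreover have "{..k} \<union> {Suc k..} = UNIV" by auto
    ultimately show ?thesis by (simp add: Fk T_def)
  qed
  have Tk: "?P {k..} = T + p"
  proof -
    have "?P ({k} \<union> {Suc k..}) = ?P {k} + ?P {Suc k..}"
      by (rule measure_pmf.finite_measure_Union) auto
    moreover have "{k} \<union> {Suc k..} = {k..}" by auto
    ultimately show ?thesis by (simp add: T_def p_def measure_pmf_single del: pmf_poisson)
  qed
  have e1: "real k * T \<le> l * (T + p)" using poisson_tail_ineq[OF l, of k] by (simp add: Tk T_def)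
  have e2: "l * F \<le> real k * (F + p)"
    using poisson_cdf_ineq[OF l, of k] unfolding Fk using Suc by (simp add: F_def lessThan_Suc_atMost)
  have a0: "a \<ge> 0" "c \<ge> 0" "d \<ge> 0" "d \<le> 1" "F \<ge> 0" "T \<ge> 0"
    by (auto simp: a_def c_def d_def F_def T_def indicator_def)
  have "stein_chen l A (Suc k) = ((a + d * p) - (a + d * p + c) * (F + p)) / (l * p)"
    unfolding A[symmetric] by (simp add: stein_chen_def Ak Fk p_def)
  moreover have "stein_chen l A k = (a - (a + d * p + c) * F) / (real k * p)"
    unfolding A[symmetric] using Suc by (simp add: stein_chen_def a_def F_def r)
  ultimately have "(stein_chen l A (Suc k) - stein_chen l A k) * (l * real k * p)
      = ((a + d * p) - (a + d * p + c) * (F + p)) * real k - (a - (a + d * p + c) * F) * l"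
  proof -
    assume *: "stein_chen l A (Suc k) = ((a + d * p) - (a + d * p + c) * (F + p)) / (l * p)"
      "stein_chen l A k = (a - (a + d * p + c) * F) / (real k * p)"
    have "(X / (l * p) - Y / (real k * p)) * (l * real k * p) = X * real k - Y * l" for X Y
      using l k p by (simp add: left_diff_distrib)
    then show ?thesis unfolding * .
  qed
  \<comment> \<open>Sorted by the masses \<open>a\<close>, \<open>c\<close> and \<open>d * p\<close>
    of \<open>A\<close> below, above and at \<open>k\<close>; substituting F = 1 - p - T makes it a
    polynomial identity.\<close>
  also have "\<dots> = a * (real k * T - l * (T + p)) + c * (l * F - real k * (F + p)) + d * p * (real k * T + l * F)"
  proof -
    have F: "F = 1 - p - T" using tot by simp
    show ?thesis unfolding F by (simp add: algebra_simps)
  qed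
  also have "\<dots> \<le> 0 + 0 + 1 * p * (real k * T + real k * (F + p))"
  proof (intro add_mono)
    show "d * p * (real k * T + l * F) \<le> 1 * p * (real k * T + real k * (F + p))"
    proof (rule mult_mono)
      show "d * p \<le> 1 * p" using a0 p by (simp add: mult_left_le_one_le)
    qed (use a0 e2 p k l in auto)
  qed (use a0 e1 e2 in \<open>auto intro: mult_nonneg_nonpos\<close>)
  also have "\<dots> = real k * p" using tot by (simp add: algebra_simps flip: distrib_left)
     (metis add.assoc add.commute mult.commute mult.right_neutral distrib_left)
  finally have "(stein_chen l A (Suc k) - stein_chen l A k) * l * (real k * p) \<le> 1 * (real k * p)"
    by (simp add: mult_ac)
  then have "(stein_chen l A (Suc k) - stein_chen l A k) * l \<le> 1"
    using k p by (metis mult_le_cancel_right_pos mult_pos_pos)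
  then show ?thesis using l by (simp add: field_simps)
qed

lemma abs_stein_chen_diff_le:
  assumes "0 < l"
  shows "\<bar>stein_chen l A (Suc k) - stein_chen l A k\<bar> \<le> 1 / l"
  using stein_chen_diff_le[OF assms, of A k] stein_chen_diff_le[OF assms, of "- A" k]
  by (simp add: stein_chen_compl[OF assms])

lemma pmf_translated_poisson:
  assumes "0 < s2" "\<gamma> = \<lfloor>\<mu> - s2\<rfloor>" "l = s2 + (\<mu> - s2 - of_int \<gamma>)"
  shows "pmf (map_pmf (\<lambda>k. int k + \<gamma>) (poisson_pmf l)) j = TP \<mu> s2 j"
proof -
  have l: "0 < l" using assms by linarith
  have inj: "inj (\<lambda>k. int k + \<gamma>)" by (auto simp: inj_def)
  show ?thesis
  proof (cases "\<gamma> \<le> j")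
    case True
    then have "j = int (nat (j - \<gamma>)) + \<gamma>" by simp
    then have "pmf (map_pmf (\<lambda>k. int k + \<gamma>) (poisson_pmf l)) j = pmf (poisson_pmf l) (nat (j - \<gamma>))"
      using pmf_map_inj'[OF inj] by metis
    then show ?thesis using True l assms(3) unfolding TP_def Let_def assms(2)[symmetric]
      by (simp add: mult.commute)
  next
    case False
    then have "j \<notin> set_pmf (map_pmf (\<lambda>k. int k + \<gamma>) (poisson_pmf l))" by auto
    then have "pmf (map_pmf (\<lambda>k. int k + \<gamma>) (poisson_pmf l)) j = 0"
      unfolding set_pmf_iff by simp
    then show ?thesis using False unfolding TP_def Let_def assms(2)[symmetric] by simp
  qed
qed

text \<open>Two corrections of at most 1 / s2 each, doubled by \<open>tv_norm_eq_prob_diff\<close>,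
  give the 4 / s2: the Poisson mean \<open>l\<close> differs from \<open>s2\<close> because the
  shift is rounded to an integer, and \<open>p\<close> may put mass below the support of the
  translated Poisson law.\<close>

lemma tv_norm_TP_le_stein:
  fixes p :: "int pmf"
  assumes int2: "integrable (measure_pmf p) (\<lambda>w. (real_of_int w)\<^sup>2)"
    and s2: "s2 = measure_pmf.variance p real_of_int" "0 < s2"
    and \<mu>: "\<mu> = expect p real_of_int"
    and stein: "\<And>g :: int \<Rightarrow> real. (\<And>k. \<bar>g (k + 1) - g k\<bar> \<le> 1 / s2) \<Longrightarrow>
       \<bar>s2 * expect p (\<lambda>w. g (w + 1) - g w)
         - expect p (\<lambda>w. (real_of_int w - \<mu>) * g w)\<bar> \<le> R"
  shows "tv_norm_TP p \<mu> s2 \<le> 4 / s2 + 2 * R"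
proof -
  define \<gamma> where "\<gamma> = \<lfloor>\<mu> - s2\<rfloor>"
  define l where "l = s2 + (\<mu> - s2 - of_int \<gamma>)"
  define q where "q = map_pmf (\<lambda>k. int k + \<gamma>) (poisson_pmf l)"
  have TP: "TP \<mu> s2 j = pmf q j" for j
    unfolding q_def by (rule pmf_translated_poisson[symmetric]) (use s2 in \<open>auto simp: \<gamma>_def l_def\<close>)
  have lge: "s2 \<le> l" "l - s2 \<le> 1" and l: "0 < l" and lm: "of_int \<gamma> = \<mu> - l"
    unfolding l_def \<gamma>_def using s2 by linarith+
  have tv: "tv_norm_TP p \<mu> s2 = tv_norm p q" by (simp add: tv_norm_TP_def tv_norm_def TP)
  \<comment> \<open>The extremal test set lies in the support of \<open>q\<close>, hence to the
    right of \<gamma>, and corresponds to a set \<open>A\<close> of naturals.\<close>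
  define B where "B = {z. pmf q z > pmf p z}"
  define A where "A = {k. int k + \<gamma> \<in> B}"
  have Bge: "\<gamma> \<le> z" if "z \<in> B" for z
  proof -
    have "pmf q z \<noteq> 0" using that pmf_nonneg[of p z] by (auto simp: B_def)
    then have "z \<in> set_pmf q" by (simp add: set_pmf_iff)
    then show ?thesis by (auto simp: q_def)
  qed
  have BA: "z \<in> B \<longleftrightarrow> \<gamma> \<le> z \<and> nat (z - \<gamma>) \<in> A" for z using Bge[of z] by (auto simp: A_def)
  have qB: "prob q B = prob (poisson_pmf l) A"
    by (simp add: q_def A_def vimage_def)
  define a where "a = prob (poisson_pmf l) A"
  define g where "g z = stein_chen l A (nat (z - \<gamma>))" for z
  have gd: "\<bar>g (k + 1) - g k\<bar> \<le> 1 / l" for k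
  proof (cases "\<gamma> \<le> k")
    case True
    then have "nat (k + 1 - \<gamma>) = Suc (nat (k - \<gamma>))" by simp
    then show ?thesis unfolding g_def by (simp only: abs_stein_chen_diff_le[OF l])
  next
    case False
    then show ?thesis using l by (simp add: g_def)
  qed
  \<comment> \<open>To the left of \<gamma> both sides are 0, as \<open>g\<close> vanishes up to and
    including \<gamma>. So the constant \<open>a\<close> is seen only on
    \<open>{\<gamma>..}\<close>, which is where the mass of \<open>p\<close> below \<gamma> enters
    the estimate.\<close>
  have eq: "l * g (z + 1) - real_of_int (z - \<gamma>) * g z = indicator B z - a * indicator {\<gamma>..} z" for z
  proof (cases "\<gamma> \<le> z")
    case True
    have "nat (z + 1 - \<gamma>) = Suc (nat (z - \<gamma>))" "real_of_int (z - \<gamma>) = real (nat (z - \<gamma>))" using True by auto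
    then have "l * g (z + 1) - real_of_int (z - \<gamma>) * g z = indicator A (nat (z - \<gamma>)) - a"
      unfolding g_def a_def using stein_chen_equation[OF l, of A "nat (z - \<gamma>)"] by simp
    then show ?thesis using True BA[of z] by (auto simp: indicator_def)
  next
    case False
    then show ?thesis using BA[of z] by (auto simp: g_def stein_chen_def indicator_def)
  qed
  have "1 / l \<le> 1 / s2" using lge s2 by (simp add: frac_le)
  then have R: "\<bar>s2 * expect p (\<lambda>w. g (w + 1) - g w)
         - expect p (\<lambda>w. (real_of_int w - \<mu>) * g w)\<bar> \<le> R"
    using gd by (intro stein) (meson order_trans)
  have id: "indicator B z - a * indicator {\<gamma>..} z = l * (g (z + 1) - g z) - (real_of_int z - \<mu>) * g z" for z
    unfolding eq[symmetric] by (simp add: lm algebra_simps)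
  have iD: "integrable (measure_pmf p) (\<lambda>w. g (w + 1) - g w)"
    by (rule integrable_bounded_pmf[OF gd])
  have iB: "integrable (measure_pmf p) (\<lambda>z. indicator B z - a * indicator {\<gamma>..} z :: real)"
    using measure_pmf.prob_le_1[of "poisson_pmf l" A] measure_nonneg[of "measure_pmf (poisson_pmf l)" A]
    by (intro integrable_bounded_pmf[where B = 2])
       (auto simp: a_def indicator_def simp del: measure_nonneg measure_pmf.prob_le_1)
  have iX: "integrable (measure_pmf p) (\<lambda>w. (real_of_int w - \<mu>) * g w)"
  proof -
    have "integrable (measure_pmf p) (\<lambda>z. l * (g (z + 1) - g z) - (indicator B z - a * indicator {\<gamma>..} z))"
      using iD iB by simp
    then show ?thesis unfolding id by simp
  qed
  have "prob p B - a * prob p {\<gamma>..}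
     = expect p (\<lambda>z. indicator B z - a * indicator {\<gamma>..} z)"
  proof -
    have "integrable (measure_pmf p) (indicator S :: int \<Rightarrow> real)" for S
      by (rule integrable_bounded_pmf[where B = 1]) (auto simp: indicator_def)
    then show ?thesis by (subst Bochner_Integration.integral_diff) auto
  qed
  also have "\<dots> = l * expect p (\<lambda>w. g (w + 1) - g w)
     - expect p (\<lambda>w. (real_of_int w - \<mu>) * g w)"
    unfolding id using iD iX by (subst Bochner_Integration.integral_diff) auto
  finally have main: "prob p B - a * prob p {\<gamma>..}
     = l * expect p (\<lambda>w. g (w + 1) - g w)
     - expect p (\<lambda>w. (real_of_int w - \<mu>) * g w)" .
  have ED: "\<bar>expect p (\<lambda>w. g (w + 1) - g w)\<bar> \<le> 1 / l"
    by (rule abs_expectation_le_const[OF gd])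
  have small: "\<bar>(l - s2) * expect p (\<lambda>w. g (w + 1) - g w)\<bar> \<le> 1 / s2"
  proof -
    have "\<bar>(l - s2) * expect p (\<lambda>w. g (w + 1) - g w)\<bar> \<le> 1 * (1 / l)"
      unfolding abs_mult using ED lge by (intro mult_mono) auto
    then show ?thesis using \<open>1 / l \<le> 1 / s2\<close> by simp
  qed
  \<comment> \<open>As \<gamma> = \<mu> - l, a value below \<gamma> deviates from the mean by at
    least \<open>l\<close>, and \<open>l\<close> is at least the variance \<open>s2\<close>.\<close>
  have cheb: "prob p {..<\<gamma>} \<le> 1 / s2"
  proof -
    have "prob p {..<\<gamma>} \<le> prob p {w \<in> space (measure_pmf p). l \<le> \<bar>real_of_int w - expect p real_of_int\<bar>}"
    proof (intro measure_pmf.finite_measure_mono)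
      show "{..<\<gamma>} \<subseteq> {w \<in> space (measure_pmf p). l \<le> \<bar>real_of_int w - expect p real_of_int\<bar>}"
      proof safe
        fix w assume "w < \<gamma>"
        then have "real_of_int w \<le> \<mu> - l" unfolding lm[symmetric] by simp
        then show "l \<le> \<bar>real_of_int w - expect p real_of_int\<bar>" unfolding \<mu> by linarith
      qed simp
    qed simp
    also have "\<dots> \<le> s2 / l\<^sup>2"
      unfolding s2(1) using int2 l by (intro measure_pmf.Chebyshev_inequality) auto
    also have "\<dots> \<le> s2 / s2\<^sup>2" using lge s2 by (intro divide_left_mono power_mono) auto
    also have "\<dots> = 1 / s2" using s2 by (simp add: power2_eq_square)
    finally show ?thesis .
  qed
  have compl: "prob p {\<gamma>..} = 1 - prob p {..<\<gamma>}"
    using measure_pmf.prob_compl[of "{..<\<gamma>}" p] by (simp add: Compl_eq_Diff_UNIV[symmetric] Compl_lessThan)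
  have a01: "0 \<le> a" "a \<le> 1" by (auto simp: a_def)
  have "a * prob p {..<\<gamma>} \<le> 1 * (1 / s2)"
    using a01 cheb by (intro mult_mono) auto
  moreover have "a - prob p B = a * prob p {..<\<gamma>}
      - (s2 * expect p (\<lambda>w. g (w + 1) - g w)
         - expect p (\<lambda>w. (real_of_int w - \<mu>) * g w))
      - (l - s2) * expect p (\<lambda>w. g (w + 1) - g w)"
    using main unfolding compl by (simp add: algebra_simps)
  ultimately have "a - prob p B \<le> 2 / s2 + R" using R small by linarith
  then show ?thesis
    unfolding tv tv_norm_eq_prob_diff B_def[symmetric] qB a_def[symmetric] by simp
qed

section \<open>Moments of dominated laws\<close>

text \<open>Summation by parts: a cube is the sum of the nonnegative increments \<open>c r\<close>
  over r < k, so its mean is a nonnegative combination of tail probabilities.\<close>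

lemma nn_integral_cube_mono_tail:
  fixes p q :: "nat pmf"
  assumes "\<And>r. prob p {r..} \<le> prob q {r..}"
  shows "(\<integral>\<^sup>+k. ennreal (real k ^ 3) \<partial>p) \<le> (\<integral>\<^sup>+k. ennreal (real k ^ 3) \<partial>q)"
proof -
  define c where "c r = real (Suc r) ^ 3 - real r ^ 3" for r
  have c: "c r \<ge> 0" for r by (simp add: c_def power_mono)
  have cube: "ennreal (real k ^ 3) = (\<Sum>r. ennreal (c r) * indicator {Suc r..} k)" for k
  proof -
    have "(\<Sum>r. ennreal (c r) * indicator {Suc r..} k) = (\<Sum>r<k. ennreal (c r) * indicator {Suc r..} k)"
      by (intro suminf_finite) (auto simp: indicator_def)
    also have "\<dots> = (\<Sum>r<k. ennreal (c r))" by (intro sum.cong) (auto simp: indicator_def)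
    also have "\<dots> = ennreal (\<Sum>r<k. c r)" using c by (simp add: sum_ennreal)
    also have "(\<Sum>r<k. c r) = real k ^ 3" unfolding c_def using sum_lessThan_telescope[of "\<lambda>r. real r ^ 3" k] by simp
    finally show ?thesis ..
  qed
  have eq: "(\<integral>\<^sup>+k. ennreal (real k ^ 3) \<partial>r) = (\<Sum>i. ennreal (c i) * ennreal (prob r {Suc i..}))" for r :: "nat pmf"
    unfolding cube
    by (subst nn_integral_suminf) (auto simp: nn_integral_cmult measure_pmf.emeasure_eq_measure)
  show ?thesis unfolding eq
    by (intro suminf_le mult_left_mono ennreal_leI assms) auto
qed

locale dominated_laws =
  fixes E :: "nat set" and Q :: "nat \<Rightarrow> int pmf" and Z :: "nat pmf"
  assumes Z_pos: "0 \<notin> set_pmf Z"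
    and Z_cube: "integrable (measure_pmf Z) (\<lambda>z. real z ^ 3)"
    and Z_dom: "l \<in> E \<Longrightarrow>
        max (prob (Q l) {y. y \<ge> int r}) (prob (Q l) {y. y \<le> - int r})
          \<le> prob Z {z. z \<ge> r}"
begin

definition \<zeta> :: real where "\<zeta> = expect Z (\<lambda>z. real z ^ 3)"
text \<open>The common length scale: moments of order 1, 2 and 3 of the observations are all bounded
  by a constant times the corresponding power of \<theta>.\<close>

definition \<theta> :: real where "\<theta> = root 3 \<zeta>"

lemma nn_integral_Z: "(\<integral>\<^sup>+z. ennreal (real z ^ 3) \<partial>Z) = ennreal \<zeta>"
  unfolding \<zeta>_def by (rule nn_integral_eq_integral[OF Z_cube]) simp

lemma zeta_ge_1: "1 \<le> \<zeta>"
proof -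
  have "expect Z (\<lambda>_. 1) \<le> \<zeta>" unfolding \<zeta>_def
  proof (rule integral_mono_AE[OF _ Z_cube])
    show "AE x in measure_pmf Z. 1 \<le> real x ^ 3"
    proof (subst AE_measure_pmf_iff, rule ballI)
      fix x assume "x \<in> set_pmf Z"
      then have "1 \<le> x" using Z_pos by (cases x) auto
      then show "1 \<le> real x ^ 3" by (simp add: one_le_power)
    qed
  qed simp
  then show ?thesis by simp
qed

lemma theta_ge_1: "1 \<le> \<theta>" and theta_cube: "\<theta> ^ 3 = \<zeta>"
  using zeta_ge_1 by (auto simp: \<theta>_def)

lemma nn_integral_pos_part:
  assumes "l \<in> E"
  shows "(\<integral>\<^sup>+y. ennreal (real (nat y) ^ 3) \<partial>Q l) \<le> ennreal \<zeta>"
    and "(\<integral>\<^sup>+y. ennreal (real (nat (- y)) ^ 3) \<partial>Q l) \<le> ennreal \<zeta>"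
proof -
  have "prob (map_pmf nat (Q l)) {r..} \<le> prob Z {r..}
    \<and> prob (map_pmf (\<lambda>y. nat (- y)) (Q l)) {r..} \<le> prob Z {r..}" for r
  proof (cases "r = 0")
    case True
    then have "{r..} = (UNIV :: nat set)" by auto
    then show ?thesis by simp
  next
    case False
    have "nat -` {r..} = {y. y \<ge> int r}" "(\<lambda>y. nat (- y)) -` {r..} = {y. y \<le> - int r}" "{z. z \<ge> r} = {r..}"
      using False by auto
    then show ?thesis using Z_dom[OF assms, of r] by simp
  qed
  then show "(\<integral>\<^sup>+y. ennreal (real (nat y) ^ 3) \<partial>Q l) \<le> ennreal \<zeta>"
    "(\<integral>\<^sup>+y. ennreal (real (nat (- y)) ^ 3) \<partial>Q l) \<le> ennreal \<zeta>"
    using nn_integral_cube_mono_tail[of "map_pmf nat (Q l)" Z]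
      nn_integral_cube_mono_tail[of "map_pmf (\<lambda>y. nat (- y)) (Q l)" Z]
    by (simp_all add: nn_integral_Z)
qed

lemma third_moment:
  assumes "l \<in> E"
  shows "(\<integral>\<^sup>+y. ennreal (\<bar>real_of_int y\<bar> ^ 3) \<partial>Q l) \<le> ennreal (2 * \<zeta>)"
proof -
  have "(\<integral>\<^sup>+y. ennreal (\<bar>real_of_int y\<bar> ^ 3) \<partial>Q l)
      = (\<integral>\<^sup>+y. ennreal (real (nat y) ^ 3) + ennreal (real (nat (- y)) ^ 3) \<partial>Q l)"
  proof (rule nn_integral_cong)
    fix y :: int
    show "ennreal (\<bar>real_of_int y\<bar> ^ 3) = ennreal (real (nat y) ^ 3) + ennreal (real (nat (- y)) ^ 3)"
      by (cases "y \<ge> 0") auto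
  qed
  also have "\<dots> = (\<integral>\<^sup>+y. ennreal (real (nat y) ^ 3) \<partial>Q l) + (\<integral>\<^sup>+y. ennreal (real (nat (- y)) ^ 3) \<partial>Q l)"
    by (rule nn_integral_add) auto
  also have "\<dots> \<le> ennreal \<zeta> + ennreal \<zeta>" by (intro add_mono nn_integral_pos_part assms)
  also have "\<dots> = ennreal (2 * \<zeta>)" using zeta_ge_1 by (simp flip: ennreal_plus)
  finally show ?thesis .
qed

text \<open>For equal signs the difference is at most the larger modulus and the factor is 1; for
  opposite signs convexity costs 4 = 1 + 3. The sign indicators record which case occurs. A factor 4
  throughout would turn the 10 of \<open>third_moment_diff\<close> into 16.\<close>

lemma cube_diff_le:
  fixes y y' :: int
  shows "\<bar>real_of_int y - real_of_int y'\<bar> ^ 3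
    \<le> real (nat y) ^ 3 * (1 + 3 * indicator {..<0} y') + real (nat (- y)) ^ 3 * (1 + 3 * indicator {0<..} y')
    + (real (nat y') ^ 3 * (1 + 3 * indicator {..<0} y) + real (nat (- y')) ^ 3 * (1 + 3 * indicator {0<..} y))"
proof -
  have same: "\<bar>a - b\<bar> ^ 3 \<le> a ^ 3 + b ^ 3" if "0 \<le> a" "0 \<le> b" for a b :: real
  proof -
    have "\<bar>a - b\<bar> \<le> max a b" using that by auto
    then have "\<bar>a - b\<bar> ^ 3 \<le> max a b ^ 3" by (intro power_mono) auto
    also have "\<dots> \<le> a ^ 3 + b ^ 3" using that by (auto simp: max_def)
    finally show ?thesis .
  qed
  have opp: "(a + b) ^ 3 \<le> 4 * (a ^ 3 + b ^ 3)" if "0 \<le> a" "0 \<le> b" for a b :: real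
  proof -
    have "4 * (a ^ 3 + b ^ 3) - (a + b) ^ 3 = 3 * (a + b) * (a - b)\<^sup>2"
      by (simp add: power2_eq_square power3_eq_cube algebra_simps)
    moreover have "\<dots> \<ge> 0" using that by simp
    ultimately show ?thesis by linarith
  qed
  consider "y \<ge> 0" "y' \<ge> 0" | "y \<le> 0" "y' \<le> 0" | "y > 0" "y' < 0" | "y < 0" "y' > 0" by linarith
  then show ?thesis
  proof cases
    case 1
    then show ?thesis using same[of "real_of_int y" "real_of_int y'"] by (simp add: indicator_def)
  next
    case 2
    then show ?thesis using same[of "real_of_int (- y)" "real_of_int (- y')"]
      by (simp add: indicator_def abs_minus_commute)
  next
    case 3
    then show ?thesis using opp[of "real_of_int y" "real_of_int (- y')"] by (simp add: indicator_def)
  next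
    case 4
    then show ?thesis using opp[of "real_of_int (- y)" "real_of_int y'"]
      by (simp add: indicator_def abs_if add.commute)
  qed
qed

text \<open>By independence the sign indicators become probabilities, and those of
  \<open>{..<0}\<close> and \<open>{0<..}\<close> under one law add up to at most 1. The four
  one-sided third moments then give 4 + 3 + 3 = 10.\<close>

lemma third_moment_diff:
  assumes "l \<in> E" "l' \<in> E"
  shows "(\<integral>\<^sup>+p. ennreal (\<bar>real_of_int (fst p) - real_of_int (snd p)\<bar> ^ 3) \<partial>pair_pmf (Q l) (Q l')) \<le> ennreal (10 * \<zeta>)"
proof -
  define a :: "int \<Rightarrow> ennreal" where "a y = ennreal (real (nat y) ^ 3)" for y
  define b :: "int \<Rightarrow> ennreal" where "b y = ennreal (real (nat (- y)) ^ 3)" for y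
  define m where "m x = emeasure (measure_pmf (Q x)) {..<0}" for x
  define n where "n x = emeasure (measure_pmf (Q x)) {0<..}" for x
  have z1: "ennreal (1 + 3 * indicator S y) = 1 + 3 * indicator S y" for S and y :: int
    by (auto simp: indicator_def)
  have mn: "m x + n x \<le> 1" for x
  proof -
    have "m x + n x = emeasure (measure_pmf (Q x)) ({..<0} \<union> {0<..})"
      unfolding m_def n_def by (rule plus_emeasure) auto
    also have "\<dots> \<le> 1" by (rule measure_pmf.emeasure_le_1)
    finally show ?thesis .
  qed
  have "(\<integral>\<^sup>+p. ennreal (\<bar>real_of_int (fst p) - real_of_int (snd p)\<bar> ^ 3) \<partial>pair_pmf (Q l) (Q l'))
     = (\<integral>\<^sup>+y. \<integral>\<^sup>+y'. ennreal (\<bar>real_of_int y - real_of_int y'\<bar> ^ 3) \<partial>Q l' \<partial>Q l)"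
    by (simp add: nn_integral_pair_pmf')
  also have "\<dots> \<le> (\<integral>\<^sup>+y. \<integral>\<^sup>+y'. a y * (1 + 3 * indicator {..<0} y') + b y * (1 + 3 * indicator {0<..} y')
      + (a y' * (1 + 3 * indicator {..<0} y) + b y' * (1 + 3 * indicator {0<..} y)) \<partial>Q l' \<partial>Q l)"
    unfolding a_def b_def z1[symmetric]
    by (intro nn_integral_mono order_trans[OF ennreal_leI[OF cube_diff_le]])
       (simp add: ennreal_mult' del: ennreal_plus add: ennreal_plus[of "_ * _"] ennreal_plus[of "_ + _"])
  also have "\<dots> = (\<integral>\<^sup>+y. a y * (1 + 3 * m l') + b y * (1 + 3 * n l')
      + ((\<integral>\<^sup>+y'. a y' \<partial>Q l') * (1 + 3 * indicator {..<0} y) + (\<integral>\<^sup>+y'. b y' \<partial>Q l') * (1 + 3 * indicator {0<..} y)) \<partial>Q l)"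
    by (simp add: nn_integral_add nn_integral_cmult nn_integral_multc m_def n_def)
  also have "\<dots> = (\<integral>\<^sup>+y. a y \<partial>Q l) * (1 + 3 * m l') + (\<integral>\<^sup>+y. b y \<partial>Q l) * (1 + 3 * n l')
      + ((\<integral>\<^sup>+y'. a y' \<partial>Q l') * (1 + 3 * m l) + (\<integral>\<^sup>+y'. b y' \<partial>Q l') * (1 + 3 * n l))"
    by (simp add: nn_integral_add nn_integral_cmult nn_integral_multc m_def n_def)
  also have "\<dots> \<le> ennreal \<zeta> * (1 + 3 * m l') + ennreal \<zeta> * (1 + 3 * n l')
      + (ennreal \<zeta> * (1 + 3 * m l) + ennreal \<zeta> * (1 + 3 * n l))"
    unfolding a_def b_def by (intro add_mono mult_right_mono nn_integral_pos_part assms) auto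
  also have "\<dots> = ennreal \<zeta> * (4 + 3 * (m l' + n l') + 3 * (m l + n l))"
  proof -
    have four: "(4::ennreal) = 1 + 1 + 1 + 1" by simp
    show ?thesis unfolding four distrib_left mult_1_right by (simp only: add_ac)
  qed
  also have "\<dots> \<le> ennreal \<zeta> * (4 + 3 * 1 + 3 * 1)"
    by (intro mult_left_mono add_mono mn) auto
  also have "\<dots> = ennreal (10 * \<zeta>)" using zeta_ge_1 by (simp add: ennreal_mult' mult.commute)
  finally show ?thesis .
qed

end

section \<open>Lower moments from third moments\<close>

text \<open>Young's inequality in tangent form: the cubic touches the line at \<kappa>, as the
  double root shows. The best contact point is the cube root of \<open>t\<close>, where Lyapunov's
  bound is recovered; a rational \<kappa> nearby avoids roots of constants.\<close>

lemma first_moment_from_third: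
  fixes f :: "'a \<Rightarrow> real"
  assumes "(\<integral>\<^sup>+x. ennreal (\<bar>f x\<bar> ^ 3) \<partial>measure_pmf p) \<le> ennreal t" "0 < \<kappa>" "0 \<le> t"
  shows "(\<integral>\<^sup>+x. ennreal \<bar>f x\<bar> \<partial>measure_pmf p) \<le> ennreal (t / (3 * \<kappa>\<^sup>2) + 2 * \<kappa> / 3)"
proof -
  have young: "a \<le> 1 / (3 * \<kappa>\<^sup>2) * a ^ 3 + 2 * \<kappa> / 3" if "a \<ge> 0" for a
  proof -
    have "a ^ 3 + 2 * \<kappa> ^ 3 - 3 * \<kappa>\<^sup>2 * a = (a - \<kappa>)\<^sup>2 * (a + 2 * \<kappa>)"
      by (simp add: power2_eq_square power3_eq_cube algebra_simps)
    moreover have "\<dots> \<ge> 0" using that assms by simp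
    ultimately have "3 * \<kappa>\<^sup>2 * a \<le> a ^ 3 + 2 * \<kappa> ^ 3" by linarith
    then have "a \<le> (a ^ 3 + 2 * \<kappa> ^ 3) / (3 * \<kappa>\<^sup>2)"
      using assms by (subst pos_le_divide_eq) (auto simp: mult.commute)
    also have "\<dots> = 1 / (3 * \<kappa>\<^sup>2) * a ^ 3 + 2 * \<kappa> / 3"
      using assms by (simp add: add_divide_distrib power2_eq_square power3_eq_cube)
    finally show ?thesis .
  qed
  have "(\<integral>\<^sup>+x. ennreal \<bar>f x\<bar> \<partial>measure_pmf p)
     \<le> (\<integral>\<^sup>+x. ennreal (1 / (3 * \<kappa>\<^sup>2)) * ennreal (\<bar>f x\<bar> ^ 3) + ennreal (2 * \<kappa> / 3) \<partial>measure_pmf p)"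
  proof (rule nn_integral_mono)
    fix x
    have "ennreal \<bar>f x\<bar> \<le> ennreal (1 / (3 * \<kappa>\<^sup>2) * \<bar>f x\<bar> ^ 3 + 2 * \<kappa> / 3)"
      by (intro ennreal_leI young) simp
    also have "\<dots> = ennreal (1 / (3 * \<kappa>\<^sup>2)) * ennreal (\<bar>f x\<bar> ^ 3) + ennreal (2 * \<kappa> / 3)"
      using assms by (subst ennreal_plus, simp, simp, subst ennreal_mult') auto
    finally show "ennreal \<bar>f x\<bar> \<le> ennreal (1 / (3 * \<kappa>\<^sup>2)) * ennreal (\<bar>f x\<bar> ^ 3) + ennreal (2 * \<kappa> / 3)" .
  qed
  also have "\<dots> = ennreal (1 / (3 * \<kappa>\<^sup>2)) * (\<integral>\<^sup>+x. ennreal (\<bar>f x\<bar> ^ 3) \<partial>measure_pmf p) + ennreal (2 * \<kappa> / 3)"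
    by (simp add: nn_integral_add nn_integral_cmult)
  also have "\<dots> \<le> ennreal (1 / (3 * \<kappa>\<^sup>2)) * ennreal t + ennreal (2 * \<kappa> / 3)"
    by (intro add_mono mult_left_mono assms) auto
  also have "\<dots> = ennreal (t / (3 * \<kappa>\<^sup>2) + 2 * \<kappa> / 3)"
    using assms by (subst ennreal_mult'[symmetric], simp, subst ennreal_plus[symmetric]) auto
  finally show ?thesis .
qed

lemma second_moment_from_third:
  fixes f :: "'a \<Rightarrow> real"
  assumes "(\<integral>\<^sup>+x. ennreal (\<bar>f x\<bar> ^ 3) \<partial>measure_pmf p) \<le> ennreal t" "0 < \<kappa>" "0 \<le> t"
  shows "(\<integral>\<^sup>+x. ennreal ((f x)\<^sup>2) \<partial>measure_pmf p) \<le> ennreal (2 * t / (3 * \<kappa>) + \<kappa>\<^sup>2 / 3)"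
proof -
  have young: "b\<^sup>2 \<le> 2 / (3 * \<kappa>) * \<bar>b\<bar> ^ 3 + \<kappa>\<^sup>2 / 3" for b
  proof -
    define a where "a = \<bar>b\<bar>"
    have "2 * a ^ 3 + \<kappa> ^ 3 - 3 * \<kappa> * a\<^sup>2 = (a - \<kappa>)\<^sup>2 * (2 * a + \<kappa>)"
      by (simp add: power2_eq_square power3_eq_cube algebra_simps)
    moreover have "\<dots> \<ge> 0" using assms by (simp add: a_def)
    ultimately have "3 * \<kappa> * a\<^sup>2 \<le> 2 * a ^ 3 + \<kappa> ^ 3" by linarith
    then have "a\<^sup>2 \<le> 2 / (3 * \<kappa>) * a ^ 3 + \<kappa>\<^sup>2 / 3"
    proof -
      assume "3 * \<kappa> * a\<^sup>2 \<le> 2 * a ^ 3 + \<kappa> ^ 3"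
      then have "a\<^sup>2 \<le> (2 * a ^ 3 + \<kappa> ^ 3) / (3 * \<kappa>)"
        using assms by (subst pos_le_divide_eq) (auto simp: mult.commute)
      also have "\<dots> = 2 / (3 * \<kappa>) * a ^ 3 + \<kappa>\<^sup>2 / 3"
        using assms by (simp add: add_divide_distrib power2_eq_square power3_eq_cube)
      finally show ?thesis .
    qed
    then show ?thesis by (simp add: a_def)
  qed
  have "(\<integral>\<^sup>+x. ennreal ((f x)\<^sup>2) \<partial>measure_pmf p)
     \<le> (\<integral>\<^sup>+x. ennreal (2 / (3 * \<kappa>)) * ennreal (\<bar>f x\<bar> ^ 3) + ennreal (\<kappa>\<^sup>2 / 3) \<partial>measure_pmf p)"
  proof (rule nn_integral_mono)
    fix x
    have "ennreal ((f x)\<^sup>2) \<le> ennreal (2 / (3 * \<kappa>) * \<bar>f x\<bar> ^ 3 + \<kappa>\<^sup>2 / 3)"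
      by (intro ennreal_leI young)
    also have "\<dots> = ennreal (2 / (3 * \<kappa>)) * ennreal (\<bar>f x\<bar> ^ 3) + ennreal (\<kappa>\<^sup>2 / 3)"
      using assms by (subst ennreal_plus, simp, simp, subst ennreal_mult') auto
    finally show "ennreal ((f x)\<^sup>2) \<le> ennreal (2 / (3 * \<kappa>)) * ennreal (\<bar>f x\<bar> ^ 3) + ennreal (\<kappa>\<^sup>2 / 3)" .
  qed
  also have "\<dots> = ennreal (2 / (3 * \<kappa>)) * (\<integral>\<^sup>+x. ennreal (\<bar>f x\<bar> ^ 3) \<partial>measure_pmf p) + ennreal (\<kappa>\<^sup>2 / 3)"
    by (simp add: nn_integral_add nn_integral_cmult)
  also have "\<dots> \<le> ennreal (2 / (3 * \<kappa>)) * ennreal t + ennreal (\<kappa>\<^sup>2 / 3)"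
    by (intro add_mono mult_left_mono assms) auto
  also have "\<dots> = ennreal (2 * t / (3 * \<kappa>) + \<kappa>\<^sup>2 / 3)"
    using assms by (subst ennreal_mult'[symmetric], simp, subst ennreal_plus[symmetric]) auto
  finally show ?thesis .
qed

context dominated_laws begin

text \<open>1.26 is the cube root of 2, rounded up, and also serves as contact point.\<close>

lemma first_moment:
  assumes "l \<in> E"
  shows "(\<integral>\<^sup>+y. ennreal \<bar>real_of_int y\<bar> \<partial>Q l) \<le> ennreal (1.26 * \<theta>)"
proof -
  have "(\<integral>\<^sup>+y. ennreal \<bar>real_of_int y\<bar> \<partial>Q l)
      \<le> ennreal (2 * \<zeta> / (3 * (1.26 * \<theta>)\<^sup>2) + 2 * (1.26 * \<theta>) / 3)"
    using theta_ge_1 zeta_ge_1 by (intro first_moment_from_third third_moment assms) auto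
  also have "2 * \<zeta> / (3 * (1.26 * \<theta>)\<^sup>2) + 2 * (1.26 * \<theta>) / 3 \<le> 1.26 * \<theta>"
    using theta_ge_1 by (simp add: theta_cube[symmetric] power2_eq_square power3_eq_cube field_simps)
  finally show ?thesis by (simp add: ennreal_leI)
qed

text \<open>2.16 is an upper approximation of the cube root of 10.\<close>

lemma first_moment_diff:
  assumes "l \<in> E" "l' \<in> E"
  shows "(\<integral>\<^sup>+p. ennreal \<bar>real_of_int (fst p) - real_of_int (snd p)\<bar> \<partial>pair_pmf (Q l) (Q l')) \<le> ennreal (2.16 * \<theta>)"
proof -
  have "(\<integral>\<^sup>+p. ennreal \<bar>real_of_int (fst p) - real_of_int (snd p)\<bar> \<partial>pair_pmf (Q l) (Q l'))
      \<le> ennreal (10 * \<zeta> / (3 * (2.16 * \<theta>)\<^sup>2) + 2 * (2.16 * \<theta>) / 3)"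
    using theta_ge_1 zeta_ge_1 by (intro first_moment_from_third third_moment_diff assms) auto
  also have "10 * \<zeta> / (3 * (2.16 * \<theta>)\<^sup>2) + 2 * (2.16 * \<theta>) / 3 \<le> 2.16 * \<theta>"
    using theta_ge_1 by (simp add: theta_cube[symmetric] power2_eq_square power3_eq_cube field_simps)
  finally show ?thesis by (simp add: ennreal_leI)
qed

text \<open>4.65 bounds 10 to the power 2/3 from above; the contact point 2.15 approximates the cube
  root of 10.\<close>

lemma second_moment_diff:
  assumes "l \<in> E" "l' \<in> E"
  shows "(\<integral>\<^sup>+p. ennreal ((real_of_int (fst p) - real_of_int (snd p))\<^sup>2) \<partial>pair_pmf (Q l) (Q l')) \<le> ennreal (4.65 * \<theta>\<^sup>2)"
proof -
  have "(\<integral>\<^sup>+p. ennreal ((real_of_int (fst p) - real_of_int (snd p))\<^sup>2) \<partial>pair_pmf (Q l) (Q l'))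
      \<le> ennreal (2 * (10 * \<zeta>) / (3 * (2.15 * \<theta>)) + (2.15 * \<theta>)\<^sup>2 / 3)"
    using theta_ge_1 zeta_ge_1 by (intro second_moment_from_third third_moment_diff assms) auto
  also have "2 * (10 * \<zeta>) / (3 * (2.15 * \<theta>)) + (2.15 * \<theta>)\<^sup>2 / 3 \<le> 4.65 * \<theta>\<^sup>2"
    using theta_ge_1 by (simp add: theta_cube[symmetric] power2_eq_square power3_eq_cube field_simps)
  finally show ?thesis by (simp add: ennreal_leI)
qed

text \<open>Serves integrability only, hence the unrefined constant.\<close>

lemma second_moment:
  assumes "l \<in> E"
  shows "(\<integral>\<^sup>+y. ennreal ((real_of_int y)\<^sup>2) \<partial>Q l) \<le> ennreal (2 * \<theta>\<^sup>2)"
proof -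
  have "(\<integral>\<^sup>+y. ennreal ((real_of_int y)\<^sup>2) \<partial>Q l)
      \<le> ennreal (2 * (2 * \<zeta>) / (3 * \<theta>) + \<theta>\<^sup>2 / 3)"
    using theta_ge_1 zeta_ge_1 by (intro second_moment_from_third third_moment assms) auto
  also have "2 * (2 * \<zeta>) / (3 * \<theta>) + \<theta>\<^sup>2 / 3 \<le> 2 * \<theta>\<^sup>2"
    using theta_ge_1 by (simp add: theta_cube[symmetric] power2_eq_square power3_eq_cube field_simps)
  finally show ?thesis by (simp add: ennreal_leI)
qed

end

section \<open>Auxiliary facts on discrete expectations\<close>

lemma bind_pair_pmf_fst: "bind_pmf (pair_pmf p q) (\<lambda>z. f (fst z)) = bind_pmf p f"
  using bind_map_pmf[of fst "pair_pmf p q" f] by (simp add: map_fst_pair_pmf)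

lemma map_swap_pair_pmf: "map_pmf prod.swap (pair_pmf p q) = pair_pmf q p"
  by (subst pair_commute_pmf) (simp add: map_pmf_comp split_beta)

lemma nn_integral_le_const_pmf:
  assumes "\<And>x. x \<in> set_pmf p \<Longrightarrow> f x \<le> c"
  shows "(\<integral>\<^sup>+x. f x \<partial>measure_pmf p) \<le> c"
proof -
  have "(\<integral>\<^sup>+x. f x \<partial>measure_pmf p) \<le> (\<integral>\<^sup>+x. c \<partial>measure_pmf p)"
    by (intro nn_integral_mono_AE) (simp add: AE_measure_pmf_iff assms)
  then show ?thesis by simp
qed

lemma nn_integral_ge_const_pmf:
  assumes "\<And>x. x \<in> set_pmf p \<Longrightarrow> c \<le> f x"
  shows "c \<le> (\<integral>\<^sup>+x. f x \<partial>measure_pmf p)"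
proof -
  have "(\<integral>\<^sup>+x. c \<partial>measure_pmf p) \<le> (\<integral>\<^sup>+x. f x \<partial>measure_pmf p)"
    by (intro nn_integral_mono_AE) (simp add: AE_measure_pmf_iff assms)
  then show ?thesis by simp
qed

lemma nn_integral_mono_pmf:
  assumes "\<And>x. x \<in> set_pmf p \<Longrightarrow> f x \<le> g x"
  shows "(\<integral>\<^sup>+x. f x \<partial>measure_pmf p) \<le> (\<integral>\<^sup>+x. g x \<partial>measure_pmf p)"
  by (intro nn_integral_mono_AE) (simp add: AE_measure_pmf_iff assms)

lemma expectation_cong_pmf:
  fixes f g :: "'a \<Rightarrow> real"
  assumes "\<And>x. x \<in> set_pmf p \<Longrightarrow> f x = g x"
  shows "expect p f = expect p g"
  by (intro integral_cong_AE) (auto simp: AE_measure_pmf_iff assms)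

lemma ennreal_abs_add_le: "ennreal \<bar>a + b\<bar> \<le> ennreal \<bar>a\<bar> + ennreal \<bar>b\<bar>"
  using ennreal_leI[OF abs_triangle_ineq[of a b]] by simp

section \<open>Additive functionals of a chain\<close>

lemma joint_law_0 [simp]: "joint_law A Q s 0 = return_pmf (s, 0)"
  by (simp add: joint_law_def)

lemma joint_law_Suc:
  "joint_law A Q s (Suc m) = bind_pmf (A s) (\<lambda>x. bind_pmf (Q x) (\<lambda>y.
     map_pmf (\<lambda>p. (fst p, y + snd p)) (joint_law A Q x m)))"
  by (simp add: joint_law_def map_bind_pmf map_pmf_comp)
     (intro bind_pmf_cong map_pmf_cong refl, auto)

lemma joint_law_add:
  "joint_law A Q s (a + b) = bind_pmf (joint_law A Q s a) (\<lambda>p.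
     map_pmf (\<lambda>p'. (fst p', snd p + snd p')) (joint_law A Q (fst p) b))"
proof (induction a arbitrary: s)
  case 0
  then show ?case by (simp add: bind_return_pmf)
next
  case (Suc a)
  show ?case
    by (simp add: joint_law_Suc Suc.IH map_bind_pmf bind_map_pmf bind_assoc_pmf map_pmf_comp add.assoc)
qed

definition sumlaw :: "(nat \<Rightarrow> nat pmf) \<Rightarrow> (nat \<Rightarrow> int pmf) \<Rightarrow> nat \<Rightarrow> nat \<Rightarrow> int pmf" where
  "sumlaw A Q m x = map_pmf snd (joint_law A Q x m)"

lemma sumlaw_0 [simp]: "sumlaw A Q 0 x = return_pmf 0"
  by (simp add: sumlaw_def)

lemma sumlaw_Suc:
  "sumlaw A Q (Suc m) x = bind_pmf (A x) (\<lambda>z. bind_pmf (Q z) (\<lambda>y. map_pmf ((+) y) (sumlaw A Q m z)))"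
  by (simp add: sumlaw_def joint_law_Suc map_bind_pmf map_pmf_comp)

lemma sumlaw_add:
  "sumlaw A Q (a + b) x = bind_pmf (joint_law A Q x a) (\<lambda>p. map_pmf ((+) (snd p)) (sumlaw A Q b (fst p)))"
  by (simp add: sumlaw_def joint_law_add map_bind_pmf map_pmf_comp)

text \<open>The increments of two independent copies of the observed chain, recorded up to and including
  the first time at which both chains are in state 0, or for \<open>m\<close> steps if that happens earlier.\<close>

fun meet :: "(nat \<Rightarrow> nat pmf) \<Rightarrow> (nat \<Rightarrow> int pmf) \<Rightarrow> nat \<Rightarrow> nat \<times> nat \<Rightarrow> (int \<times> int) list pmf" where
  "meet A Q 0 s = return_pmf []"
| "meet A Q (Suc m) s = (if s = (0, 0) then return_pmf [] else
     bind_pmf (pair_kernel A s) (\<lambda>z. bind_pmf (pair_pmf (Q (fst z)) (Q (snd z))) (\<lambda>p.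
       map_pmf ((#) p) (meet A Q m z))))"

lemma length_meet: "l \<in> set_pmf (meet A Q m s) \<Longrightarrow> length l \<le> m"
  by (induction m arbitrary: s l) (auto split: if_splits)

text \<open>The stopping state (0, 0) is symmetric, so exchangeability of the two copies survives
  the stopping rule. This transfers facts from the first copy to the second and leads to
  \<open>pair_law_swap\<close>.\<close>

lemma meet_swap: "map_pmf (map prod.swap) (meet A Q m s) = meet A Q m (prod.swap s)"
proof (induction m arbitrary: s)
  case (Suc m)
  show ?case
  proof (cases "s = (0, 0)")
    case False
    then have "prod.swap s \<noteq> (0, 0)" by (metis swap_simp swap_swap)
    have "map_pmf (map prod.swap) (meet A Q (Suc m) s)
       = bind_pmf (pair_kernel A s) (\<lambda>z. bind_pmf (pair_pmf (Q (fst z)) (Q (snd z))) (\<lambda>p.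
          map_pmf ((#) (prod.swap p)) (meet A Q m (prod.swap z))))"
      using False by (simp add: map_bind_pmf map_pmf_comp Suc.IH[symmetric])
    also have "\<dots> = bind_pmf (pair_kernel A s) (\<lambda>z. bind_pmf (map_pmf prod.swap (pair_pmf (Q (fst z)) (Q (snd z)))) (\<lambda>p.
          map_pmf ((#) p) (meet A Q m (prod.swap z))))"
      by (simp add: bind_map_pmf)
    also have "\<dots> = bind_pmf (map_pmf prod.swap (pair_kernel A s)) (\<lambda>z. bind_pmf (pair_pmf (Q (fst z)) (Q (snd z))) (\<lambda>p.
          map_pmf ((#) p) (meet A Q m z)))"
      unfolding map_swap_pair_pmf by (simp add: bind_map_pmf)
    also have "map_pmf prod.swap (pair_kernel A s) = pair_kernel A (prod.swap s)"
      by (simp add: pair_kernel_def map_swap_pair_pmf)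
    finally show ?thesis using \<open>prod.swap s \<noteq> (0, 0)\<close> by simp
  qed auto
qed simp

text \<open>Strong Markov property at the meeting time.\<close>

lemma meet_continue_fst:
  "bind_pmf (meet A Q m (x, x')) (\<lambda>l. map_pmf ((+) (sum_list (map fst l))) (sumlaw A Q (m - length l) 0))
   = sumlaw A Q m x"
proof (induction m arbitrary: x x')
  case 0
  then show ?case by (simp add: bind_return_pmf)
next
  case (Suc m)
  show ?case
  proof (cases "(x, x') = (0, 0)")
    case True
    have "((+) 0) = (id :: int \<Rightarrow> int)" by auto
    with True show ?thesis by (simp add: bind_return_pmf pmf.map_id)
  next
    case False
    have IH: "bind_pmf (meet A Q m z) (\<lambda>l. map_pmf ((+) (y + sum_list (map fst l))) (sumlaw A Q (m - length l) 0))
       = map_pmf ((+) y) (sumlaw A Q m (fst z))" for z y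
      using arg_cong[OF Suc.IH[of "fst z" "snd z"], of "map_pmf ((+) y)"]
      by (simp add: map_bind_pmf map_pmf_comp add.assoc[symmetric])
    have "bind_pmf (meet A Q (Suc m) (x, x')) (\<lambda>l. map_pmf ((+) (sum_list (map fst l))) (sumlaw A Q (Suc m - length l) 0))
       = bind_pmf (pair_kernel A (x, x')) (\<lambda>z. bind_pmf (pair_pmf (Q (fst z)) (Q (snd z))) (\<lambda>p.
            map_pmf ((+) (fst p)) (sumlaw A Q m (fst z))))"
      using False by (auto simp: bind_assoc_pmf bind_map_pmf IH)
    also have "\<dots> = sumlaw A Q (Suc m) x"
      by (simp add: bind_pair_pmf_fst[of _ _ "\<lambda>y. map_pmf ((+) y) (sumlaw A Q m _)"] sumlaw_Suc pair_kernel_def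
          bind_pair_pmf_fst[of _ _ "\<lambda>z. bind_pmf (Q z) (\<lambda>y. map_pmf ((+) y) (sumlaw A Q m z))"])
    finally show ?thesis .
  qed
qed

lemma meet_continue_snd:
  "bind_pmf (meet A Q m (x, x')) (\<lambda>l. map_pmf ((+) (sum_list (map snd l))) (sumlaw A Q (m - length l) 0))
   = sumlaw A Q m x'"
proof -
  have "sumlaw A Q m x' = bind_pmf (map_pmf (map prod.swap) (meet A Q m (x, x')))
     (\<lambda>l. map_pmf ((+) (sum_list (map fst l))) (sumlaw A Q (m - length l) 0))"
    unfolding meet_swap using meet_continue_fst[of A Q m x' x] by simp
  then show ?thesis by (simp add: bind_map_pmf comp_def)
qed

section \<open>Hitting times of the pair chain\<close>

lemma avoid_bounds: "0 \<le> avoid K s0 m s \<and> avoid K s0 m s \<le> 1"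
proof (induction m arbitrary: s)
  case (Suc m)
  have "\<bar>expect (K s) (avoid K s0 m)\<bar> \<le> 1"
    by (rule abs_expectation_le_const) (use Suc in \<open>simp add: abs_le_iff order_trans[of "- 1" 0]\<close>)
  moreover have "0 \<le> expect (K s) (avoid K s0 m)"
    by (rule integral_nonneg_AE) (use Suc in auto)
  ultimately show ?case by auto
qed simp

lemma integrable_avoid: "integrable (measure_pmf p) (avoid K s0 m)"
  by (rule integrable_bounded_pmf[where B = 1])
     (use avoid_bounds[of K s0 m] in \<open>simp add: abs_le_iff order_trans[of "- 1" 0]\<close>)

lemma avoid_Suc_le: "avoid K s0 (Suc m) s \<le> avoid K s0 m s"
proof (induction m arbitrary: s)
  case 0
  then show ?case using avoid_bounds[of K s0 "Suc 0" s] by simp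
next
  case (Suc m)
  have "expect (K s) (avoid K s0 (Suc m)) \<le> expect (K s) (avoid K s0 m)"
    by (intro integral_mono integrable_avoid Suc)
  then show ?case by (cases "s = s0") (simp_all only: avoid.simps(2) if_True if_False order_refl simp_thms)
qed

text \<open>The law of the hitting time of (0, 0) from \<open>s\<close>, recovered from its tails:
  \<open>avoid\<close> at \<open>a\<close> is the probability that this time is at least
  \<open>a\<close>.\<close>

definition hit :: "(nat \<Rightarrow> nat pmf) \<Rightarrow> nat \<times> nat \<Rightarrow> nat pmf" where
  "hit A s = embed_pmf (\<lambda>a. avoid (pair_kernel A) (0, 0) a s - avoid (pair_kernel A) (0, 0) (Suc a) s)"

text \<open>Made to be instantiated twice, by the kernel \<open>P\<close> and by its time reversal,
  which share the stationary law.\<close>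

locale stationary_kernel =
  fixes E :: "nat set" and A :: "nat \<Rightarrow> nat pmf" and Q :: "nat \<Rightarrow> int pmf" and \<pi> :: "nat pmf"
    and C \<rho> :: real
  assumes closed: "\<And>x. x \<in> E \<Longrightarrow> set_pmf (A x) \<subseteq> E"
    and supp: "set_pmf \<pi> \<subseteq> E"
    and stat: "bind_pmf \<pi> A = \<pi>"
    and zero: "0 \<in> E"
    and rho: "1 < \<rho>"
    and decay: "\<And>m s. s \<in> E \<times> E \<Longrightarrow> avoid (pair_kernel A) (0, 0) m s \<le> C * \<rho> powr (- real m)"
begin

lemma pair_closed: "s \<in> E \<times> E \<Longrightarrow> z \<in> set_pmf (pair_kernel A s) \<Longrightarrow> z \<in> E \<times> E"
  using closed by (force simp: pair_kernel_def)

lemma avoid_tendsto_0: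
  assumes "s \<in> E \<times> E"
  shows "(\<lambda>m. avoid (pair_kernel A) (0, 0) m s) \<longlonglongrightarrow> 0"
proof (rule tendsto_sandwich[OF _ _ tendsto_const])
  show "(\<lambda>m. C * (1 / \<rho>) ^ m) \<longlonglongrightarrow> 0"
    using rho by (intro tendsto_mult_right_zero LIMSEQ_realpow_zero) auto
  show "\<forall>\<^sub>F m in sequentially. avoid (pair_kernel A) (0, 0) m s \<le> C * (1 / \<rho>) ^ m"
    using decay[OF assms] rho by (simp add: powr_minus powr_realpow power_one_over inverse_eq_divide)
  show "\<forall>\<^sub>F m in sequentially. 0 \<le> avoid (pair_kernel A) (0, 0) m s"
    by (intro always_eventually allI conjunct1[OF avoid_bounds])
qed

text \<open>The weights telescope to 1 minus the limit of the tails, and geometric decay makes that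
  limit 0: the copies meet almost surely.\<close>

lemma pmf_hit:
  assumes "s \<in> E \<times> E"
  shows "pmf (hit A s) a = avoid (pair_kernel A) (0, 0) a s - avoid (pair_kernel A) (0, 0) (Suc a) s"
  unfolding hit_def
proof (rule pmf_embed_pmf)
  let ?f = "\<lambda>a. avoid (pair_kernel A) (0, 0) a s"
  show nn: "0 \<le> ?f a - ?f (Suc a)" for a
    using avoid_Suc_le[of "pair_kernel A" "(0, 0)" a s] by linarith
  have "(\<lambda>a. ?f a - ?f (Suc a)) sums (?f 0 - 0)"
    by (rule telescope_sums'[OF avoid_tendsto_0[OF assms]])
  then have "(\<lambda>a. ?f a - ?f (Suc a)) sums 1" by (simp only: avoid.simps(1) diff_zero)
  from suminf_ennreal_eq[OF nn this]
  show "(\<integral>\<^sup>+a. ennreal (?f a - ?f (Suc a)) \<partial>count_space UNIV) = 1"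
    unfolding nn_integral_count_space_nat by (simp only: ennreal_1)
qed

lemma hit_rec:
  assumes s: "s \<in> E \<times> E"
  shows "hit A s = (if s = (0, 0) then return_pmf 0 else bind_pmf (pair_kernel A s) (\<lambda>z. map_pmf Suc (hit A z)))"
proof (rule pmf_eqI)
  fix a
  show "pmf (hit A s) a = pmf (if s = (0, 0) then return_pmf 0
      else bind_pmf (pair_kernel A s) (\<lambda>z. map_pmf Suc (hit A z))) a"
  proof (cases "s = (0, 0)")
    case True
    then show ?thesis using s by (cases a) (auto simp: pmf_hit)
  next
    case False
    show ?thesis
    proof (cases a)
      case 0
      have "pmf (map_pmf Suc (hit A z)) 0 = 0" for z by (simp add: pmf_map_outside)
      moreover have "avoid (pair_kernel A) (0, 0) 0 = (\<lambda>_. 1)" by (rule ext) simp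
      ultimately show ?thesis using 0 False s by (simp add: pmf_hit pmf_bind)
    next
      case (Suc b)
      have "pmf (map_pmf Suc (hit A z)) (Suc b) = pmf (hit A z) b" for z
        by (rule pmf_map_inj') simp
      then have "pmf (bind_pmf (pair_kernel A s) (\<lambda>z. map_pmf Suc (hit A z))) a
         = expect (pair_kernel A s) (\<lambda>z. pmf (hit A z) b)"
        by (simp add: pmf_bind Suc)
      also have "\<dots> = expect (pair_kernel A s) (\<lambda>z. avoid (pair_kernel A) (0, 0) b z - avoid (pair_kernel A) (0, 0) (Suc b) z)"
        by (intro expectation_cong_pmf pmf_hit pair_closed[OF s])
      also have "\<dots> = pmf (hit A s) a"
        using False
        by (subst Bochner_Integration.integral_diff)
           (simp_all only: integrable_avoid pmf_hit[OF s] Suc avoid.simps(2) if_False)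
      finally show ?thesis using False by simp
    qed
  qed
qed

lemma length_meet_eq_hit:
  assumes "s \<in> E \<times> E"
  shows "map_pmf length (meet A Q m s) = map_pmf (min m) (hit A s)"
  using assms
proof (induction m arbitrary: s)
  case 0
  then show ?case by (simp add: map_pmf_const)
next
  case (Suc m)
  show ?case
  proof (cases "s = (0, 0)")
    case True
    then show ?thesis using Suc.prems by (simp add: hit_rec)
  next
    case False
    have "map_pmf length (meet A Q (Suc m) s) = bind_pmf (pair_kernel A s) (\<lambda>z. map_pmf Suc (map_pmf length (meet A Q m z)))"
      using False by (simp add: map_bind_pmf map_pmf_comp)
    also have "\<dots> = bind_pmf (pair_kernel A s) (\<lambda>z. map_pmf Suc (map_pmf (min m) (hit A z)))"
      by (intro bind_pmf_cong refl arg_cong[where f = "map_pmf Suc"] Suc.IH pair_closed[OF Suc.prems])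
    also have "\<dots> = map_pmf (min (Suc m)) (hit A s)"
      using False by (subst hit_rec[OF Suc.prems]) (simp add: map_bind_pmf map_pmf_comp)
    finally show ?thesis .
  qed
qed

lemma nn_integral_length_meet_le:
  assumes "s \<in> E \<times> E" "mono f"
  shows "(\<integral>\<^sup>+l. f (length l) \<partial>meet A Q m s) \<le> (\<integral>\<^sup>+a. f a \<partial>hit A s)"
proof -
  have "(\<integral>\<^sup>+l. f (length l) \<partial>meet A Q m s) = (\<integral>\<^sup>+a. f a \<partial>map_pmf length (meet A Q m s))" by simp
  also have "\<dots> = (\<integral>\<^sup>+a. f (min m a) \<partial>hit A s)" unfolding length_meet_eq_hit[OF assms(1)] by simp
  also have "\<dots> \<le> (\<integral>\<^sup>+a. f a \<partial>hit A s)" by (intro nn_integral_mono monoD[OF assms(2)]) simp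
  finally show ?thesis .
qed

text \<open>A Wald-type inequality. When to stop is decided by the states, so given these each
  recorded pair of observations can be averaged separately, at cost \<open>M\<close>, even in the
  presence of a weight on the length. The weight is arbitrary because the induction shifts it by
  one.\<close>

lemma nn_integral_meet_sum:
  fixes \<phi> :: "int \<times> int \<Rightarrow> ennreal" and f :: "nat \<Rightarrow> ennreal"
  assumes M: "\<And>l l'. l \<in> E \<Longrightarrow> l' \<in> E \<Longrightarrow> (\<integral>\<^sup>+p. \<phi> p \<partial>pair_pmf (Q l) (Q l')) \<le> M"
    and s: "s \<in> E \<times> E"
  shows "(\<integral>\<^sup>+l. sum_list (map \<phi> l) * f (length l) \<partial>meet A Q m s)
       \<le> M * (\<integral>\<^sup>+l. of_nat (length l) * f (length l) \<partial>meet A Q m s)"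
  using s
proof (induction m arbitrary: s f)
  case (Suc m)
  show ?case
  proof (cases "s = (0, 0)")
    case False
    let ?F = "\<lambda>z. \<integral>\<^sup>+l. f (Suc (length l)) \<partial>meet A Q m z"
    let ?G = "\<lambda>z. \<integral>\<^sup>+l. of_nat (length l) * f (Suc (length l)) \<partial>meet A Q m z"
    have "(\<integral>\<^sup>+l. sum_list (map \<phi> l) * f (length l) \<partial>meet A Q (Suc m) s)
      = (\<integral>\<^sup>+z. (\<integral>\<^sup>+p. \<phi> p \<partial>pair_pmf (Q (fst z)) (Q (snd z))) * ?F z
          + (\<integral>\<^sup>+l. sum_list (map \<phi> l) * f (Suc (length l)) \<partial>meet A Q m z) \<partial>pair_kernel A s)"
      using False by (simp add: distrib_right nn_integral_add nn_integral_cmult nn_integral_multc)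
    also have "\<dots> \<le> (\<integral>\<^sup>+z. M * ?F z + M * ?G z \<partial>pair_kernel A s)"
    proof (rule nn_integral_mono_pmf)
      fix z assume "z \<in> set_pmf (pair_kernel A s)"
      then have z: "z \<in> E \<times> E" by (rule pair_closed[OF Suc.prems])
      show "(\<integral>\<^sup>+p. \<phi> p \<partial>pair_pmf (Q (fst z)) (Q (snd z))) * ?F z
          + (\<integral>\<^sup>+l. sum_list (map \<phi> l) * f (Suc (length l)) \<partial>meet A Q m z) \<le> M * ?F z + M * ?G z"
        using z Suc.IH[OF z, of "\<lambda>k. f (Suc k)"] by (intro add_mono mult_right_mono M) auto
    qed
    also have "\<dots> = M * (\<integral>\<^sup>+z. ?F z + ?G z \<partial>pair_kernel A s)"
      by (simp add: distrib_left[symmetric] nn_integral_cmult)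
    also have "\<dots> = M * (\<integral>\<^sup>+l. of_nat (length l) * f (length l) \<partial>meet A Q (Suc m) s)"
      using False by (simp add: distrib_right nn_integral_add nn_integral_cmult)
    finally show ?thesis .
  qed simp
qed simp

text \<open>From \<open>(y, x)\<close> with \<open>y \<noteq> 0\<close> the pair can only meet after the first chain has reached 0, and at that
  time the second chain is still stationary.\<close>

lemma mean_length_meet_0_le:
  assumes "y \<in> E"
  shows "(\<integral>\<^sup>+x. \<integral>\<^sup>+l. of_nat (length l) \<partial>meet A Q m (0, x) \<partial>\<pi>)
       \<le> (\<integral>\<^sup>+x. \<integral>\<^sup>+l. of_nat (length l) \<partial>meet A Q m (y, x) \<partial>\<pi>)"
  using assms
proof (induction m arbitrary: y)
  case (Suc m)
  define L where "L m y = bind_pmf \<pi> (\<lambda>x. map_pmf length (meet A Q m (y, x)))" for m y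
  define \<mu> :: "nat \<Rightarrow> nat \<Rightarrow> ennreal" where "\<mu> m y = (\<integral>\<^sup>+k. of_nat k \<partial>L m y)" for m y
  have \<mu>: "\<mu> m y = (\<integral>\<^sup>+x. \<integral>\<^sup>+l. of_nat (length l) \<partial>meet A Q m (y, x) \<partial>\<pi>)" for m y
    by (simp add: \<mu>_def L_def)
  have IH: "\<mu> m 0 \<le> \<mu> m a" if "a \<in> E" for a unfolding \<mu> by (rule Suc.IH[OF that])
  show ?case
  proof (cases "y = 0")
    case False
    have "L (Suc m) y = bind_pmf \<pi> (\<lambda>x. bind_pmf (A y) (\<lambda>a. bind_pmf (A x) (\<lambda>b. map_pmf Suc (map_pmf length (meet A Q m (a, b))))))"
      using False by (simp add: L_def map_bind_pmf map_pmf_comp pair_kernel_def pair_pmf_def bind_assoc_pmf bind_return_pmf)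
    also have "\<dots> = bind_pmf (A y) (\<lambda>a. bind_pmf (bind_pmf \<pi> A) (\<lambda>b. map_pmf Suc (map_pmf length (meet A Q m (a, b)))))"
      by (subst bind_commute_pmf) (simp add: bind_assoc_pmf)
    also have "\<dots> = bind_pmf (A y) (\<lambda>a. map_pmf Suc (L m a))"
      unfolding stat L_def map_bind_pmf ..
    finally have "\<mu> (Suc m) y = 1 + (\<integral>\<^sup>+a. \<mu> m a \<partial>A y)"
      by (simp add: \<mu>_def nn_integral_add)
    moreover have "\<mu> m 0 \<le> (\<integral>\<^sup>+a. \<mu> m a \<partial>A y)"
      using closed[OF Suc.prems] by (intro nn_integral_ge_const_pmf IH) auto
    moreover have "\<mu> (Suc m) 0 \<le> 1 + \<mu> m 0"
    proof -
      have "\<mu> (Suc m) 0 \<le> (\<integral>\<^sup>+x. 1 + (\<integral>\<^sup>+l. of_nat (length l) \<partial>meet A Q m (0, x)) \<partial>\<pi>)"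
        unfolding \<mu>
      proof (rule nn_integral_mono_pmf)
        fix x assume "x \<in> set_pmf \<pi>"
        then have s: "(0, x) \<in> E \<times> E" using supp zero by auto
        have e: "(\<integral>\<^sup>+l. of_nat (length l) \<partial>meet A Q k (0, x)) = (\<integral>\<^sup>+a. of_nat (min k a) \<partial>hit A (0, x))" for k
        proof -
          have "(\<integral>\<^sup>+l. of_nat (length l) \<partial>meet A Q k (0, x)) = (\<integral>\<^sup>+a. of_nat a \<partial>map_pmf length (meet A Q k (0, x)))" by simp
          then show ?thesis unfolding length_meet_eq_hit[OF s] by simp
        qed
        have "(\<integral>\<^sup>+a. of_nat (min (Suc m) a) \<partial>hit A (0, x)) \<le> (\<integral>\<^sup>+a. 1 + of_nat (min m a) \<partial>hit A (0, x))"
        proof (rule nn_integral_mono)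
          fix a
          have "min (Suc m) a \<le> 1 + min m a" by auto
          then have "of_nat (min (Suc m) a) \<le> (of_nat (1 + min m a) :: ennreal)" by (simp only: of_nat_le_iff)
          then show "of_nat (min (Suc m) a) \<le> (1 + of_nat (min m a) :: ennreal)" by simp
        qed
        then show "(\<integral>\<^sup>+l. of_nat (length l) \<partial>meet A Q (Suc m) (0, x))
           \<le> 1 + (\<integral>\<^sup>+l. of_nat (length l) \<partial>meet A Q m (0, x))"
          unfolding e by (simp add: nn_integral_add)
      qed
      then show ?thesis by (simp add: nn_integral_add \<mu>)
    qed
    ultimately show ?thesis unfolding \<mu>[symmetric] by (metis add_left_mono order_trans)
  qed simp
qed simp

text \<open>The previous lemma is averaged over \<open>y\<close> drawn from \<pi>. It brings a pair
  with one component restarted in 0 back to the stationary pair, the one that enters \<tau>.\<close>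

lemma mean_length_meet_le_hit:
  "(\<integral>\<^sup>+x. \<integral>\<^sup>+l. of_nat (length l) \<partial>meet A Q m (0, x) \<partial>\<pi>) \<le> (\<integral>\<^sup>+s. \<integral>\<^sup>+a. of_nat a \<partial>hit A s \<partial>pair_pmf \<pi> \<pi>)"
proof -
  have "(\<integral>\<^sup>+x. \<integral>\<^sup>+l. of_nat (length l) \<partial>meet A Q m (0, x) \<partial>\<pi>)
     \<le> (\<integral>\<^sup>+y. \<integral>\<^sup>+x. \<integral>\<^sup>+l. of_nat (length l) \<partial>meet A Q m (y, x) \<partial>\<pi> \<partial>\<pi>)"
    using supp by (intro nn_integral_ge_const_pmf mean_length_meet_0_le) auto
  also have "\<dots> = (\<integral>\<^sup>+s. \<integral>\<^sup>+l. of_nat (length l) \<partial>meet A Q m s \<partial>pair_pmf \<pi> \<pi>)"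
    by (simp add: nn_integral_pair_pmf')
  also have "\<dots> \<le> (\<integral>\<^sup>+s. \<integral>\<^sup>+a. of_nat a \<partial>hit A s \<partial>pair_pmf \<pi> \<pi>)"
    using supp by (intro nn_integral_mono_pmf nn_integral_length_meet_le) (auto simp: mono_def)
  finally show ?thesis .
qed

lemma joint_law_stationary: "bind_pmf \<pi> (\<lambda>x. map_pmf fst (joint_law A Q x m)) = \<pi>"
proof (induction m)
  case (Suc m)
  have "bind_pmf \<pi> (\<lambda>x. map_pmf fst (joint_law A Q x (Suc m)))
     = bind_pmf (bind_pmf \<pi> A) (\<lambda>x. map_pmf fst (joint_law A Q x m))"
    by (simp add: joint_law_Suc map_bind_pmf map_pmf_comp bind_assoc_pmf)
  then show ?case by (simp add: stat Suc)
qed (simp add: bind_return_pmf')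

lemma nn_integral_abs_joint_law:
  assumes e: "\<And>l. l \<in> E \<Longrightarrow> (\<integral>\<^sup>+y. ennreal \<bar>real_of_int y\<bar> \<partial>Q l) \<le> e" and x: "x \<in> E"
  shows "(\<integral>\<^sup>+p. ennreal \<bar>real_of_int (snd p)\<bar> \<partial>joint_law A Q x m) \<le> of_nat m * e"
  using x
proof (induction m arbitrary: x)
  case (Suc m)
  have "(\<integral>\<^sup>+p. ennreal \<bar>real_of_int (snd p)\<bar> \<partial>joint_law A Q x (Suc m))
     = (\<integral>\<^sup>+z. \<integral>\<^sup>+y. \<integral>\<^sup>+p. ennreal \<bar>real_of_int y + real_of_int (snd p)\<bar> \<partial>joint_law A Q z m \<partial>Q z \<partial>A x)"
    by (simp add: joint_law_Suc)
  also have "\<dots> \<le> (\<integral>\<^sup>+z. \<integral>\<^sup>+y. \<integral>\<^sup>+p. ennreal \<bar>real_of_int y\<bar> + ennreal \<bar>real_of_int (snd p)\<bar> \<partial>joint_law A Q z m \<partial>Q z \<partial>A x)"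
    by (intro nn_integral_mono ennreal_abs_add_le)
  also have "\<dots> = (\<integral>\<^sup>+z. (\<integral>\<^sup>+y. ennreal \<bar>real_of_int y\<bar> \<partial>Q z) + (\<integral>\<^sup>+p. ennreal \<bar>real_of_int (snd p)\<bar> \<partial>joint_law A Q z m) \<partial>A x)"
    by (simp add: nn_integral_add)
  also have "\<dots> \<le> e + of_nat m * e"
    using closed[OF Suc.prems] by (intro nn_integral_le_const_pmf add_mono e Suc.IH) auto
  finally show ?case by (simp add: distrib_right)
qed simp

text \<open>Deliberately crude, as finiteness is all that is wanted: each step uses (a + b)^2 <= 2
  a^2 + 2 b^2 and at most quadruples the bound.\<close>

lemma nn_integral_square_sumlaw:
  assumes e: "\<And>l. l \<in> E \<Longrightarrow> (\<integral>\<^sup>+y. ennreal ((real_of_int y)\<^sup>2) \<partial>Q l) \<le> e" and x: "x \<in> E"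
  shows "(\<integral>\<^sup>+w. ennreal ((real_of_int w)\<^sup>2) \<partial>sumlaw A Q m x) \<le> 4 ^ m * e"
  using x
proof (induction m arbitrary: x)
  case (Suc m)
  have "(\<integral>\<^sup>+w. ennreal ((real_of_int w)\<^sup>2) \<partial>sumlaw A Q (Suc m) x)
     = (\<integral>\<^sup>+z. \<integral>\<^sup>+y. \<integral>\<^sup>+w. ennreal ((real_of_int y + real_of_int w)\<^sup>2) \<partial>sumlaw A Q m z \<partial>Q z \<partial>A x)"
    by (simp add: sumlaw_Suc)
  also have "\<dots> \<le> (\<integral>\<^sup>+z. \<integral>\<^sup>+y. \<integral>\<^sup>+w. 2 * ennreal ((real_of_int y)\<^sup>2) + 2 * ennreal ((real_of_int w)\<^sup>2) \<partial>sumlaw A Q m z \<partial>Q z \<partial>A x)"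
  proof (intro nn_integral_mono)
    fix y w :: int
    have "0 \<le> (real_of_int y - real_of_int w)\<^sup>2" by simp
    then have "(real_of_int y + real_of_int w)\<^sup>2 \<le> 2 * (real_of_int y)\<^sup>2 + 2 * (real_of_int w)\<^sup>2"
      by (simp add: power2_eq_square algebra_simps)
    then have "ennreal ((real_of_int y + real_of_int w)\<^sup>2) \<le> ennreal (2 * (real_of_int y)\<^sup>2 + 2 * (real_of_int w)\<^sup>2)"
      by (rule ennreal_leI)
    then show "ennreal ((real_of_int y + real_of_int w)\<^sup>2) \<le> 2 * ennreal ((real_of_int y)\<^sup>2) + 2 * ennreal ((real_of_int w)\<^sup>2)"
      by (simp add: ennreal_mult')
  qed
  also have "\<dots> = (\<integral>\<^sup>+z. 2 * (\<integral>\<^sup>+y. ennreal ((real_of_int y)\<^sup>2) \<partial>Q z) + 2 * (\<integral>\<^sup>+w. ennreal ((real_of_int w)\<^sup>2) \<partial>sumlaw A Q m z) \<partial>A x)"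
    by (simp add: nn_integral_add nn_integral_cmult)
  also have "\<dots> \<le> 2 * e + 2 * (4 ^ m * e)"
    using closed[OF Suc.prems] by (intro nn_integral_le_const_pmf add_mono mult_left_mono e Suc.IH) auto
  also have "\<dots> \<le> 2 * (4 ^ m * e) + 2 * (4 ^ m * e)"
  proof -
    have "1 * e \<le> 4 ^ m * e" by (intro mult_right_mono one_le_power) auto
    then show ?thesis by (intro add_mono mult_left_mono) auto
  qed
  also have "\<dots> = 4 ^ Suc m * e"
  proof -
    have "(4::ennreal) ^ Suc m = 2 * 4 ^ m + 2 * 4 ^ m" by (subst distrib_right[symmetric]) simp
    then show ?thesis by (simp only: distrib_right mult.assoc)
  qed
  finally show ?case .
qed simp


end

section \<open>Finite second moments of hitting times; smoothness of partial sums\<close>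

context stationary_kernel begin

text \<open>Geometric tails are compared with the twice differentiated geometric series, whose
  coefficients (a + 1)(a + 2) dominate (a + 1)^2.\<close>

lemma hit_second_moment:
  "\<exists>B. \<forall>s\<in>E \<times> E. (\<integral>\<^sup>+a. ennreal ((real a + 1)\<^sup>2) \<partial>hit A s) \<le> ennreal B"
proof -
  define x where "x = 1 / \<rho>"
  have x: "0 < x" "x < 1" using rho by (auto simp: x_def)
  have C: "0 \<le> C" using decay[of "(0, 0)" 0] zero rho by auto
  have 0: "summable (\<lambda>n. 1 * y ^ n)" if "norm y < 1" for y :: real
    using that by (simp add: summable_geometric)
  have 1: "summable (\<lambda>n. diffs (\<lambda>_. 1) n * y ^ n)" if "norm y < 1" for y :: real
    using that 0 by (intro termdiff_converges[where K = 1]) auto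
  have "summable (\<lambda>n. diffs (diffs (\<lambda>_. 1)) n * x ^ n)"
    using x 1 by (intro termdiff_converges[where K = 1]) auto
  then have "summable (\<lambda>n. C * (diffs (diffs (\<lambda>_. 1)) n * x ^ n))" by (rule summable_mult)
  then have sm: "summable (\<lambda>n. C * (real (Suc n) * real (Suc (Suc n)) * x ^ n))"
    by (simp add: diffs_def)
  define B where "B = (\<Sum>n. C * (real (Suc n) * real (Suc (Suc n)) * x ^ n))"
  have "(\<integral>\<^sup>+a. ennreal ((real a + 1)\<^sup>2) \<partial>hit A s) \<le> ennreal B" if s: "s \<in> E \<times> E" for s
  proof -
    have "(\<integral>\<^sup>+a. ennreal ((real a + 1)\<^sup>2) \<partial>hit A s)
       = (\<Sum>a. ennreal (pmf (hit A s) a) * ennreal ((real a + 1)\<^sup>2))"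
      by (simp add: nn_integral_measure_pmf nn_integral_count_space_nat)
    also have "\<dots> \<le> (\<Sum>n. ennreal (C * (real (Suc n) * real (Suc (Suc n)) * x ^ n)))"
    proof (intro suminf_le)
      fix a
      have "pmf (hit A s) a \<le> avoid (pair_kernel A) (0, 0) a s"
        unfolding pmf_hit[OF s] using avoid_bounds[of "pair_kernel A" "(0, 0)" "Suc a" s] by linarith
      also have "\<dots> \<le> C * x ^ a"
        using decay[OF s, of a] rho by (simp add: x_def powr_minus powr_realpow power_one_over inverse_eq_divide)
      finally have "pmf (hit A s) a * (real a + 1)\<^sup>2 \<le> (C * x ^ a) * (real (Suc a) * real (Suc (Suc a)))"
        using C x by (intro mult_mono) (auto simp: power2_eq_square algebra_simps)
      then have "ennreal (pmf (hit A s) a * (real a + 1)\<^sup>2) \<le> ennreal (C * (real (Suc a) * real (Suc (Suc a)) * x ^ a))"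
        by (intro ennreal_leI) (simp add: mult_ac)
      then show "ennreal (pmf (hit A s) a) * ennreal ((real a + 1)\<^sup>2) \<le> ennreal (C * (real (Suc a) * real (Suc (Suc a)) * x ^ a))"
        by (simp add: ennreal_mult' pmf_nonneg del: of_nat_Suc)
    qed auto
    also have "\<dots> = ennreal B"
      unfolding B_def using C x by (intro suminf_ennreal2 sm) auto
    finally show ?thesis .
  qed
  then show ?thesis by blast
qed

lemma beta_nonneg: "0 \<le> beta A Q m"
  by (simp add: beta_def tv_norm_nonneg)

text \<open>Given the first \<open>m\<close> steps, the remaining ones turn \<open>F\<close> into a
  function of the state and the partial sum reached, still bounded by \<open>B\<close>. The unit
  shift can be moved to that partial sum, which is why \<open>beta\<close> compares laws of pairs
  and not of sums alone.\<close>

lemma smooth_sumlaw: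
  fixes F :: "int \<Rightarrow> real"
  assumes "m \<le> q" and F: "\<And>w. \<bar>F w\<bar> \<le> B"
  shows "\<bar>expect (sumlaw A Q q 0) (\<lambda>w. F (w + 1)) - expect (sumlaw A Q q 0) F\<bar>
      \<le> B * beta A Q m"
proof -
  define G where "G p = expect (sumlaw A Q (q - m) (fst p)) (\<lambda>w. F (snd p + w))" for p :: "nat \<times> int"
  have split: "sumlaw A Q q 0 = bind_pmf (joint_law A Q 0 m) (\<lambda>p. map_pmf ((+) (snd p)) (sumlaw A Q (q - m) (fst p)))"
    using sumlaw_add[of A Q m "q - m" 0] assms(1) by simp
  have "expect (sumlaw A Q q 0) F = expect (joint_law A Q 0 m) G"
    unfolding split G_def by (subst integral_bind_pmf) (auto intro: integrable_bounded_pmf F)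
  moreover have "expect (sumlaw A Q q 0) (\<lambda>w. F (w + 1))
      = expect (map_pmf (\<lambda>(x, w). (x, 1 + w)) (joint_law A Q 0 m)) G"
    unfolding split G_def
    by (subst integral_bind_pmf) (auto intro: integrable_bounded_pmf F simp: split_beta add_ac)
  moreover have "\<bar>G p\<bar> \<le> B" for p unfolding G_def by (rule abs_expectation_le_const) (rule F)
  ultimately show ?thesis
    unfolding beta_def
    using expectation_diff_le_tv_norm[of G B "map_pmf (\<lambda>(x, w). (x, 1 + w)) (joint_law A Q 0 m)" "joint_law A Q 0 m"]
    by presburger
qed

text \<open>The test function is a step from 1 to -1 just after \<open>v\<close>: a unit shift
  changes it by 2 exactly when the sum equals \<open>v\<close>.\<close>

lemma pmf_sumlaw_le_beta: "2 * pmf (sumlaw A Q m 0) v \<le> beta A Q m"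
proof -
  define f :: "nat \<times> int \<Rightarrow> real" where "f p = (if snd p \<le> v then 1 else - 1)" for p
  let ?J = "joint_law A Q 0 m" and ?J1 = "map_pmf (\<lambda>(x, w). (x, 1 + w)) (joint_law A Q 0 m)"
  have f: "\<bar>f p\<bar> \<le> 1" for p by (simp add: f_def)
  have "\<bar>expect ?J1 f - expect ?J f\<bar> \<le> 1 * tv_norm ?J1 ?J"
    by (rule expectation_diff_le_tv_norm[OF f])
  moreover have "expect ?J f - expect ?J1 f
      = expect ?J (\<lambda>p. f p - f (fst p, 1 + snd p))"
    by (subst Bochner_Integration.integral_diff)
       (auto intro!: integrable_bounded_pmf[of _ 1] f simp: split_beta)
  moreover have "(\<lambda>p. f p - f (fst p, 1 + snd p)) = (\<lambda>p. 2 * indicator {p. snd p = v} p)"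
    by (auto simp: f_def indicator_def fun_eq_iff)
  moreover have "prob ?J {p. snd p = v} = pmf (sumlaw A Q m 0) v"
    by (simp add: sumlaw_def pmf_map vimage_def)
  ultimately show ?thesis by (simp add: beta_def)
qed

end

section \<open>Small point masses force a large first absolute moment\<close>

lemma sum_tent: "(\<Sum>v\<in>{- int M..int M}. real M - \<bar>real_of_int v\<bar>) = (real M)\<^sup>2"
proof (induction M)
  case (Suc M)
  have "(\<Sum>v\<in>{- int (Suc M)..int (Suc M)}. real (Suc M) - \<bar>real_of_int v\<bar>)
      = (\<Sum>v\<in>{- int M..int M}. real (Suc M) - \<bar>real_of_int v\<bar>)"
  proof (rule sum.mono_neutral_right)
    show "\<forall>v\<in>{- int (Suc M)..int (Suc M)} - {- int M..int M}. real (Suc M) - \<bar>real_of_int v\<bar> = 0"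
    proof
      fix v assume "v \<in> {- int (Suc M)..int (Suc M)} - {- int M..int M}"
      then have "v = int (Suc M) \<or> v = - int (Suc M)" by auto
      then show "real (Suc M) - \<bar>real_of_int v\<bar> = 0" by auto
    qed
  qed auto
  also have "\<dots> = (\<Sum>v\<in>{- int M..int M}. (real M - \<bar>real_of_int v\<bar>) + 1)"
    by (intro sum.cong) auto
  also have "\<dots> = (real M)\<^sup>2 + real (card {- int M..int M})"
    unfolding sum.distrib Suc.IH by simp
  also have "\<dots> = (real (Suc M))\<^sup>2" by (simp add: power2_eq_square algebra_simps)
  finally show ?case .
qed simp

text \<open>By \<open>E|V| \<ge> E min(|V|, M)\<close>; the best \<open>M\<close> is about \<open>1 / (2 s)\<close>.\<close>

lemma expectation_abs_ge_of_pmf_le: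
  fixes p :: "int pmf"
  assumes int: "integrable (measure_pmf p) (\<lambda>v. \<bar>real_of_int v\<bar>)" and s: "\<And>v. pmf p v \<le> s"
  shows "real M - s * (real M)\<^sup>2 \<le> expect p (\<lambda>v. \<bar>real_of_int v\<bar>)"
proof -
  define t where "t v = max 0 (real M - \<bar>real_of_int v\<bar>)" for v :: int
  have t: "\<bar>t v\<bar> \<le> real M" for v by (simp add: t_def)
  have "expect p t = (\<Sum>v\<in>{- int M..int M}. t v * pmf p v)"
    by (rule integral_measure_pmf_real) (auto simp: t_def max_def split: if_splits)
  also have "\<dots> \<le> (\<Sum>v\<in>{- int M..int M}. (real M - \<bar>real_of_int v\<bar>) * s)"
  proof (rule sum_mono)
    fix v assume "v \<in> {- int M..int M}"
    then have "\<bar>real_of_int v\<bar> \<le> real M" by auto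
    then show "t v * pmf p v \<le> (real M - \<bar>real_of_int v\<bar>) * s"
      by (auto simp: t_def intro: mult_left_mono s)
  qed
  also have "\<dots> = s * (real M)\<^sup>2" unfolding sum_distrib_right[symmetric] sum_tent by simp
  finally have 1: "expect p t \<le> s * (real M)\<^sup>2" .
  have "real M - expect p t = expect p (\<lambda>v. real M - t v)"
    by (subst Bochner_Integration.integral_diff) (auto intro: integrable_bounded_pmf t)
  also have "\<dots> \<le> expect p (\<lambda>v. \<bar>real_of_int v\<bar>)"
  proof (intro integral_mono int)
    show "integrable (measure_pmf p) (\<lambda>v. real M - t v)"
      by (rule integrable_bounded_pmf[where B = "real M"]) (auto simp: t_def)
  qed (auto simp: t_def)
  finally show ?thesis using 1 by linarith
qed

text \<open>With s = b / 2, the real choice M = 1 / (2 s) would give N b >= 2. An integer with |2 s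
  M - 1| <= 1/2 loses a quarter of this. It is found by rounding for s <= 1/2 and is 1 for s between
  1/2 and 3/4; beyond 3/4 the bound follows from N >= 1.\<close>

lemma tent_bound_optimized:
  fixes b N :: real
  assumes tent: "\<And>M :: nat. real M - b / 2 * (real M)\<^sup>2 \<le> N / 4" and N: "1 \<le> N" and b: "0 \<le> b"
  shows "1.5 \<le> N * b"
proof -
  define s where "s = b / 2"
  have s: "0 \<le> s" "b = 2 * s" using b by (auto simp: s_def)
  have "s \<noteq> 0"
  proof
    assume "s = 0"
    then have "real (nat \<lceil>N\<rceil>) \<le> N / 4" using tent[of "nat \<lceil>N\<rceil>"] by (simp add: s_def)
    moreover have "N \<le> real (nat \<lceil>N\<rceil>)" by linarith
    ultimately show False using N by linarith
  qed
  with s have s0: "0 < s" by simp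
  show ?thesis
  proof (cases "s \<ge> 3 / 4")
    case True
    then have "1 * 1.5 \<le> N * b" using N s by (intro mult_mono) auto
    then show ?thesis by simp
  next
    case False
    have "\<exists>M :: nat. \<bar>2 * s * real M - 1\<bar> \<le> 1 / 2"
    proof (cases "s \<le> 1 / 2")
      case True
      define M where "M = nat (round (1 / (2 * s)))"
      have "0 \<le> round (1 / (2 * s))" using s0 by (simp add: round_def)
      then have "real M = of_int (round (1 / (2 * s)))" by (simp add: M_def)
      then have "\<bar>real M - 1 / (2 * s)\<bar> \<le> 1 / 2" using of_int_round_abs_le[of "1 / (2 * s)"] by simp
      then have "2 * s * \<bar>real M - 1 / (2 * s)\<bar> \<le> 2 * s * (1 / 2)" using s0 by (intro mult_left_mono) auto
      moreover have "2 * s * \<bar>real M - 1 / (2 * s)\<bar> = \<bar>2 * s * (real M - 1 / (2 * s))\<bar>"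
        using s0 by (simp add: abs_mult)
      moreover have "2 * s * (real M - 1 / (2 * s)) = 2 * s * real M - 1" using s0 by (simp add: right_diff_distrib)
      ultimately show ?thesis using True by (intro exI[of _ M]) simp
    next
      case False
      with \<open>\<not> s \<ge> 3 / 4\<close> show ?thesis by (intro exI[of _ 1]) (simp add: abs_le_iff)
    qed
    then obtain M :: nat where M: "\<bar>2 * s * real M - 1\<bar> \<le> 1 / 2" ..
    have "(2 * s * real M - 1)\<^sup>2 \<le> (1 / 2)\<^sup>2" using M by (metis abs_le_square_iff abs_of_pos half_gt_zero_iff zero_less_one)
    then have "2 - 2 * (2 * s * real M - 1)\<^sup>2 \<ge> 1.5" by (simp add: power2_eq_square)
    moreover have "2 - 2 * (2 * s * real M - 1)\<^sup>2 = 8 * s * (real M - s * (real M)\<^sup>2)"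
      by (simp add: power2_eq_square algebra_simps)
    moreover have "8 * s * (real M - s * (real M)\<^sup>2) \<le> 8 * s * (N / 4)"
      using tent[of M] s0 by (intro mult_left_mono) (auto simp: s_def)
    ultimately show ?thesis using s by simp
  qed
qed

section \<open>Time reversal\<close>

lemma pmf_bind_Pair: "pmf (bind_pmf p (\<lambda>x. map_pmf (Pair x) (k x))) (a, b) = pmf p a * pmf (k a) b"
proof -
  have "pmf (map_pmf (Pair x) (k x)) (a, b) = indicator {a} x * pmf (k a) b" for x
  proof (cases "x = a")
    case True
    then show ?thesis by (simp add: pmf_map_inj' inj_def)
  next
    case False
    then have "(a, b) \<notin> set_pmf (map_pmf (Pair x) (k x))" by auto
    then show ?thesis using False by (simp add: set_pmf_iff del: set_map_pmf)
  qed
  then show ?thesis by (simp add: pmf_bind pmf.rep_eq[symmetric] measure_pmf_single)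
qed

text \<open>Stationarity is what makes the reversed weights sum to 1. At a state of zero mass,
  division by 0 would make all of them 0, which is no law.\<close>

lemma pmf_rev_kernel:
  assumes "bind_pmf \<pi> P = \<pi>" "0 < pmf \<pi> k"
  shows "pmf (rev_kernel \<pi> P k) j = pmf \<pi> j * pmf (P j) k / pmf \<pi> k"
  unfolding rev_kernel_def
proof (rule pmf_embed_pmf)
  have "(\<integral>\<^sup>+j. ennreal (pmf \<pi> j * pmf (P j) k / pmf \<pi> k) \<partial>count_space UNIV)
     = (\<integral>\<^sup>+j. ennreal (pmf \<pi> j) * ennreal (pmf (P j) k) / ennreal (pmf \<pi> k) \<partial>count_space UNIV)"
    using assms by (intro nn_integral_cong) (simp add: divide_ennreal[symmetric] ennreal_mult' pmf_nonneg)
  also have "\<dots> = (\<integral>\<^sup>+j. ennreal (pmf \<pi> j) * ennreal (pmf (P j) k) \<partial>count_space UNIV) / ennreal (pmf \<pi> k)"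
    by (rule nn_integral_divide) auto
  also have "(\<integral>\<^sup>+j. ennreal (pmf \<pi> j) * ennreal (pmf (P j) k) \<partial>count_space UNIV) = ennreal (pmf (bind_pmf \<pi> P) k)"
    by (simp add: ennreal_pmf_bind nn_integral_measure_pmf)
  also have "\<dots> / ennreal (pmf \<pi> k) = 1" using assms by (simp add: divide_ennreal)
  finally show "(\<integral>\<^sup>+j. ennreal (pmf \<pi> j * pmf (P j) k / pmf \<pi> k) \<partial>count_space UNIV) = 1" .
qed (simp add: pmf_nonneg)

text \<open>\<pi> is invariant under all powers of the kernel, and some power carries mass from a
  state of its support to \<open>k\<close>.\<close>

lemma stationary_pos:
  assumes "irreducible_on E P" "set_pmf \<pi> \<subseteq> E" "bind_pmf \<pi> P = \<pi>" "k \<in> E"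
  shows "0 < pmf \<pi> k"
proof -
  have st: "bind_pmf \<pi> (kstep P n) = \<pi>" for n
  proof (induction n)
    case 0
    then show ?case by (simp add: bind_return_pmf' kstep.simps(1)[abs_def])
  next
    case (Suc n)
    have eq: "bind_pmf \<pi> (kstep P (Suc n)) = bind_pmf (bind_pmf \<pi> P) (kstep P n)"
      by (simp add: bind_assoc_pmf kstep.simps(2)[abs_def])
    show ?case unfolding eq assms(3) by (rule Suc)
  qed
  obtain i where i: "i \<in> set_pmf \<pi>" using set_pmf_not_empty[of \<pi>] by auto
  then obtain n where "pmf (kstep P n i) k > 0"
    using assms unfolding irreducible_on_def by blast
  then have "k \<in> set_pmf (kstep P n i)" by (simp add: set_pmf_iff)
  then have "k \<in> set_pmf (bind_pmf \<pi> (kstep P n))" using i by auto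
  then show ?thesis unfolding st by (simp add: pmf_positive)
qed

text \<open>One stationary transition read from either end. States of zero mass are harmless because
  no state of positive mass leads to them, so both sides vanish there.\<close>

lemma detailed_reversal:
  assumes st: "bind_pmf \<pi> P = \<pi>" 
  shows "bind_pmf \<pi> (\<lambda>x. bind_pmf (P x) (f x)) = bind_pmf \<pi> (\<lambda>z. bind_pmf (rev_kernel \<pi> P z) (\<lambda>x. f x z))"
proof -
  have "bind_pmf \<pi> (\<lambda>x. map_pmf (Pair x) (P x))
      = map_pmf prod.swap (bind_pmf \<pi> (\<lambda>z. map_pmf (Pair z) (rev_kernel \<pi> P z)))"
  proof (rule pmf_eqI)
    fix p :: "nat \<times> nat"
    obtain a b where p: "p = (a, b)" by (cases p)
    have "pmf (map_pmf prod.swap (bind_pmf \<pi> (\<lambda>z. map_pmf (Pair z) (rev_kernel \<pi> P z)))) (prod.swap (b, a))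
       = pmf \<pi> b * pmf (rev_kernel \<pi> P b) a"
      by (subst pmf_map_inj') (simp_all add: pmf_bind_Pair)
    also have "\<dots> = pmf \<pi> a * pmf (P a) b"
    proof (cases "pmf \<pi> b > 0")
      case True
      then show ?thesis by (simp add: pmf_rev_kernel[OF st])
    next
      case False
      then have b: "b \<notin> set_pmf (bind_pmf \<pi> P)" unfolding st by (simp add: pmf_positive_iff)
      then have "pmf \<pi> a * pmf (P a) b = 0" by (auto simp: set_pmf_iff)
      then show ?thesis using False pmf_nonneg[of \<pi> b] by simp
    qed
    finally show "pmf (bind_pmf \<pi> (\<lambda>x. map_pmf (Pair x) (P x))) p
      = pmf (map_pmf prod.swap (bind_pmf \<pi> (\<lambda>z. map_pmf (Pair z) (rev_kernel \<pi> P z)))) p"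
      by (simp add: p pmf_bind_Pair)
  qed
  from arg_cong[OF this, of "\<lambda>r. bind_pmf r (\<lambda>p. f (fst p) (snd p))"]
  show ?thesis by (simp add: bind_assoc_pmf bind_map_pmf)
qed

lemma rev_kernel_stationary:
  assumes "bind_pmf \<pi> P = \<pi>"
  shows "bind_pmf \<pi> (rev_kernel \<pi> P) = \<pi>"
  using detailed_reversal[OF assms, of "\<lambda>x z. return_pmf x"] by (simp add: bind_return_pmf')

lemma set_rev_kernel:
  assumes "bind_pmf \<pi> P = \<pi>" "0 < pmf \<pi> k"
  shows "set_pmf (rev_kernel \<pi> P k) \<subseteq> set_pmf \<pi>"
  using assms by (auto simp: set_pmf_iff pmf_rev_kernel)

text \<open>The \<open>k\<close> observed steps are followed by one step to \<open>x\<close> that is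
  not observed; seen from \<open>x\<close>, the observed states are the first \<open>k\<close>
  states of the reversed chain. The induction observes \<open>x\<close>, moves on to
  \<open>z\<close> and reverses this last transition.\<close>

lemma joint_law_reversal:
  assumes st: "bind_pmf \<pi> P = \<pi>"
  shows "bind_pmf \<pi> (\<lambda>s. bind_pmf (joint_law P Q s k) (\<lambda>p. map_pmf (\<lambda>x. (x, snd p)) (P (fst p))))
    = bind_pmf \<pi> (\<lambda>x. map_pmf (Pair x) (sumlaw (rev_kernel \<pi> P) Q k x))"
proof (induction k)
  case 0
  have "bind_pmf \<pi> (\<lambda>s. map_pmf (\<lambda>x. (x, 0::int)) (P s)) = map_pmf (\<lambda>x. (x, 0)) (bind_pmf \<pi> P)"
    by (simp add: map_bind_pmf)
  then show ?case by (simp add: bind_return_pmf st map_pmf_def)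
next
  case (Suc k)
  let ?R = "rev_kernel \<pi> P"
  have J: "joint_law P Q s (Suc k) = bind_pmf (joint_law P Q s k) (\<lambda>p. bind_pmf (P (fst p)) (\<lambda>x. map_pmf (\<lambda>y. (x, snd p + y)) (Q x)))" for s
    using joint_law_add[of P Q s k 1]
    by (simp add: joint_law_Suc map_bind_pmf map_pmf_comp bind_return_pmf map_pmf_def bind_assoc_pmf)
  have "bind_pmf \<pi> (\<lambda>s. bind_pmf (joint_law P Q s (Suc k)) (\<lambda>p. map_pmf (\<lambda>x. (x, snd p)) (P (fst p))))
     = bind_pmf (bind_pmf \<pi> (\<lambda>s. bind_pmf (joint_law P Q s k) (\<lambda>p. map_pmf (\<lambda>x. (x, snd p)) (P (fst p)))))
        (\<lambda>r. bind_pmf (Q (fst r)) (\<lambda>y. map_pmf (\<lambda>z. (z, snd r + y)) (P (fst r))))"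
    by (simp add: J bind_assoc_pmf bind_map_pmf)
  also have "\<dots> = bind_pmf \<pi> (\<lambda>x. bind_pmf (sumlaw ?R Q k x) (\<lambda>L. bind_pmf (Q x) (\<lambda>y. map_pmf (\<lambda>z. (z, L + y)) (P x))))"
    unfolding Suc.IH by (simp add: bind_assoc_pmf bind_map_pmf)
  also have "\<dots> = bind_pmf \<pi> (\<lambda>x. bind_pmf (P x) (\<lambda>z. bind_pmf (Q x) (\<lambda>y. map_pmf (\<lambda>L. (z, L + y)) (sumlaw ?R Q k x))))"
  proof (rule bind_pmf_cong[OF refl])
    fix x
    have "bind_pmf (sumlaw ?R Q k x) (\<lambda>L. bind_pmf (Q x) (\<lambda>y. map_pmf (\<lambda>z. (z, L + y)) (P x)))
      = bind_pmf (sumlaw ?R Q k x) (\<lambda>L. bind_pmf (P x) (\<lambda>z. bind_pmf (Q x) (\<lambda>y. return_pmf (z, L + y))))"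
      unfolding map_pmf_def by (subst bind_commute_pmf) simp
    also have "\<dots> = bind_pmf (P x) (\<lambda>z. bind_pmf (sumlaw ?R Q k x) (\<lambda>L. bind_pmf (Q x) (\<lambda>y. return_pmf (z, L + y))))"
      by (rule bind_commute_pmf)
    also have "\<dots> = bind_pmf (P x) (\<lambda>z. bind_pmf (Q x) (\<lambda>y. map_pmf (\<lambda>L. (z, L + y)) (sumlaw ?R Q k x)))"
      unfolding map_pmf_def by (subst (2) bind_commute_pmf) simp
    finally show "bind_pmf (sumlaw ?R Q k x) (\<lambda>L. bind_pmf (Q x) (\<lambda>y. map_pmf (\<lambda>z. (z, L + y)) (P x)))
      = bind_pmf (P x) (\<lambda>z. bind_pmf (Q x) (\<lambda>y. map_pmf (\<lambda>L. (z, L + y)) (sumlaw ?R Q k x)))" .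
  qed
  also have "\<dots> = bind_pmf \<pi> (\<lambda>z. bind_pmf (?R z) (\<lambda>x. bind_pmf (Q x) (\<lambda>y. map_pmf (\<lambda>L. (z, L + y)) (sumlaw ?R Q k x))))"
    by (rule detailed_reversal[OF st])
  also have "\<dots> = bind_pmf \<pi> (\<lambda>x. map_pmf (Pair x) (sumlaw ?R Q (Suc k) x))"
    by (simp add: sumlaw_Suc map_bind_pmf map_pmf_comp add.commute)
  finally show ?case .
qed

lemma length_traj: "l \<in> set_pmf (traj P Q s n) \<Longrightarrow> length l = n"
  by (induction n arbitrary: s l) auto

lemma traj_add:
  "traj P Q s (a + b) = bind_pmf (traj P Q s a) (\<lambda>l.
     map_pmf ((@) l) (traj P Q (if l = [] then s else fst (last l)) b))"
proof (induction a arbitrary: s)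
  case 0
  have "((@) []) = (id :: (nat \<times> int) list \<Rightarrow> _)" by auto
  then show ?case by (simp add: bind_return_pmf pmf.map_id)
next
  case (Suc a)
  show ?case
    by (simp add: Suc.IH map_bind_pmf bind_map_pmf bind_assoc_pmf map_pmf_comp if_distrib)
       (intro bind_pmf_cong map_pmf_cong refl arg_cong2[where f = "\<lambda>a. traj P Q a"], auto)
qed

lemma sumlaw_traj: "sumlaw P Q m x = map_pmf (\<lambda>l. sum_list (map snd l)) (traj P Q x m)"
  by (simp add: sumlaw_def joint_law_def map_pmf_comp)

text \<open>The trajectory is cut at the state \<open>x\<close> of observation \<open>q\<close>,
  counted from 0. Given \<open>x\<close>, the \<open>q\<close> earlier observations come from the
  reversed chain and the \<open>j\<close> later ones from the chain itself, independently. This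
  replaces a two-sided process.\<close>

lemma observation_and_sum_law:
  assumes st: "bind_pmf \<pi> P = \<pi>"
  shows "bind_pmf \<pi> (\<lambda>s. map_pmf (\<lambda>l. (snd (l ! q), sum_list (map snd l))) (traj P Q s (q + Suc j)))
    = bind_pmf \<pi> (\<lambda>x. bind_pmf (sumlaw (rev_kernel \<pi> P) Q q x) (\<lambda>L. bind_pmf (Q x) (\<lambda>y.
        map_pmf (\<lambda>R. (y, L + y + R)) (sumlaw P Q j x))))"
proof -
  define F where "F L x = bind_pmf (Q x) (\<lambda>y. map_pmf (\<lambda>R. (y, L + y + R)) (sumlaw P Q j x))" for L x
  have "map_pmf (\<lambda>l. (snd (l ! q), sum_list (map snd l))) (traj P Q s (q + Suc j))
     = bind_pmf (joint_law P Q s q) (\<lambda>p. bind_pmf (P (fst p)) (F (snd p)))" for s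
  proof -
    have "map_pmf (\<lambda>l. (snd (l ! q), sum_list (map snd l))) (traj P Q s (q + Suc j))
      = bind_pmf (traj P Q s q) (\<lambda>l. bind_pmf (P (if l = [] then s else fst (last l))) (F (sum_list (map snd l))))"
      unfolding traj_add traj.simps map_bind_pmf
      by (intro bind_pmf_cong refl)
         (simp add: F_def map_bind_pmf map_pmf_comp nth_append length_traj sumlaw_traj add_ac)
    then show ?thesis by (simp add: joint_law_def bind_map_pmf)
  qed
  then have "bind_pmf \<pi> (\<lambda>s. map_pmf (\<lambda>l. (snd (l ! q), sum_list (map snd l))) (traj P Q s (q + Suc j)))
     = bind_pmf (bind_pmf \<pi> (\<lambda>s. bind_pmf (joint_law P Q s q) (\<lambda>p. map_pmf (\<lambda>x. (x, snd p)) (P (fst p))))) (\<lambda>r. F (snd r) (fst r))"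
    by (simp add: bind_assoc_pmf bind_map_pmf)
  then show ?thesis unfolding joint_law_reversal[OF st] by (simp add: bind_assoc_pmf bind_map_pmf F_def)
qed

lemma W_law_split:
  assumes st: "bind_pmf \<pi> P = \<pi>"
  shows "W_law \<pi> P Q (q + Suc j) = bind_pmf \<pi> (\<lambda>x. bind_pmf (sumlaw (rev_kernel \<pi> P) Q q x) (\<lambda>L. bind_pmf (Q x) (\<lambda>y.
        map_pmf (\<lambda>R. L + y + R) (sumlaw P Q j x))))"
  using arg_cong[OF observation_and_sum_law[OF st, of q Q j], of "map_pmf snd"]
  by (simp add: W_law_def map_bind_pmf map_pmf_comp)

section \<open>The two-sided chain\<close>

locale markov_sum =
  dominated_laws E Q Z +
  fwd: stationary_kernel E P Q \<pi> C \<rho> +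
  bwd: stationary_kernel E "rev_kernel \<pi> P" Q \<pi> Cbar \<rho>
  for E Q Z P \<pi> C Cbar \<rho> +
  assumes finE: "finite E"
begin

abbreviation "R \<equiv> rev_kernel \<pi> P"

definition tau :: "nat pmf" where
  "tau = bind_pmf (pair_pmf \<pi> \<pi>) (\<lambda>s. bind_pmf (hit P s) (\<lambda>a. map_pmf (\<lambda>b. a + b + 1) (hit R s)))"

definition \<Theta> :: real where "\<Theta> = E_tau_sq \<pi> P E"

lemma pair_pi_closed: "s \<in> set_pmf (pair_pmf \<pi> \<pi>) \<Longrightarrow> s \<in> E \<times> E"
  using fwd.supp by auto

text \<open>\<open>E_tau_sq\<close> is made of real-valued infinite sums, which are 0 by convention
  when they diverge. Hence finiteness comes first, from the geometric tails in both directions of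
  time.\<close>

lemma nn_integral_tau_sq: "(\<integral>\<^sup>+t. ennreal ((real t)\<^sup>2) \<partial>tau) = ennreal \<Theta>"
proof -
  define f where "f z = (real (fst z) + real (snd z) + 1)\<^sup>2" for z :: "nat \<times> nat"
  define q where "q s = pair_pmf (hit P s) (hit R s)" for s
  obtain B1 where B1: "\<And>s. s \<in> E \<times> E \<Longrightarrow> (\<integral>\<^sup>+a. ennreal ((real a + 1)\<^sup>2) \<partial>hit P s) \<le> ennreal B1"
    using fwd.hit_second_moment by blast
  obtain B2 where B2: "\<And>s. s \<in> E \<times> E \<Longrightarrow> (\<integral>\<^sup>+a. ennreal ((real a + 1)\<^sup>2) \<partial>hit R s) \<le> ennreal B2"
    using bwd.hit_second_moment by blast
  have fin: "(\<integral>\<^sup>+z. ennreal (f z) \<partial>q s) < \<infinity>" if "s \<in> E \<times> E" for s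
  proof -
    have "(\<integral>\<^sup>+z. ennreal (f z) \<partial>q s) \<le> (\<integral>\<^sup>+a. \<integral>\<^sup>+b. 2 * ennreal ((real a + 1)\<^sup>2) + 2 * ennreal ((real b + 1)\<^sup>2) \<partial>hit R s \<partial>hit P s)"
      unfolding q_def nn_integral_pair_pmf'
    proof (intro nn_integral_mono)
      fix a b :: nat
      have "0 \<le> (real a - real b)\<^sup>2" by simp
      then have "f (a, b) \<le> 2 * (real a + 1)\<^sup>2 + 2 * (real b + 1)\<^sup>2"
        by (simp add: f_def power2_eq_square algebra_simps)
      then have "ennreal (f (a, b)) \<le> ennreal (2 * (real a + 1)\<^sup>2 + 2 * (real b + 1)\<^sup>2)" by (rule ennreal_leI)
      then show "ennreal (f (a, b)) \<le> 2 * ennreal ((real a + 1)\<^sup>2) + 2 * ennreal ((real b + 1)\<^sup>2)"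
        by (simp add: ennreal_mult')
    qed
    also have "\<dots> = 2 * (\<integral>\<^sup>+a. ennreal ((real a + 1)\<^sup>2) \<partial>hit P s) + 2 * (\<integral>\<^sup>+b. ennreal ((real b + 1)\<^sup>2) \<partial>hit R s)"
      by (simp add: nn_integral_add nn_integral_cmult)
    also have "\<dots> \<le> 2 * ennreal B1 + 2 * ennreal B2"
      using B1[OF that] B2[OF that] by (intro add_mono mult_left_mono) auto
    also have "\<dots> < \<infinity>" by (simp add: ennreal_mult_less_top)
    finally show ?thesis .
  qed
  define X where "X s = expect (q s) f" for s
  have int: "integrable (measure_pmf (q s)) f" if "s \<in> E \<times> E" for s
    using fin[OF that] by (intro integrable_pmfI) (simp add: f_def)
  have X: "infsum (\<lambda>(a, b).
            (avoid (pair_kernel P) (0, 0) a s - avoid (pair_kernel P) (0, 0) (Suc a) s)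
          * (avoid (pair_kernel R) (0, 0) b s - avoid (pair_kernel R) (0, 0) (Suc b) s)
          * (real a + real b + 1) ^ 2) UNIV = X s" if s: "s \<in> E \<times> E" for s
  proof -
    have "(\<lambda>(a, b). (avoid (pair_kernel P) (0, 0) a s - avoid (pair_kernel P) (0, 0) (Suc a) s)
          * (avoid (pair_kernel R) (0, 0) b s - avoid (pair_kernel R) (0, 0) (Suc b) s)
          * (real a + real b + 1) ^ 2) = (\<lambda>z. pmf (q s) z * f z)"
      unfolding q_def f_def fwd.pmf_hit[OF s, symmetric] bwd.pmf_hit[OF s, symmetric]
      by (auto simp: fun_eq_iff pmf_pair)
    moreover have "integrable (count_space UNIV) (\<lambda>z. pmf (q s) z * f z)"
    proof -
      have "integrable (density (count_space UNIV) (\<lambda>z. ennreal (pmf (q s) z))) f"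
        using int[OF s] unfolding measure_pmf_eq_density[of "q s"] .
      then show ?thesis by (subst (asm) integrable_density) (auto simp: pmf_nonneg)
    qed
    ultimately show ?thesis
      by (simp add: infsum_eq_count_space_integral X_def expectation_pmf_count_space)
  qed
  have X0: "0 \<le> X s" for s unfolding X_def f_def by simp
  have "\<Theta> = (\<Sum>s\<in>E \<times> E. X s * pmf (pair_pmf \<pi> \<pi>) s)"
    unfolding \<Theta>_def E_tau_sq_def
  proof (rule sum.cong[OF refl])
    fix s assume s: "s \<in> E \<times> E"
    have "pmf (pair_pmf \<pi> \<pi>) s = pmf \<pi> (fst s) * pmf \<pi> (snd s)" by (cases s) (simp add: pmf_pair)
    then show "pmf \<pi> (fst s) * pmf \<pi> (snd s) * infsum (\<lambda>(a, b).
            (avoid (pair_kernel P) (0, 0) a s - avoid (pair_kernel P) (0, 0) (Suc a) s)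
          * (avoid (pair_kernel R) (0, 0) b s - avoid (pair_kernel R) (0, 0) (Suc b) s)
          * (real a + real b + 1) ^ 2) UNIV = X s * pmf (pair_pmf \<pi> \<pi>) s"
      unfolding X[OF s] by simp
  qed
  also have "\<dots> = expect (pair_pmf \<pi> \<pi>) X"
    using pair_pi_closed finE by (intro integral_measure_pmf_real[symmetric]) auto
  finally have \<Theta>: "\<Theta> = expect (pair_pmf \<pi> \<pi>) X" .
  have "(\<integral>\<^sup>+t. ennreal ((real t)\<^sup>2) \<partial>tau) = (\<integral>\<^sup>+s. \<integral>\<^sup>+z. ennreal (f z) \<partial>q s \<partial>pair_pmf \<pi> \<pi>)"
    by (simp add: tau_def q_def nn_integral_pair_pmf' f_def add_ac)
  also have "\<dots> = (\<integral>\<^sup>+s. ennreal (X s) \<partial>pair_pmf \<pi> \<pi>)"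
  proof (rule nn_integral_cong_AE, subst AE_measure_pmf_iff, rule ballI)
    fix s assume "s \<in> set_pmf (pair_pmf \<pi> \<pi>)"
    then show "(\<integral>\<^sup>+z. ennreal (f z) \<partial>q s) = ennreal (X s)"
      unfolding X_def by (intro nn_integral_eq_integral int pair_pi_closed) (simp_all add: f_def)
  qed
  also have "\<dots> = ennreal \<Theta>"
    unfolding \<Theta> using X0
    by (intro nn_integral_eq_integral integrable_measure_pmf_finite) (auto intro: finite_subset[OF fwd.supp finE])
  finally show ?thesis .
qed

lemma tau_ge_1: "t \<in> set_pmf tau \<Longrightarrow> 1 \<le> t"
  by (auto simp: tau_def)

lemma integrable_tau_sq: "integrable (measure_pmf tau) (\<lambda>t. (real t)\<^sup>2)"
  by (rule integrable_pmfI) (simp add: nn_integral_tau_sq)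

lemma integrable_tau: "integrable (measure_pmf tau) real"
  by (rule measure_pmf.square_integrable_imp_integrable[OF _ integrable_tau_sq]) simp

definition T1 :: real where "T1 = expect tau real"

lemma nn_integral_tau: "(\<integral>\<^sup>+t. of_nat t \<partial>tau) = ennreal T1"
  using nn_integral_eq_integral[OF integrable_tau] by (simp add: T1_def ennreal_of_nat_eq_real_of_nat)

lemma T1_nonneg: "0 \<le> T1" by (simp add: T1_def)

lemma T1_sq_le: "T1\<^sup>2 \<le> \<Theta>"
proof -
  have "0 \<le> measure_pmf.variance tau real" by simp
  also have "\<dots> = expect tau (\<lambda>t. (real t)\<^sup>2) - T1\<^sup>2"
    unfolding T1_def by (rule measure_pmf.variance_eq[OF integrable_tau integrable_tau_sq])
  also have "expect tau (\<lambda>t. (real t)\<^sup>2) = \<Theta>"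
  proof -
    have "ennreal (expect tau (\<lambda>t. (real t)\<^sup>2)) = ennreal \<Theta>"
      using nn_integral_eq_integral[OF integrable_tau_sq] nn_integral_tau_sq by simp
    \<comment> \<open>\<open>ennreal\<close> sends every negative real to 0, so the equation of
      extended values determines \<Theta> only once its sign is known.\<close>
    moreover have "0 < \<Theta>"
    proof (rule ccontr)
      assume "\<not> 0 < \<Theta>"
      then have "(\<integral>\<^sup>+t. ennreal ((real t)\<^sup>2) \<partial>tau) = 0" unfolding nn_integral_tau_sq by (simp add: ennreal_neg)
      moreover have "1 \<le> (\<integral>\<^sup>+t. ennreal ((real t)\<^sup>2) \<partial>tau)"
        by (rule nn_integral_ge_const_pmf) (use tau_ge_1 in \<open>auto simp: one_le_power\<close>)
      ultimately show False by simp
    qed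
    ultimately show ?thesis by (simp add: ennreal_inj)
  qed
  finally show ?thesis by simp
qed

lemma Theta_nonneg: "0 \<le> \<Theta>"
  using T1_sq_le by (meson order_trans zero_le_power2)

text \<open>From a stationary pair, the two hitting times add up to \<tau> - 1 in mean.\<close>

lemma mean_meet_bounds:
  "(\<integral>\<^sup>+x. \<integral>\<^sup>+l. of_nat (length l) \<partial>meet R Q q (0, x) \<partial>\<pi>) + (\<integral>\<^sup>+x. \<integral>\<^sup>+l. of_nat (length l) \<partial>meet P Q r (0, x) \<partial>\<pi>)
    \<le> ennreal T1"
proof -
  have "(\<integral>\<^sup>+t. of_nat t \<partial>tau) = (\<integral>\<^sup>+s. (\<integral>\<^sup>+a. of_nat a \<partial>hit R s) + (\<integral>\<^sup>+a. of_nat a \<partial>hit P s) + 1 \<partial>pair_pmf \<pi> \<pi>)"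
    by (simp add: tau_def nn_integral_add add_ac)
  also have "\<dots> = (\<integral>\<^sup>+s. \<integral>\<^sup>+a. of_nat a \<partial>hit R s \<partial>pair_pmf \<pi> \<pi>) + (\<integral>\<^sup>+s. \<integral>\<^sup>+a. of_nat a \<partial>hit P s \<partial>pair_pmf \<pi> \<pi>) + 1"
    by (simp add: nn_integral_add)
  finally have "(\<integral>\<^sup>+s. \<integral>\<^sup>+a. of_nat a \<partial>hit R s \<partial>pair_pmf \<pi> \<pi>) + (\<integral>\<^sup>+s. \<integral>\<^sup>+a. of_nat a \<partial>hit P s \<partial>pair_pmf \<pi> \<pi>) + 1 = ennreal T1"
    by (simp add: nn_integral_tau)
  then have "(\<integral>\<^sup>+s. \<integral>\<^sup>+a. of_nat a \<partial>hit R s \<partial>pair_pmf \<pi> \<pi>) + (\<integral>\<^sup>+s. \<integral>\<^sup>+a. of_nat a \<partial>hit P s \<partial>pair_pmf \<pi> \<pi>) \<le> ennreal T1"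
    by (metis add.right_neutral add_left_mono zero_le)
  then show ?thesis
    by (rule order_trans[OF add_mono[OF bwd.mean_length_meet_le_hit fwd.mean_length_meet_le_hit]])
qed

section \<open>The segment around a fixed time\<close>

text \<open>The segment seen from its central time: the two observations there, the pairs after it
  and the pairs before it, up to a meeting on each side. Given the two central states the three
  parts are independent. \<open>j\<close> and \<open>q\<close> count the observations available
  after and before.\<close>

definition seg :: "nat \<Rightarrow> nat \<Rightarrow> ((int \<times> int) \<times> (int \<times> int) list \<times> (int \<times> int) list) pmf" where
  "seg j q = bind_pmf (pair_pmf \<pi> \<pi>) (\<lambda>s. bind_pmf (pair_pmf (Q (fst s)) (Q (snd s))) (\<lambda>p.
     bind_pmf (meet P Q j s) (\<lambda>a. map_pmf (\<lambda>b. (p, a, b)) (meet R Q q s))))"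

definition incs :: "(int \<times> int) \<times> (int \<times> int) list \<times> (int \<times> int) list \<Rightarrow> (int \<times> int) list" where
  "incs z = fst z # fst (snd z) @ snd (snd z)"

lemma seg_length:
  assumes "z \<in> set_pmf (seg j q)"
  shows "length (fst (snd z)) \<le> j" "length (snd (snd z)) \<le> q"
  using assms by (auto simp: seg_def dest: length_meet)

text \<open>Given the two central states, the observations there are independent of both meeting
  times, and the factors integrate separately.\<close>

lemma nn_integral_seg_head:
  fixes \<phi> :: "int \<times> int \<Rightarrow> ennreal" and w :: "nat \<Rightarrow> ennreal"
  assumes M: "\<And>l l'. l \<in> E \<Longrightarrow> l' \<in> E \<Longrightarrow> (\<integral>\<^sup>+p. \<phi> p \<partial>pair_pmf (Q l) (Q l')) \<le> M"
  shows "(\<integral>\<^sup>+z. \<phi> (fst z) * w (length (incs z)) \<partial>seg j q) \<le> M * (\<integral>\<^sup>+z. w (length (incs z)) \<partial>seg j q)"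
proof -
  define W where "W s = (\<integral>\<^sup>+a. \<integral>\<^sup>+b. w (Suc (length a + length b)) \<partial>meet R Q q s \<partial>meet P Q j s)" for s
  have "(\<integral>\<^sup>+z. \<phi> (fst z) * w (length (incs z)) \<partial>seg j q)
     = (\<integral>\<^sup>+s. (\<integral>\<^sup>+p. \<phi> p \<partial>pair_pmf (Q (fst s)) (Q (snd s))) * W s \<partial>pair_pmf \<pi> \<pi>)"
    by (simp add: seg_def incs_def W_def nn_integral_cmult nn_integral_multc)
  also have "\<dots> \<le> (\<integral>\<^sup>+s. M * W s \<partial>pair_pmf \<pi> \<pi>)"
    using fwd.supp by (intro nn_integral_mono_pmf mult_right_mono M) auto
  also have "\<dots> = M * (\<integral>\<^sup>+z. w (length (incs z)) \<partial>seg j q)"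
    by (simp add: seg_def incs_def W_def nn_integral_cmult)
  finally show ?thesis .
qed

lemma nn_integral_seg_sum:
  fixes \<phi> :: "int \<times> int \<Rightarrow> ennreal" and w :: "nat \<Rightarrow> ennreal"
  assumes M: "\<And>l l'. l \<in> E \<Longrightarrow> l' \<in> E \<Longrightarrow> (\<integral>\<^sup>+p. \<phi> p \<partial>pair_pmf (Q l) (Q l')) \<le> M"
  shows "(\<integral>\<^sup>+z. sum_list (map \<phi> (incs z)) * w (length (incs z)) \<partial>seg j q)
     \<le> M * (\<integral>\<^sup>+z. of_nat (length (incs z)) * w (length (incs z)) \<partial>seg j q)"
proof -
  let ?A = "\<lambda>s. meet P Q j s" and ?B = "\<lambda>s. meet R Q q s"
  let ?w = "\<lambda>a b. w (Suc (length a + length b))"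
  define W where "W s = (\<integral>\<^sup>+a. \<integral>\<^sup>+b. ?w a b \<partial>?B s \<partial>?A s)" for s
  define WA where "WA s = (\<integral>\<^sup>+a. of_nat (length a) * (\<integral>\<^sup>+b. ?w a b \<partial>?B s) \<partial>?A s)" for s
  define WB where "WB s = (\<integral>\<^sup>+a. \<integral>\<^sup>+b. of_nat (length b) * ?w a b \<partial>?B s \<partial>?A s)" for s
  have "(\<integral>\<^sup>+z. sum_list (map \<phi> (incs z)) * w (length (incs z)) \<partial>seg j q)
     = (\<integral>\<^sup>+s. (\<integral>\<^sup>+p. \<phi> p \<partial>pair_pmf (Q (fst s)) (Q (snd s))) * W s
        + ((\<integral>\<^sup>+a. sum_list (map \<phi> a) * (\<integral>\<^sup>+b. ?w a b \<partial>?B s) \<partial>?A s)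
        + (\<integral>\<^sup>+a. \<integral>\<^sup>+b. sum_list (map \<phi> b) * ?w a b \<partial>?B s \<partial>?A s)) \<partial>pair_pmf \<pi> \<pi>)"
    by (simp add: seg_def incs_def W_def nn_integral_cmult nn_integral_multc nn_integral_add distrib_right)
  also have "\<dots> \<le> (\<integral>\<^sup>+s. M * W s + (M * WA s + M * WB s) \<partial>pair_pmf \<pi> \<pi>)"
  proof (intro nn_integral_mono_pmf add_mono)
    fix s assume "s \<in> set_pmf (pair_pmf \<pi> \<pi>)"
    then have s: "s \<in> E \<times> E" by (rule pair_pi_closed)
    show "(\<integral>\<^sup>+p. \<phi> p \<partial>pair_pmf (Q (fst s)) (Q (snd s))) * W s \<le> M * W s"
      using s by (intro mult_right_mono M) auto
    show "(\<integral>\<^sup>+a. sum_list (map \<phi> a) * (\<integral>\<^sup>+b. ?w a b \<partial>?B s) \<partial>?A s) \<le> M * WA s"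
      unfolding WA_def
      using fwd.nn_integral_meet_sum[OF M s, where f = "\<lambda>k. \<integral>\<^sup>+b. w (Suc (k + length b)) \<partial>?B s" and m = j] by simp
    have "(\<integral>\<^sup>+a. \<integral>\<^sup>+b. sum_list (map \<phi> b) * ?w a b \<partial>?B s \<partial>?A s)
        \<le> (\<integral>\<^sup>+a. M * (\<integral>\<^sup>+b. of_nat (length b) * ?w a b \<partial>?B s) \<partial>?A s)"
      by (intro nn_integral_mono bwd.nn_integral_meet_sum[OF M s, where f = "\<lambda>k. w (Suc (length _ + k))"])
    then show "(\<integral>\<^sup>+a. \<integral>\<^sup>+b. sum_list (map \<phi> b) * ?w a b \<partial>?B s \<partial>?A s) \<le> M * WB s"
      unfolding WB_def by (simp add: nn_integral_cmult)
  qed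
  also have "\<dots> = M * (\<integral>\<^sup>+s. W s + (WA s + WB s) \<partial>pair_pmf \<pi> \<pi>)"
    by (simp add: distrib_left[symmetric] nn_integral_cmult)
  also have "(\<integral>\<^sup>+s. W s + (WA s + WB s) \<partial>pair_pmf \<pi> \<pi>) = (\<integral>\<^sup>+z. of_nat (length (incs z)) * w (length (incs z)) \<partial>seg j q)"
    by (simp add: seg_def incs_def W_def WA_def WB_def nn_integral_cmult nn_integral_multc nn_integral_add distrib_right)
  finally show ?thesis .
qed

text \<open>Truncation at the ends of the observation window can only shorten a segment, and the
  central time supplies the + 1 in \<tau>.\<close>

lemma nn_integral_seg_length_le:
  fixes w :: "nat \<Rightarrow> ennreal"
  assumes "mono w"
  shows "(\<integral>\<^sup>+z. w (length (incs z)) \<partial>seg j q) \<le> (\<integral>\<^sup>+t. w t \<partial>tau)"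
proof -
  have "(\<integral>\<^sup>+z. w (length (incs z)) \<partial>seg j q)
     = (\<integral>\<^sup>+s. \<integral>\<^sup>+a. \<integral>\<^sup>+b. w (Suc (length a + length b)) \<partial>meet R Q q s \<partial>meet P Q j s \<partial>pair_pmf \<pi> \<pi>)"
    by (simp add: seg_def incs_def)
  also have "\<dots> \<le> (\<integral>\<^sup>+s. \<integral>\<^sup>+a. \<integral>\<^sup>+b. w (Suc (a + b)) \<partial>hit R s \<partial>hit P s \<partial>pair_pmf \<pi> \<pi>)"
  proof (rule nn_integral_mono_pmf)
    fix s assume "s \<in> set_pmf (pair_pmf \<pi> \<pi>)"
    then have s: "s \<in> E \<times> E" by (rule pair_pi_closed)
    have "(\<integral>\<^sup>+a. \<integral>\<^sup>+b. w (Suc (length a + length b)) \<partial>meet R Q q s \<partial>meet P Q j s)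
       \<le> (\<integral>\<^sup>+a. \<integral>\<^sup>+b. w (Suc (length a + b)) \<partial>hit R s \<partial>meet P Q j s)"
      by (intro nn_integral_mono bwd.nn_integral_length_meet_le[OF s, of "\<lambda>k. w (Suc (length _ + k))"])
         (auto simp: mono_def intro!: monoD[OF assms])
    also have "\<dots> \<le> (\<integral>\<^sup>+a. \<integral>\<^sup>+b. w (Suc (a + b)) \<partial>hit R s \<partial>hit P s)"
      by (intro fwd.nn_integral_length_meet_le[OF s, of "\<lambda>k. \<integral>\<^sup>+b. w (Suc (k + b)) \<partial>hit R s"])
         (auto simp: mono_def intro!: nn_integral_mono monoD[OF assms])
    finally show "(\<integral>\<^sup>+a. \<integral>\<^sup>+b. w (Suc (length a + length b)) \<partial>meet R Q q s \<partial>meet P Q j s)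
       \<le> (\<integral>\<^sup>+a. \<integral>\<^sup>+b. w (Suc (a + b)) \<partial>hit R s \<partial>hit P s)" .
  qed
  also have "\<dots> = (\<integral>\<^sup>+t. w t \<partial>tau)" by (simp add: tau_def)
  finally show ?thesis .
qed

end

section \<open>Moments of an observation times a segment sum\<close>

lemma sum_list_square_le:
  fixes xs :: "real list"
  shows "(sum_list xs)\<^sup>2 \<le> real (length xs) * sum_list (map power2 xs)"
  using sum_squared_le_sum_of_squares[of "\<lambda>i. xs ! i" "{0..<length xs}"]
  by (simp add: sum_list_sum_nth mult.commute)

text \<open>Young's inequality, with the weights that nearly minimise the bound when the third moments of the two
  factors are in ratio 10 to 2.\<close>

lemma weighted_am_gm:
  fixes a x :: real
  assumes "0 \<le> a"
  shows "a * x\<^sup>2 \<le> 49 / 432 * a ^ 3 + 8 / 7 * \<bar>x\<bar> ^ 3"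
proof -
  define b where "b = \<bar>x\<bar>"
  have "49 / 432 * a ^ 3 + 8 / 7 * b ^ 3 - a * b\<^sup>2 = 4 / 7 * (7 / 12 * a - b)\<^sup>2 * (7 / 12 * a + 2 * b)"
    by (simp add: power2_eq_square power3_eq_cube algebra_simps)
  also have "\<dots> \<ge> 0" using assms by (simp add: b_def)
  finally show ?thesis by (simp add: b_def)
qed

text \<open>Cauchy-Schwarz costs one factor of the length, after which Young's inequality separates
  \<open>a\<close> from each entry. The first part then carries the length squared; the second
  carries it once explicitly and once more through the number of cubes summed.\<close>

lemma head_times_square_le:
  fixes a :: real and xs :: "real list"
  assumes "0 \<le> a"
  shows "a * (sum_list xs)\<^sup>2 \<le> 49 / 432 * (a ^ 3 * (real (length xs))\<^sup>2)
      + 8 / 7 * (sum_list (map (\<lambda>x. \<bar>x\<bar> ^ 3) xs) * real (length xs))"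
proof -
  have "a * sum_list (map power2 xs) \<le> 49 / 432 * a ^ 3 * real (length xs) + 8 / 7 * sum_list (map (\<lambda>x. \<bar>x\<bar> ^ 3) xs)"
  proof (induction xs)
    case (Cons x xs)
    then show ?case using weighted_am_gm[OF assms, of x] by (simp add: distrib_left distrib_right)
  qed simp
  from mult_left_mono[OF this, of "real (length xs)"]
  have 1: "real (length xs) * (a * sum_list (map power2 xs))
     \<le> 49 / 432 * (a ^ 3 * (real (length xs))\<^sup>2) + 8 / 7 * (sum_list (map (\<lambda>x. \<bar>x\<bar> ^ 3) xs) * real (length xs))"
    by (simp add: power2_eq_square algebra_simps)
  have "a * (sum_list xs)\<^sup>2 \<le> a * (real (length xs) * sum_list (map power2 xs))"
    by (intro mult_left_mono sum_list_square_le assms)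
  with 1 show ?thesis by (simp add: mult_ac)
qed

text \<open>AM-GM balances \<open>\<bar>a\<bar>\<close> times the length against the modulus of the
  sum, so that after Cauchy-Schwarz each part is of first order in the length.\<close>

lemma head_times_sum_le:
  fixes a :: real and xs :: "real list"
  assumes "xs \<noteq> []"
  shows "\<bar>a\<bar> * \<bar>sum_list xs\<bar> \<le> 1 / 2 * (a\<^sup>2 * real (length xs)) + 1 / 2 * sum_list (map power2 xs)"
proof -
  define n where "n = real (length xs)"
  have n: "0 < n" using assms by (simp add: n_def)
  have "0 \<le> (n * \<bar>a\<bar> - \<bar>sum_list xs\<bar>)\<^sup>2" by simp
  then have "2 * n * (\<bar>a\<bar> * \<bar>sum_list xs\<bar>) \<le> n\<^sup>2 * a\<^sup>2 + (sum_list xs)\<^sup>2"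
    by (simp add: power2_diff power_mult_distrib algebra_simps)
  also have "\<dots> \<le> n\<^sup>2 * a\<^sup>2 + n * sum_list (map power2 xs)"
    using sum_list_square_le[of xs] by (simp add: n_def)
  also have "\<dots> = n * (a\<^sup>2 * n + sum_list (map power2 xs))" by (simp add: power2_eq_square algebra_simps)
  finally have "n * (2 * (\<bar>a\<bar> * \<bar>sum_list xs\<bar>)) \<le> n * (a\<^sup>2 * n + sum_list (map power2 xs))" by (simp add: mult_ac)
  then have "2 * (\<bar>a\<bar> * \<bar>sum_list xs\<bar>) \<le> a\<^sup>2 * n + sum_list (map power2 xs)" using n by simp
  then show ?thesis by (simp add: n_def)
qed

lemma ennreal_sum_list:
  assumes "\<And>x. 0 \<le> f x"
  shows "ennreal (sum_list (map f xs)) = sum_list (map (\<lambda>x. ennreal (f x)) xs)"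
proof (induction xs)
  case (Cons x xs)
  have "0 \<le> sum_list (map f xs)" by (intro sum_list_nonneg) (auto simp: assms)
  then show ?case using Cons assms[of x] by simp
qed simp

lemma ennreal_lin_comb:
  assumes "0 \<le> c" "0 \<le> c'" "0 \<le> a" "0 \<le> b" "0 \<le> d" "0 \<le> e"
  shows "ennreal (c * (a * b) + c' * (d * e)) = ennreal c * (ennreal a * ennreal b) + ennreal c' * (ennreal d * ennreal e)"
  using assms by (simp add: ennreal_mult)

lemma of_int_sum_list: "real_of_int (sum_list (map f xs)) = sum_list (map (\<lambda>x. real_of_int (f x)) xs)"
  by (induction xs) auto

lemma of_int_sum_list_diff:
  "real_of_int (sum_list (map f xs)) - real_of_int (sum_list (map g xs))
   = sum_list (map (\<lambda>x. real_of_int (f x) - real_of_int (g x)) xs)"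
  by (induction xs) auto

context markov_sum begin

lemma incs_ne [simp]: "incs z \<noteq> []" by (simp add: incs_def)

definition hd_diff :: "(int \<times> int) \<times> (int \<times> int) list \<times> (int \<times> int) list \<Rightarrow> real" where
  "hd_diff z = real_of_int (fst (fst z)) - real_of_int (snd (fst z))"

definition seg_fst :: "(int \<times> int) \<times> (int \<times> int) list \<times> (int \<times> int) list \<Rightarrow> int" where
  "seg_fst z = sum_list (map fst (incs z))"

definition seg_snd :: "(int \<times> int) \<times> (int \<times> int) list \<times> (int \<times> int) list \<Rightarrow> int" where
  "seg_snd z = sum_list (map snd (incs z))"

text \<open>49/432 * 10 + 8/7 * 2 is just below 3.42, which is the cube root of 10 * 2^2 rounded up:
  the constant that Hoelder's inequality suggests for these third moments. The map \<open>f\<close>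
  stands for either copy.\<close>

lemma seg_square_moment_aux:
  fixes f :: "int \<times> int \<Rightarrow> int"
  assumes f: "\<And>l l'. l \<in> E \<Longrightarrow> l' \<in> E \<Longrightarrow> (\<integral>\<^sup>+p. ennreal (\<bar>real_of_int (f p)\<bar> ^ 3) \<partial>pair_pmf (Q l) (Q l')) \<le> ennreal (2 * \<zeta>)"
  shows "(\<integral>\<^sup>+z. ennreal (\<bar>hd_diff z\<bar> * (real_of_int (sum_list (map f (incs z))))\<^sup>2) \<partial>seg j q) \<le> ennreal (3.42 * \<zeta> * \<Theta>)"
proof -
  let ?\<phi> = "\<lambda>p. ennreal (\<bar>real_of_int (fst p) - real_of_int (snd p)\<bar> ^ 3)"
  let ?\<psi> = "\<lambda>p. ennreal (\<bar>real_of_int (f p)\<bar> ^ 3)"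
  have len: "(\<integral>\<^sup>+z. ennreal ((real (length (incs z)))\<^sup>2) \<partial>seg j q) \<le> ennreal \<Theta>"
    using nn_integral_seg_length_le[of "\<lambda>t. ennreal ((real t)\<^sup>2)" j q]
    by (auto simp: nn_integral_tau_sq mono_def intro!: ennreal_leI power_mono)
  have "(\<integral>\<^sup>+z. ennreal (\<bar>hd_diff z\<bar> * (real_of_int (sum_list (map f (incs z))))\<^sup>2) \<partial>seg j q)
     \<le> (\<integral>\<^sup>+z. ennreal (49 / 432) * (?\<phi> (fst z) * ennreal ((real (length (incs z)))\<^sup>2))
        + ennreal (8 / 7) * (sum_list (map ?\<psi> (incs z)) * ennreal (real (length (incs z)))) \<partial>seg j q)"
  proof (rule nn_integral_mono)
    fix z
    have "\<bar>hd_diff z\<bar> * (real_of_int (sum_list (map f (incs z))))\<^sup>2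
       \<le> 49 / 432 * (\<bar>hd_diff z\<bar> ^ 3 * (real (length (incs z)))\<^sup>2)
        + 8 / 7 * (sum_list (map (\<lambda>p. \<bar>real_of_int (f p)\<bar> ^ 3) (incs z)) * real (length (incs z)))"
      using head_times_square_le[of "\<bar>hd_diff z\<bar>" "map (\<lambda>p. real_of_int (f p)) (incs z)"]
      by (simp add: of_int_sum_list comp_def)
    then have "ennreal (\<bar>hd_diff z\<bar> * (real_of_int (sum_list (map f (incs z))))\<^sup>2)
       \<le> ennreal (49 / 432 * (\<bar>hd_diff z\<bar> ^ 3 * (real (length (incs z)))\<^sup>2)
        + 8 / 7 * (sum_list (map (\<lambda>p. \<bar>real_of_int (f p)\<bar> ^ 3) (incs z)) * real (length (incs z))))"
      by (rule ennreal_leI)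
    also have "\<dots> = ennreal (49 / 432) * (?\<phi> (fst z) * ennreal ((real (length (incs z)))\<^sup>2))
        + ennreal (8 / 7) * (sum_list (map ?\<psi> (incs z)) * ennreal (real (length (incs z))))"
    proof -
      have e: "sum_list (map ?\<psi> (incs z)) = ennreal (sum_list (map (\<lambda>p. \<bar>real_of_int (f p)\<bar> ^ 3) (incs z)))"
        by (rule ennreal_sum_list[symmetric]) simp
      have "0 \<le> sum_list (map (\<lambda>p. \<bar>real_of_int (f p)\<bar> ^ 3) (incs z))"
        by (intro sum_list_nonneg) auto
      then show ?thesis unfolding e hd_diff_def by (intro ennreal_lin_comb) simp_all
    qed
    finally show "ennreal (\<bar>hd_diff z\<bar> * (real_of_int (sum_list (map f (incs z))))\<^sup>2)
       \<le> ennreal (49 / 432) * (?\<phi> (fst z) * ennreal ((real (length (incs z)))\<^sup>2))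
        + ennreal (8 / 7) * (sum_list (map ?\<psi> (incs z)) * ennreal (real (length (incs z))))" .
  qed
  also have "\<dots> = ennreal (49 / 432) * (\<integral>\<^sup>+z. ?\<phi> (fst z) * ennreal ((real (length (incs z)))\<^sup>2) \<partial>seg j q)
        + ennreal (8 / 7) * (\<integral>\<^sup>+z. sum_list (map ?\<psi> (incs z)) * ennreal (real (length (incs z))) \<partial>seg j q)"
    by (simp add: nn_integral_add nn_integral_cmult)
  also have "\<dots> \<le> ennreal (49 / 432) * (ennreal (10 * \<zeta>) * ennreal \<Theta>) + ennreal (8 / 7) * (ennreal (2 * \<zeta>) * ennreal \<Theta>)"
  proof (intro add_mono mult_left_mono)
    have "(\<integral>\<^sup>+z. ?\<phi> (fst z) * ennreal ((real (length (incs z)))\<^sup>2) \<partial>seg j q)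
       \<le> ennreal (10 * \<zeta>) * (\<integral>\<^sup>+z. ennreal ((real (length (incs z)))\<^sup>2) \<partial>seg j q)"
      by (rule nn_integral_seg_head[where \<phi> = ?\<phi> and w = "\<lambda>t. ennreal ((real t)\<^sup>2)", OF third_moment_diff])
    also have "\<dots> \<le> ennreal (10 * \<zeta>) * ennreal \<Theta>" by (intro mult_left_mono len) auto
    finally show "(\<integral>\<^sup>+z. ?\<phi> (fst z) * ennreal ((real (length (incs z)))\<^sup>2) \<partial>seg j q) \<le> ennreal (10 * \<zeta>) * ennreal \<Theta>" .
    have "(\<integral>\<^sup>+z. sum_list (map ?\<psi> (incs z)) * ennreal (real (length (incs z))) \<partial>seg j q)
       \<le> ennreal (2 * \<zeta>) * (\<integral>\<^sup>+z. of_nat (length (incs z)) * ennreal (real (length (incs z))) \<partial>seg j q)"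
      by (rule nn_integral_seg_sum[where \<phi> = ?\<psi> and w = "\<lambda>t. ennreal (real t)", OF f])
    also have "(\<integral>\<^sup>+z. of_nat (length (incs z)) * ennreal (real (length (incs z))) \<partial>seg j q) = (\<integral>\<^sup>+z. ennreal ((real (length (incs z)))\<^sup>2) \<partial>seg j q)"
      by (simp add: power2_eq_square ennreal_mult ennreal_of_nat_eq_real_of_nat)
    also have "ennreal (2 * \<zeta>) * \<dots> \<le> ennreal (2 * \<zeta>) * ennreal \<Theta>" by (intro mult_left_mono len) auto
    finally show "(\<integral>\<^sup>+z. sum_list (map ?\<psi> (incs z)) * ennreal (real (length (incs z))) \<partial>seg j q) \<le> ennreal (2 * \<zeta>) * ennreal \<Theta>" .
  qed auto
  also have "\<dots> = ennreal (49 / 432 * (10 * \<zeta> * \<Theta>) + 8 / 7 * (2 * \<zeta> * \<Theta>))"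
    using zeta_ge_1 Theta_nonneg by (intro ennreal_lin_comb[symmetric]) auto
  also have "\<dots> \<le> ennreal (3.42 * \<zeta> * \<Theta>)"
  proof (rule ennreal_leI)
    have "0 \<le> \<zeta> * \<Theta>" using zeta_ge_1 Theta_nonneg by simp
    then show "49 / 432 * (10 * \<zeta> * \<Theta>) + 8 / 7 * (2 * \<zeta> * \<Theta>) \<le> 3.42 * \<zeta> * \<Theta>" by simp
  qed
  finally show ?thesis .
qed

lemma seg_square_moments:
  "(\<integral>\<^sup>+z. ennreal (\<bar>hd_diff z\<bar> * (real_of_int (seg_fst z))\<^sup>2) \<partial>seg j q) \<le> ennreal (3.42 * \<zeta> * \<Theta>)"
  "(\<integral>\<^sup>+z. ennreal (\<bar>hd_diff z\<bar> * (real_of_int (seg_snd z))\<^sup>2) \<partial>seg j q) \<le> ennreal (3.42 * \<zeta> * \<Theta>)"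
  unfolding seg_fst_def seg_snd_def
  by (rule seg_square_moment_aux, simp add: nn_integral_pair_pmf' third_moment)+

text \<open>Both halves of \<open>head_times_sum_le\<close> involve differences of two observations,
  hence the same 4.65. The weight \<open>K\<close> is kept general to receive the error of replacing
  a mean of \<Delta>g by its value under W, which grows with the segment.\<close>

lemma seg_product_moment:
  fixes K :: "nat \<Rightarrow> ennreal"
  shows "(\<integral>\<^sup>+z. ennreal (\<bar>hd_diff z\<bar> * \<bar>real_of_int (seg_fst z) - real_of_int (seg_snd z)\<bar>) * K (length (incs z)) \<partial>seg j q)
    \<le> ennreal (4.65 * \<theta>\<^sup>2) * (\<integral>\<^sup>+z. of_nat (length (incs z)) * K (length (incs z)) \<partial>seg j q)"
proof -
  let ?\<phi> = "\<lambda>p. ennreal ((real_of_int (fst p) - real_of_int (snd p))\<^sup>2)"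
  let ?I = "\<integral>\<^sup>+z. of_nat (length (incs z)) * K (length (incs z)) \<partial>seg j q"
  have "(\<integral>\<^sup>+z. ennreal (\<bar>hd_diff z\<bar> * \<bar>real_of_int (seg_fst z) - real_of_int (seg_snd z)\<bar>) * K (length (incs z)) \<partial>seg j q)
     \<le> (\<integral>\<^sup>+z. ennreal (1 / 2) * (?\<phi> (fst z) * (of_nat (length (incs z)) * K (length (incs z))))
        + ennreal (1 / 2) * (sum_list (map ?\<phi> (incs z)) * K (length (incs z))) \<partial>seg j q)"
  proof (rule nn_integral_mono)
    fix z
    have "\<bar>hd_diff z\<bar> * \<bar>real_of_int (seg_fst z) - real_of_int (seg_snd z)\<bar>
       \<le> 1 / 2 * ((hd_diff z)\<^sup>2 * real (length (incs z))) + 1 / 2 * sum_list (map (\<lambda>p. (real_of_int (fst p) - real_of_int (snd p))\<^sup>2) (incs z))"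
      using head_times_sum_le[of "map (\<lambda>p. real_of_int (fst p) - real_of_int (snd p)) (incs z)" "hd_diff z"]
      unfolding seg_fst_def seg_snd_def of_int_sum_list_diff by (simp add: comp_def incs_ne)
    then have "ennreal (\<bar>hd_diff z\<bar> * \<bar>real_of_int (seg_fst z) - real_of_int (seg_snd z)\<bar>)
       \<le> ennreal (1 / 2 * ((hd_diff z)\<^sup>2 * real (length (incs z))) + 1 / 2 * sum_list (map (\<lambda>p. (real_of_int (fst p) - real_of_int (snd p))\<^sup>2) (incs z)))"
      by (rule ennreal_leI)
    also have "\<dots> = ennreal (1 / 2) * (?\<phi> (fst z) * of_nat (length (incs z))) + ennreal (1 / 2) * sum_list (map ?\<phi> (incs z))"
    proof -
      define d where "d = sum_list (map (\<lambda>p. (real_of_int (fst p) - real_of_int (snd p))\<^sup>2) (incs z))"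
      have e: "sum_list (map ?\<phi> (incs z)) = ennreal d"
        unfolding d_def by (rule ennreal_sum_list[symmetric]) simp
      have "0 \<le> d" unfolding d_def by (intro sum_list_nonneg) auto
      then show ?thesis
        unfolding e d_def[symmetric] hd_diff_def ennreal_of_nat_eq_real_of_nat
        using ennreal_lin_comb[of "1 / 2" "1 / 2" "(real_of_int (fst (fst z)) - real_of_int (snd (fst z)))\<^sup>2"
            "real (length (incs z))" d 1] by (simp only: ennreal_1 mult_1_right) simp
    qed
    finally have "ennreal (\<bar>hd_diff z\<bar> * \<bar>real_of_int (seg_fst z) - real_of_int (seg_snd z)\<bar>) * K (length (incs z))
      \<le> (ennreal (1 / 2) * (?\<phi> (fst z) * of_nat (length (incs z))) + ennreal (1 / 2) * sum_list (map ?\<phi> (incs z))) * K (length (incs z))"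
      by (rule mult_right_mono) simp
    then show "ennreal (\<bar>hd_diff z\<bar> * \<bar>real_of_int (seg_fst z) - real_of_int (seg_snd z)\<bar>) * K (length (incs z))
      \<le> ennreal (1 / 2) * (?\<phi> (fst z) * (of_nat (length (incs z)) * K (length (incs z))))
        + ennreal (1 / 2) * (sum_list (map ?\<phi> (incs z)) * K (length (incs z)))"
      by (simp only: distrib_right mult.assoc)
  qed
  also have "\<dots> = ennreal (1 / 2) * (\<integral>\<^sup>+z. ?\<phi> (fst z) * (of_nat (length (incs z)) * K (length (incs z))) \<partial>seg j q)
        + ennreal (1 / 2) * (\<integral>\<^sup>+z. sum_list (map ?\<phi> (incs z)) * K (length (incs z)) \<partial>seg j q)"
    by (simp add: nn_integral_add nn_integral_cmult)
  also have "\<dots> \<le> ennreal (1 / 2) * (ennreal (4.65 * \<theta>\<^sup>2) * ?I) + ennreal (1 / 2) * (ennreal (4.65 * \<theta>\<^sup>2) * ?I)"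
    by (intro add_mono mult_left_mono nn_integral_seg_head[where \<phi> = ?\<phi> and w = "\<lambda>t. of_nat t * K t"]
        nn_integral_seg_sum[where \<phi> = ?\<phi> and w = K] second_moment_diff) auto
  also have "\<dots> = ennreal (4.65 * \<theta>\<^sup>2) * ?I"
  proof -
    have "ennreal (1 / 2) + ennreal (1 / 2) = ennreal (1 / 2 + 1 / 2)" by (rule ennreal_plus[symmetric]) auto
    also have "\<dots> = 1" by simp
    finally show ?thesis unfolding distrib_right[symmetric] by simp
  qed
  finally show ?thesis .
qed

end

section \<open>Sums of independent integer variables\<close>

definition conv :: "int pmf \<Rightarrow> int pmf \<Rightarrow> int pmf" where
  "conv p q = bind_pmf p (\<lambda>u. map_pmf ((+) u) q)"

lemma conv_commute: "conv p q = conv q p"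
  unfolding conv_def map_pmf_def by (subst bind_commute_pmf) (simp add: add.commute)

lemma conv_bind: "conv (bind_pmf p f) (bind_pmf q g) = bind_pmf p (\<lambda>a. bind_pmf q (\<lambda>b. conv (f a) (g b)))"
proof -
  have "conv (bind_pmf p f) (bind_pmf q g) = bind_pmf p (\<lambda>a. bind_pmf (f a) (\<lambda>u. bind_pmf q (\<lambda>b. map_pmf ((+) u) (g b))))"
    by (simp add: conv_def bind_assoc_pmf map_bind_pmf)
  also have "\<dots> = bind_pmf p (\<lambda>a. bind_pmf q (\<lambda>b. conv (f a) (g b)))"
    unfolding conv_def by (rule bind_pmf_cong[OF refl], rule bind_commute_pmf)
  finally show ?thesis .
qed

lemma conv_map: "conv (map_pmf ((+) a) p) (map_pmf ((+) b) q) = map_pmf ((+) (a + b)) (conv p q)"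
  by (simp add: conv_def bind_map_pmf map_bind_pmf map_pmf_comp add_ac)

lemma expectation_conv:
  fixes F :: "int \<Rightarrow> real"
  assumes "\<And>w. \<bar>F w\<bar> \<le> B"
  shows "expect (conv p q) F = expect p (\<lambda>u. expect q (\<lambda>v. F (u + v)))"
  unfolding conv_def by (subst integral_bind_pmf) (auto intro: integrable_bounded_pmf assms)

lemma int_lipschitz:
  fixes f :: "int \<Rightarrow> real"
  assumes "\<And>a. \<bar>f (a + 1) - f a\<bar> \<le> b"
  shows "\<bar>f x - f y\<bar> \<le> b * \<bar>real_of_int x - real_of_int y\<bar>"
proof -
  have up: "\<bar>f (y + int k) - f y\<bar> \<le> b * real k" for y k
  proof (induction k)
    case (Suc k)
    have "y + int (Suc k) = y + int k + 1" by simp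
    then have "\<bar>f (y + int (Suc k)) - f y\<bar> \<le> \<bar>f (y + int k + 1) - f (y + int k)\<bar> + \<bar>f (y + int k) - f y\<bar>"
      by (simp only:)
    then show ?case using Suc assms[of "y + int k"] by (simp add: distrib_left)
  qed simp
  show ?thesis
  proof (cases "y \<le> x")
    case True
    then show ?thesis using up[of y "nat (x - y)"] by simp
  next
    case False
    then show ?thesis using up[of x "nat (y - x)"] by (simp add: abs_minus_commute)
  qed
qed

lemma discrete_taylor:
  fixes f :: "int \<Rightarrow> real"
  assumes D: "\<And>a. \<bar>(f (a + 1) - f a) - d\<bar> \<le> b * \<bar>real_of_int a\<bar>" and b: "0 \<le> b"
  shows "\<bar>f x - f 0 - real_of_int x * d\<bar> \<le> b * (real_of_int x)\<^sup>2"
proof (induction x rule: int_induct[of _ 0])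
  case (step1 i)
  have "\<bar>f (i + 1) - f 0 - real_of_int (i + 1) * d\<bar> \<le> \<bar>f i - f 0 - real_of_int i * d\<bar> + \<bar>(f (i + 1) - f i) - d\<bar>"
    by (simp add: algebra_simps)
  also have "\<dots> \<le> b * (real_of_int i)\<^sup>2 + b * \<bar>real_of_int i\<bar>" by (intro add_mono step1 D)
  also have "\<dots> = b * ((real_of_int i)\<^sup>2 + \<bar>real_of_int i\<bar>)" by (simp add: distrib_left)
  also have "\<dots> \<le> b * (real_of_int (i + 1))\<^sup>2"
    using step1(1) b by (intro mult_left_mono) (auto simp: power2_eq_square algebra_simps)
  finally show ?case .
next
  case (step2 i)
  have "\<bar>f (i - 1) - f 0 - real_of_int (i - 1) * d\<bar> \<le> \<bar>f i - f 0 - real_of_int i * d\<bar> + \<bar>(f i - f (i - 1)) - d\<bar>"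
    by (simp add: algebra_simps)
  also have "\<dots> \<le> b * (real_of_int i)\<^sup>2 + b * \<bar>real_of_int (i - 1)\<bar>"
    using D[of "i - 1"] by (intro add_mono step2) simp
  also have "\<dots> = b * ((real_of_int i)\<^sup>2 + \<bar>real_of_int (i - 1)\<bar>)" by (simp add: distrib_left)
  also have "\<dots> \<le> b * (real_of_int (i - 1))\<^sup>2"
    using step2(1) b by (intro mult_left_mono) (auto simp: power2_eq_square algebra_simps)
  finally show ?case .
qed simp

section \<open>Independent remainders on both sides\<close>

context markov_sum begin

text \<open>What is left of W outside a segment with meetings at both ends: \<open>r\<close> steps
  to the right and \<open>q\<close> reversed steps to the left, each started in 0. If no meeting
  occurs inside the window, the count on that side is 0 and the starting state is
  immaterial.\<close>

definition RL :: "nat \<Rightarrow> nat \<Rightarrow> int pmf" where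
  "RL r q = conv (sumlaw P Q r 0) (sumlaw R Q q 0)"

text \<open>The strong Markov property on both sides at once, with \<open>c\<close> the part in
  between. The starting pairs on the two sides are independent parameters because \<open>mid\<close>
  begins with different ones.\<close>

lemma meet_RL_fst:
  "bind_pmf (meet P Q j s) (\<lambda>a. bind_pmf (meet R Q q s') (\<lambda>b.
     map_pmf ((+) (c + sum_list (map fst a) + sum_list (map fst b))) (RL (j - length a) (q - length b))))
   = map_pmf ((+) c) (conv (sumlaw P Q j (fst s)) (sumlaw R Q q (fst s')))"
  using arg_cong2[OF meet_continue_fst[of P Q j "fst s" "snd s"] meet_continue_fst[of R Q q "fst s'" "snd s'"],
      of "\<lambda>p q. map_pmf ((+) c) (conv p q)"]
  by (simp add: conv_bind conv_map map_bind_pmf map_pmf_comp RL_def add.assoc[symmetric])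

lemma meet_RL_snd:
  "bind_pmf (meet P Q j s) (\<lambda>a. bind_pmf (meet R Q q s') (\<lambda>b.
     map_pmf ((+) (c + sum_list (map snd a) + sum_list (map snd b))) (RL (j - length a) (q - length b))))
   = map_pmf ((+) c) (conv (sumlaw P Q j (snd s)) (sumlaw R Q q (snd s')))"
  using arg_cong2[OF meet_continue_snd[of P Q j "fst s" "snd s"] meet_continue_snd[of R Q q "fst s'" "snd s'"],
      of "\<lambda>p q. map_pmf ((+) c) (conv p q)"]
  by (simp add: conv_bind conv_map map_bind_pmf map_pmf_comp RL_def add.assoc[symmetric])

lemma beta_tilde_ge: "beta P Q m \<le> beta_tilde \<pi> P Q m" "beta R Q m \<le> beta_tilde \<pi> P Q m"
  by (simp_all add: beta_tilde_def)

lemma beta_tilde_nonneg: "0 \<le> beta_tilde \<pi> P Q m"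
  using fwd.beta_nonneg[of m] beta_tilde_ge(1)[of m] by linarith

lemma conv_smooth:
  fixes D :: "int \<Rightarrow> real"
  assumes D: "\<And>w. \<bar>D w\<bar> \<le> \<kappa>"
    and q: "\<And>F. (\<And>w. \<bar>F w\<bar> \<le> \<kappa>) \<Longrightarrow> \<bar>expect q (\<lambda>w. F (w + 1)) - expect q F\<bar> \<le> B"
  shows "\<bar>expect (conv p q) (\<lambda>w. D (a + 1 + w)) - expect (conv p q) (\<lambda>w. D (a + w))\<bar> \<le> B"
proof -
  have b: "\<bar>expect q (\<lambda>v. D (f v))\<bar> \<le> \<kappa>" for f
    by (rule abs_expectation_le_const) (rule D)
  have "expect (conv p q) (\<lambda>w. D (a + 1 + w)) - expect (conv p q) (\<lambda>w. D (a + w))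
     = expect p (\<lambda>u. expect q (\<lambda>v. D (a + 1 + (u + v))))
       - expect p (\<lambda>u. expect q (\<lambda>v. D (a + (u + v))))"
    using D by (simp add: expectation_conv[where B = \<kappa>])
  also have "\<dots> = expect p (\<lambda>u. expect q (\<lambda>v. D (a + 1 + (u + v))) - expect q (\<lambda>v. D (a + (u + v))))"
    by (rule Bochner_Integration.integral_diff[symmetric]) (rule integrable_bounded_pmf[OF b])+
  also have "\<bar>\<dots>\<bar> \<le> B"
  proof (rule abs_expectation_le_const)
    fix u
    have "(\<lambda>v. D (a + 1 + (u + v))) = (\<lambda>v. D (a + (u + (v + 1))))" by (simp add: algebra_simps)
    then show "\<bar>expect q (\<lambda>v. D (a + 1 + (u + v))) - expect q (\<lambda>v. D (a + (u + v)))\<bar> \<le> B"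
      using q[of "\<lambda>v. D (a + (u + v))"] D by simp
  qed
  finally show ?thesis .
qed

text \<open>One long piece suffices: the other is independent of it and is averaged out, and unit
  shifts accumulate linearly.\<close>

lemma RL_smooth:
  fixes D :: "int \<Rightarrow> real"
  assumes D: "\<And>w. \<bar>D w\<bar> \<le> \<kappa>" and m: "m \<le> r \<or> m \<le> q"
  shows "\<bar>expect (RL r q) (\<lambda>w. D (x + w)) - expect (RL r q) (\<lambda>w. D (y + w))\<bar>
     \<le> \<kappa> * beta_tilde \<pi> P Q m * \<bar>real_of_int x - real_of_int y\<bar>"
proof (rule int_lipschitz)
  fix a
  have k: "0 \<le> \<kappa>" using D[of 0] by simp
  from m show "\<bar>expect (RL r q) (\<lambda>w. D (a + 1 + w)) - expect (RL r q) (\<lambda>w. D (a + w))\<bar>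
     \<le> \<kappa> * beta_tilde \<pi> P Q m"
  proof
    assume m: "m \<le> q"
    show ?thesis unfolding RL_def
    proof (rule conv_smooth[OF D])
      fix F :: "int \<Rightarrow> real" assume F: "\<And>w. \<bar>F w\<bar> \<le> \<kappa>"
      have "\<kappa> * beta R Q m \<le> \<kappa> * beta_tilde \<pi> P Q m" by (intro mult_left_mono beta_tilde_ge k)
      then show "\<bar>expect (sumlaw R Q q 0) (\<lambda>w. F (w + 1)) - expect (sumlaw R Q q 0) F\<bar>
         \<le> \<kappa> * beta_tilde \<pi> P Q m"
        using bwd.smooth_sumlaw[OF m F] by (rule order_trans[rotated])
    qed
  next
    assume m: "m \<le> r"
    show ?thesis unfolding RL_def conv_commute[of "sumlaw P Q r 0"]
    proof (rule conv_smooth[OF D])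
      fix F :: "int \<Rightarrow> real" assume F: "\<And>w. \<bar>F w\<bar> \<le> \<kappa>"
      have "\<kappa> * beta P Q m \<le> \<kappa> * beta_tilde \<pi> P Q m" by (intro mult_left_mono beta_tilde_ge k)
      then show "\<bar>expect (sumlaw P Q r 0) (\<lambda>w. F (w + 1)) - expect (sumlaw P Q r 0) F\<bar>
         \<le> \<kappa> * beta_tilde \<pi> P Q m"
        using fwd.smooth_sumlaw[OF m F] by (rule order_trans[rotated])
    qed
  qed
qed

text \<open>A coupling of \<open>RL r q\<close> with the law of W. The true chain runs from
  \<open>x\<close> through \<open>k\<close> more observed steps; on the right of this stretch and,
  reversed, on its left, a copy started in 0 is run against it until they meet. The first components
  rebuild \<open>RL\<close> without the stretch (\<open>mid_fst\<close>), the second components W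
  with it (\<open>mid_snd\<close>).\<close>

definition mid :: "nat \<Rightarrow> nat \<Rightarrow> nat \<Rightarrow> (int \<times> (int \<times> int) list \<times> (int \<times> int) list) pmf" where
  "mid k r q = bind_pmf \<pi> (\<lambda>x. bind_pmf (Q x) (\<lambda>y. bind_pmf (joint_law P Q x k) (\<lambda>p.
     bind_pmf (meet P Q r (0, fst p)) (\<lambda>a. map_pmf (\<lambda>b. (y + snd p, a, b)) (meet R Q q (0, x))))))"

lemma mid_fst:
  "bind_pmf (mid k r q) (\<lambda>z. map_pmf ((+) (sum_list (map fst (fst (snd z))) + sum_list (map fst (snd (snd z)))))
      (RL (r - length (fst (snd z))) (q - length (snd (snd z))))) = RL r q"
proof -
  have "((+) 0) = (id :: int \<Rightarrow> int)" by auto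
  then show ?thesis
    using meet_RL_fst[where c = 0 and j = r and q = q]
    by (simp add: mid_def bind_assoc_pmf bind_map_pmf RL_def pmf.map_id)
qed

lemma mid_snd:
  "bind_pmf (mid k r q) (\<lambda>z. map_pmf ((+) (fst z + sum_list (map snd (fst (snd z))) + sum_list (map snd (snd (snd z)))))
      (RL (r - length (fst (snd z))) (q - length (snd (snd z))))) = W_law \<pi> P Q (q + Suc (k + r))"
proof -
  have "bind_pmf (mid k r q) (\<lambda>z. map_pmf ((+) (fst z + sum_list (map snd (fst (snd z))) + sum_list (map snd (snd (snd z)))))
      (RL (r - length (fst (snd z))) (q - length (snd (snd z)))))
    = bind_pmf \<pi> (\<lambda>x. bind_pmf (Q x) (\<lambda>y. bind_pmf (joint_law P Q x k) (\<lambda>p.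
        map_pmf ((+) (y + snd p)) (conv (sumlaw P Q r (fst p)) (sumlaw R Q q x)))))"
    by (simp add: mid_def bind_assoc_pmf bind_map_pmf meet_RL_snd)
  also have "\<dots> = bind_pmf \<pi> (\<lambda>x. bind_pmf (Q x) (\<lambda>y. map_pmf ((+) y) (conv (sumlaw P Q (k + r) x) (sumlaw R Q q x))))"
    by (simp add: sumlaw_add conv_def bind_assoc_pmf map_bind_pmf bind_map_pmf map_pmf_comp add.assoc)
  also have "\<dots> = bind_pmf \<pi> (\<lambda>x. bind_pmf (sumlaw R Q q x) (\<lambda>L. bind_pmf (Q x) (\<lambda>y.
        map_pmf (\<lambda>R. L + y + R) (sumlaw P Q (k + r) x))))"
  proof (rule bind_pmf_cong[OF refl])
    fix x
    have "bind_pmf (Q x) (\<lambda>y. map_pmf ((+) y) (conv (sumlaw P Q (k + r) x) (sumlaw R Q q x)))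
       = bind_pmf (Q x) (\<lambda>y. bind_pmf (sumlaw R Q q x) (\<lambda>L. map_pmf (\<lambda>R. L + y + R) (sumlaw P Q (k + r) x)))"
      by (subst conv_commute, simp only: conv_def map_bind_pmf map_pmf_comp)
         (intro bind_pmf_cong map_pmf_cong refl, simp)
    also have "\<dots> = bind_pmf (sumlaw R Q q x) (\<lambda>L. bind_pmf (Q x) (\<lambda>y. map_pmf (\<lambda>R. L + y + R) (sumlaw P Q (k + r) x)))"
      by (rule bind_commute_pmf)
    finally show "bind_pmf (Q x) (\<lambda>y. map_pmf ((+) y) (conv (sumlaw P Q (k + r) x) (sumlaw R Q q x)))
      = bind_pmf (sumlaw R Q q x) (\<lambda>L. bind_pmf (Q x) (\<lambda>y. map_pmf (\<lambda>R. L + y + R) (sumlaw P Q (k + r) x)))" .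
  qed
  finally show ?thesis unfolding W_law_split[OF fwd.stat] .
qed

text \<open>The state at the end of the stretch depends on \<open>x\<close> but is again distributed
  as \<pi>. Means add regardless of dependence, so both sides reduce to
  \<open>mean_meet_bounds\<close>; the stretch itself costs 1.26 \<theta> per observation and each
  mismatched pair 2.16 \<theta>.\<close>

lemma mid_moments:
  "(\<integral>\<^sup>+z. ennreal \<bar>real_of_int (fst z)\<bar> \<partial>mid k r q) \<le> of_nat (Suc k) * ennreal (1.26 * \<theta>)"
  "(\<integral>\<^sup>+z. ennreal \<bar>real_of_int (sum_list (map fst (fst (snd z)))) - real_of_int (sum_list (map snd (fst (snd z))))\<bar>
      + ennreal \<bar>real_of_int (sum_list (map fst (snd (snd z)))) - real_of_int (sum_list (map snd (snd (snd z))))\<bar> \<partial>mid k r q)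
    \<le> ennreal (2.16 * \<theta>) * ennreal T1"
  "(\<integral>\<^sup>+z. of_nat (length (fst (snd z)) + length (snd (snd z))) \<partial>mid k r q) \<le> ennreal T1"
proof -
  have split: "(\<integral>\<^sup>+z. F (fst (snd z)) + G (snd (snd z)) \<partial>mid k r q)
      = (\<integral>\<^sup>+x. \<integral>\<^sup>+a. F a \<partial>meet P Q r (0, x) \<partial>\<pi>) + (\<integral>\<^sup>+x. \<integral>\<^sup>+b. G b \<partial>meet R Q q (0, x) \<partial>\<pi>)"
    for F G :: "(int \<times> int) list \<Rightarrow> ennreal"
  proof -
    have "(\<integral>\<^sup>+z. F (fst (snd z)) + G (snd (snd z)) \<partial>mid k r q)
      = (\<integral>\<^sup>+x. \<integral>\<^sup>+p. \<integral>\<^sup>+a. F a \<partial>meet P Q r (0, fst p) \<partial>joint_law P Q x k \<partial>\<pi>) + (\<integral>\<^sup>+x. \<integral>\<^sup>+b. G b \<partial>meet R Q q (0, x) \<partial>\<pi>)"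
      by (simp add: mid_def nn_integral_add)
    also have "(\<integral>\<^sup>+x. \<integral>\<^sup>+p. \<integral>\<^sup>+a. F a \<partial>meet P Q r (0, fst p) \<partial>joint_law P Q x k \<partial>\<pi>)
       = (\<integral>\<^sup>+z. \<integral>\<^sup>+a. F a \<partial>meet P Q r (0, z) \<partial>bind_pmf \<pi> (\<lambda>x. map_pmf fst (joint_law P Q x k)))"
      by simp
    finally show ?thesis unfolding fwd.joint_law_stationary .
  qed
  have bounds: "(\<integral>\<^sup>+x. \<integral>\<^sup>+a. of_nat (length a) \<partial>meet P Q r (0, x) \<partial>\<pi>) + (\<integral>\<^sup>+x. \<integral>\<^sup>+b. of_nat (length b) \<partial>meet R Q q (0, x) \<partial>\<pi>) \<le> ennreal T1"
    using mean_meet_bounds[of q r] by (simp add: add.commute)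
  show "(\<integral>\<^sup>+z. of_nat (length (fst (snd z)) + length (snd (snd z))) \<partial>mid k r q) \<le> ennreal T1"
    using bounds split[of "\<lambda>l. of_nat (length l)" "\<lambda>l. of_nat (length l)"] by simp
  show "(\<integral>\<^sup>+z. ennreal \<bar>real_of_int (fst z)\<bar> \<partial>mid k r q) \<le> of_nat (Suc k) * ennreal (1.26 * \<theta>)"
  proof -
    have "(\<integral>\<^sup>+z. ennreal \<bar>real_of_int (fst z)\<bar> \<partial>mid k r q)
       = (\<integral>\<^sup>+x. \<integral>\<^sup>+y. \<integral>\<^sup>+p. ennreal \<bar>real_of_int y + real_of_int (snd p)\<bar> \<partial>joint_law P Q x k \<partial>Q x \<partial>\<pi>)"
      by (simp add: mid_def)
    also have "\<dots> \<le> (\<integral>\<^sup>+x. \<integral>\<^sup>+y. \<integral>\<^sup>+p. ennreal \<bar>real_of_int y\<bar> + ennreal \<bar>real_of_int (snd p)\<bar> \<partial>joint_law P Q x k \<partial>Q x \<partial>\<pi>)"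
      by (intro nn_integral_mono ennreal_abs_add_le)
    also have "\<dots> = (\<integral>\<^sup>+x. (\<integral>\<^sup>+y. ennreal \<bar>real_of_int y\<bar> \<partial>Q x) + (\<integral>\<^sup>+p. ennreal \<bar>real_of_int (snd p)\<bar> \<partial>joint_law P Q x k) \<partial>\<pi>)"
      by (simp add: nn_integral_add)
    also have "\<dots> \<le> ennreal (1.26 * \<theta>) + of_nat k * ennreal (1.26 * \<theta>)"
      using fwd.supp by (intro nn_integral_le_const_pmf add_mono first_moment fwd.nn_integral_abs_joint_law) auto
    finally show ?thesis by (simp add: distrib_right)
  qed
  have len: "(\<integral>\<^sup>+l. ennreal \<bar>real_of_int (sum_list (map fst l)) - real_of_int (sum_list (map snd l))\<bar> \<partial>M)
     \<le> (\<integral>\<^sup>+l. sum_list (map (\<lambda>p. ennreal \<bar>real_of_int (fst p) - real_of_int (snd p)\<bar>) l) * 1 \<partial>M)" for M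
  proof (rule nn_integral_mono)
    fix l :: "(int \<times> int) list"
    have "\<bar>sum_list (map (\<lambda>p. real_of_int (fst p) - real_of_int (snd p)) l)\<bar> \<le> sum_list (map (\<lambda>p. \<bar>real_of_int (fst p) - real_of_int (snd p)\<bar>) l)"
      by (induction l) auto
    then show "ennreal \<bar>real_of_int (sum_list (map fst l)) - real_of_int (sum_list (map snd l))\<bar>
      \<le> sum_list (map (\<lambda>p. ennreal \<bar>real_of_int (fst p) - real_of_int (snd p)\<bar>) l) * 1"
      unfolding of_int_sum_list_diff
      using ennreal_sum_list[of "\<lambda>p. \<bar>real_of_int (fst p) - real_of_int (snd p)\<bar>" l] by (simp add: ennreal_leI)
  qed
  have "(\<integral>\<^sup>+z. ennreal \<bar>real_of_int (sum_list (map fst (fst (snd z)))) - real_of_int (sum_list (map snd (fst (snd z))))\<bar>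
      + ennreal \<bar>real_of_int (sum_list (map fst (snd (snd z)))) - real_of_int (sum_list (map snd (snd (snd z))))\<bar> \<partial>mid k r q)
     \<le> (\<integral>\<^sup>+x. ennreal (2.16 * \<theta>) * (\<integral>\<^sup>+a. of_nat (length a) * 1 \<partial>meet P Q r (0, x)) \<partial>\<pi>)
       + (\<integral>\<^sup>+x. ennreal (2.16 * \<theta>) * (\<integral>\<^sup>+b. of_nat (length b) * 1 \<partial>meet R Q q (0, x)) \<partial>\<pi>)"
    unfolding split[of "\<lambda>l. ennreal \<bar>real_of_int (sum_list (map fst l)) - real_of_int (sum_list (map snd l))\<bar>"
        "\<lambda>l. ennreal \<bar>real_of_int (sum_list (map fst l)) - real_of_int (sum_list (map snd l))\<bar>"]
    using fwd.supp fwd.zero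
    by (intro add_mono nn_integral_mono_pmf order_trans[OF len]
        fwd.nn_integral_meet_sum[where f = "\<lambda>_. 1"] bwd.nn_integral_meet_sum[where f = "\<lambda>_. 1"] first_moment_diff) auto
  also have "\<dots> = ennreal (2.16 * \<theta>) * ((\<integral>\<^sup>+x. \<integral>\<^sup>+a. of_nat (length a) \<partial>meet P Q r (0, x) \<partial>\<pi>) + (\<integral>\<^sup>+x. \<integral>\<^sup>+b. of_nat (length b) \<partial>meet R Q q (0, x) \<partial>\<pi>))"
    by (simp add: nn_integral_cmult distrib_left)
  also have "\<dots> \<le> ennreal (2.16 * \<theta>) * ennreal T1" by (intro mult_left_mono bounds) simp
  finally show "(\<integral>\<^sup>+z. ennreal \<bar>real_of_int (sum_list (map fst (fst (snd z)))) - real_of_int (sum_list (map snd (fst (snd z))))\<bar>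
      + ennreal \<bar>real_of_int (sum_list (map fst (snd (snd z)))) - real_of_int (sum_list (map snd (snd (snd z))))\<bar> \<partial>mid k r q)
    \<le> ennreal (2.16 * \<theta>) * ennreal T1" .
qed

text \<open>If both one-sided remainders are shorter than \<open>n / 4\<close>, then more than \<open>n / 2\<close> of the observations lie
  in the middle part or before the two meeting times; this event is handled by Markov's inequality.\<close>

lemma RL_compare_W_law:
  fixes D :: "int \<Rightarrow> real"
  assumes D: "\<And>w. \<bar>D w\<bar> \<le> \<kappa>" and n: "n = q + Suc (k + r)" and m: "4 * m \<le> n"
  shows "\<bar>expect (RL r q) D - expect (W_law \<pi> P Q n) D\<bar>
     \<le> \<kappa> * (beta_tilde \<pi> P Q m * (1.26 * \<theta> * real (Suc k) + 2.16 * \<theta> * T1) + 4 / real n * (real k + T1))"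
proof -
  define \<beta> where "\<beta> = beta_tilde \<pi> P Q m"
  have \<beta>: "0 \<le> \<beta>" by (simp add: \<beta>_def beta_tilde_nonneg)
  have k0: "0 \<le> \<kappa>" using D[of 0] by simp
  define H where "H z x = expect (RL (r - length (fst (snd z))) (q - length (snd (snd z)))) (\<lambda>w. D (x + w))"
    for z :: "int \<times> (int \<times> int) list \<times> (int \<times> int) list" and x
  define U where "U z = sum_list (map fst (fst (snd z))) + sum_list (map fst (snd (snd z)))"
    for z :: "int \<times> (int \<times> int) list \<times> (int \<times> int) list"
  define V where "V z = fst z + sum_list (map snd (fst (snd z))) + sum_list (map snd (snd (snd z)))"
    for z :: "int \<times> (int \<times> int) list \<times> (int \<times> int) list"
  have H: "\<bar>H z x\<bar> \<le> \<kappa>" for z x unfolding H_def by (rule abs_expectation_le_const) (rule D)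
  have 1: "expect (RL r q) D = expect (mid k r q) (\<lambda>z. H z (U z))"
    unfolding mid_fst[of k r q, symmetric] H_def U_def
    by (subst integral_bind_pmf) (auto intro: integrable_bounded_pmf D)
  have 2: "expect (W_law \<pi> P Q n) D = expect (mid k r q) (\<lambda>z. H z (V z))"
    unfolding n mid_snd[of k r q, symmetric] H_def V_def
    by (subst integral_bind_pmf) (auto intro: integrable_bounded_pmf D)
  define d1 where "d1 l = \<bar>real_of_int (sum_list (map fst l)) - real_of_int (sum_list (map snd l))\<bar>" for l :: "(int \<times> int) list"
  define len where "len z = length (fst (snd z)) + length (snd (snd z))"
    for z :: "int \<times> (int \<times> int) list \<times> (int \<times> int) list"
  have pt: "\<bar>H z (U z) - H z (V z)\<bar> \<le> \<kappa> * \<beta> * \<bar>real_of_int (fst z)\<bar> + \<kappa> * \<beta> * (d1 (fst (snd z)) + d1 (snd (snd z)))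
      + \<kappa> * (4 / real n) * (real k + real (len z))" if z: "z \<in> set_pmf (mid k r q)" for z
  proof -
    have la: "length (fst (snd z)) \<le> r" "length (snd (snd z)) \<le> q"
      using z by (auto simp: mid_def dest: length_meet)
    have nonneg: "0 \<le> \<kappa> * \<beta> * \<bar>real_of_int (fst z)\<bar>" "0 \<le> \<kappa> * \<beta> * (d1 (fst (snd z)) + d1 (snd (snd z)))"
      "0 \<le> \<kappa> * (4 / real n) * (real k + real (len z))"
      using k0 \<beta> by (auto simp: d1_def)
    show ?thesis
    proof (cases "m \<le> r - length (fst (snd z)) \<or> m \<le> q - length (snd (snd z))")
      case True
      have "\<bar>H z (U z) - H z (V z)\<bar> \<le> \<kappa> * \<beta> * \<bar>real_of_int (U z) - real_of_int (V z)\<bar>"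
        unfolding H_def \<beta>_def by (rule RL_smooth[OF D True])
      also have "\<dots> \<le> \<kappa> * \<beta> * (\<bar>real_of_int (fst z)\<bar> + (d1 (fst (snd z)) + d1 (snd (snd z))))"
        using k0 \<beta> by (intro mult_left_mono) (auto simp: U_def V_def d1_def)
      finally show ?thesis using nonneg by (simp add: distrib_left)
    next
      case False
      then have "r - length (fst (snd z)) < m" "q - length (snd (snd z)) < m" by auto
      then have "r < m + length (fst (snd z))" "q < m + length (snd (snd z))" using la by auto
      then have "n \<le> 2 * (k + len z)" using m unfolding len_def n by simp
      then have "real n \<le> 2 * (real k + real (len z))" by (metis of_nat_add of_nat_le_iff of_nat_mult of_nat_numeral)
      moreover have "0 < real n" using n by simp
      ultimately have "2 \<le> 4 / real n * (real k + real (len z))" by (simp add: field_simps)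
      then have "\<kappa> * 2 \<le> \<kappa> * (4 / real n * (real k + real (len z)))" using k0 by (rule mult_left_mono)
      moreover have "\<bar>H z (U z) - H z (V z)\<bar> \<le> \<kappa> * 2" using H[of z "U z"] H[of z "V z"] by linarith
      ultimately show ?thesis using nonneg by (simp add: mult.assoc)
    qed
  qed
  have "\<bar>expect (mid k r q) (\<lambda>z. H z (U z)) - expect (mid k r q) (\<lambda>z. H z (V z))\<bar>
     = \<bar>expect (mid k r q) (\<lambda>z. H z (U z) - H z (V z))\<bar>"
    by (subst Bochner_Integration.integral_diff) (auto intro: integrable_bounded_pmf H)
  also have "\<dots> \<le> \<kappa> * \<beta> * (real (Suc k) * (1.26 * \<theta>)) + \<kappa> * \<beta> * (2.16 * \<theta> * T1) + \<kappa> * (4 / real n) * (real k + T1)"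
  proof (rule abs_integral_le)
    have "(\<integral>\<^sup>+z. ennreal \<bar>H z (U z) - H z (V z)\<bar> \<partial>mid k r q)
       \<le> (\<integral>\<^sup>+z. ennreal (\<kappa> * \<beta>) * ennreal \<bar>real_of_int (fst z)\<bar> + ennreal (\<kappa> * \<beta>) * (ennreal (d1 (fst (snd z))) + ennreal (d1 (snd (snd z))))
           + ennreal (\<kappa> * (4 / real n)) * (of_nat k + of_nat (len z)) \<partial>mid k r q)"
    proof (rule nn_integral_mono_pmf)
      fix z assume z: "z \<in> set_pmf (mid k r q)"
      have "0 \<le> \<kappa> * \<beta>" "0 \<le> \<kappa> * (4 / real n)" "0 \<le> d1 l" for l using k0 \<beta> by (auto simp: d1_def)
      then have "ennreal (\<kappa> * \<beta> * \<bar>real_of_int (fst z)\<bar> + \<kappa> * \<beta> * (d1 (fst (snd z)) + d1 (snd (snd z)))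
      + \<kappa> * (4 / real n) * (real k + real (len z)))
         = ennreal (\<kappa> * \<beta>) * ennreal \<bar>real_of_int (fst z)\<bar> + ennreal (\<kappa> * \<beta>) * (ennreal (d1 (fst (snd z))) + ennreal (d1 (snd (snd z))))
           + ennreal (\<kappa> * (4 / real n)) * (of_nat k + of_nat (len z))"
        by (simp add: ennreal_mult ennreal_of_nat_eq_real_of_nat del: times_divide_eq_right)
      then show "ennreal \<bar>H z (U z) - H z (V z)\<bar> \<le> ennreal (\<kappa> * \<beta>) * ennreal \<bar>real_of_int (fst z)\<bar> + ennreal (\<kappa> * \<beta>) * (ennreal (d1 (fst (snd z))) + ennreal (d1 (snd (snd z))))
           + ennreal (\<kappa> * (4 / real n)) * (of_nat k + of_nat (len z))"
        using ennreal_leI[OF pt[OF z]] by simp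
    qed
    also have "\<dots> = ennreal (\<kappa> * \<beta>) * (\<integral>\<^sup>+z. ennreal \<bar>real_of_int (fst z)\<bar> \<partial>mid k r q)
        + ennreal (\<kappa> * \<beta>) * (\<integral>\<^sup>+z. ennreal (d1 (fst (snd z))) + ennreal (d1 (snd (snd z))) \<partial>mid k r q)
        + ennreal (\<kappa> * (4 / real n)) * (of_nat k + (\<integral>\<^sup>+z. of_nat (len z) \<partial>mid k r q))"
    proof -
      have "(\<integral>\<^sup>+z. of_nat k + of_nat (len z) \<partial>mid k r q) = (of_nat k :: ennreal) + (\<integral>\<^sup>+z. of_nat (len z) \<partial>mid k r q)"
        by (subst nn_integral_add) auto
      moreover have "(\<integral>\<^sup>+z. f z + g z + h z \<partial>mid k r q) = (\<integral>\<^sup>+z. f z \<partial>mid k r q) + (\<integral>\<^sup>+z. g z \<partial>mid k r q) + (\<integral>\<^sup>+z. h z \<partial>mid k r q)"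
        for f g h :: "_ \<Rightarrow> ennreal"
        by (simp add: nn_integral_add)
      moreover have "(\<integral>\<^sup>+z. c * f z \<partial>mid k r q) = c * (\<integral>\<^sup>+z. f z \<partial>mid k r q)" for c and f :: "_ \<Rightarrow> ennreal"
        by (rule nn_integral_cmult) simp
      ultimately show ?thesis by simp
    qed
    also have "\<dots> \<le> ennreal (\<kappa> * \<beta>) * (of_nat (Suc k) * ennreal (1.26 * \<theta>)) + ennreal (\<kappa> * \<beta>) * (ennreal (2.16 * \<theta>) * ennreal T1)
        + ennreal (\<kappa> * (4 / real n)) * (of_nat k + ennreal T1)"
      unfolding d1_def len_def by (intro add_mono mult_left_mono mid_moments order_refl) auto
    also have "\<dots> = ennreal (\<kappa> * \<beta> * (real (Suc k) * (1.26 * \<theta>)) + \<kappa> * \<beta> * (2.16 * \<theta> * T1) + \<kappa> * (4 / real n) * (real k + T1))"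
    proof -
      have a: "0 \<le> \<kappa> * \<beta>" "0 \<le> \<kappa> * (4 / real n)" "0 \<le> 1.26 * \<theta>" "0 \<le> 2.16 * \<theta>" using k0 \<beta> theta_ge_1 by auto
      have "ennreal a * (of_nat (Suc k) * ennreal b) + ennreal a * (ennreal c * ennreal T1) + ennreal d * (of_nat k + ennreal T1)
         = ennreal (a * (real (Suc k) * b) + a * (c * T1) + d * (real k + T1))"
        if "0 \<le> a" "0 \<le> b" "0 \<le> c" "0 \<le> d" for a b c d
        using that T1_nonneg by (simp add: ennreal_mult ennreal_of_nat_eq_real_of_nat del: of_nat_Suc)
      from this[OF a(1) a(3) a(4) a(2)] show ?thesis .
    qed
    finally show "(\<integral>\<^sup>+z. ennreal \<bar>H z (U z) - H z (V z)\<bar> \<partial>mid k r q) \<le> ennreal (\<kappa> * \<beta> * (real (Suc k) * (1.26 * \<theta>)) + \<kappa> * \<beta> * (2.16 * \<theta> * T1) + \<kappa> * (4 / real n) * (real k + T1))" .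
    show "0 \<le> \<kappa> * \<beta> * (real (Suc k) * (1.26 * \<theta>)) + \<kappa> * \<beta> * (2.16 * \<theta> * T1) + \<kappa> * (4 / real n) * (real k + T1)"
      using k0 \<beta> theta_ge_1 T1_nonneg by simp
  qed
  also have "\<dots> = \<kappa> * (\<beta> * (1.26 * \<theta> * real (Suc k) + 2.16 * \<theta> * T1) + 4 / real n * (real k + T1))"
    by (simp add: algebra_simps)
  finally show ?thesis unfolding 1 2 \<beta>_def .
qed

end

section \<open>Exchanging segments\<close>

lemma integrable_product_pmf:
  fixes X Y :: "'a \<Rightarrow> real"
  assumes "integrable (measure_pmf p) (\<lambda>x. (X x)\<^sup>2)" "integrable (measure_pmf p) (\<lambda>x. (Y x)\<^sup>2)"
  shows "integrable (measure_pmf p) (\<lambda>x. X x * Y x)"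
proof (rule Bochner_Integration.integrable_bound)
  show "integrable (measure_pmf p) (\<lambda>x. (X x)\<^sup>2 + (Y x)\<^sup>2)" using assms by simp
  show "AE x in measure_pmf p. norm (X x * Y x) \<le> norm ((X x)\<^sup>2 + (Y x)\<^sup>2)"
  proof (rule AE_I2)
    fix x
    have "0 \<le> (\<bar>X x\<bar> - \<bar>Y x\<bar>)\<^sup>2" by simp
    then have "2 * (\<bar>X x\<bar> * \<bar>Y x\<bar>) \<le> (X x)\<^sup>2 + (Y x)\<^sup>2" by (simp add: power2_diff)
    moreover have "0 \<le> \<bar>X x\<bar> * \<bar>Y x\<bar>" by simp
    ultimately have "\<bar>X x\<bar> * \<bar>Y x\<bar> \<le> (X x)\<^sup>2 + (Y x)\<^sup>2" by linarith
    then show "norm (X x * Y x) \<le> norm ((X x)\<^sup>2 + (Y x)\<^sup>2)" by (simp add: abs_mult)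
  qed
qed simp

context markov_sum begin

lemma W_law_conv:
  "W_law \<pi> P Q (q + Suc j) = bind_pmf \<pi> (\<lambda>x. bind_pmf (Q x) (\<lambda>y. map_pmf ((+) y) (conv (sumlaw P Q j x) (sumlaw R Q q x))))"
proof -
  have "bind_pmf (sumlaw R Q q x) (\<lambda>L. bind_pmf (Q x) (\<lambda>y. map_pmf (\<lambda>R. L + y + R) (sumlaw P Q j x)))
     = bind_pmf (Q x) (\<lambda>y. map_pmf ((+) y) (conv (sumlaw P Q j x) (sumlaw R Q q x)))" for x
    by (subst bind_commute_pmf, subst conv_commute, simp only: conv_def map_bind_pmf map_pmf_comp)
       (intro bind_pmf_cong map_pmf_cong refl, simp)
  then show ?thesis unfolding W_law_split[OF fwd.stat] by simp
qed

definition obs_law :: "nat \<Rightarrow> nat \<Rightarrow> (int \<times> int) pmf" where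
  "obs_law j q = bind_pmf \<pi> (\<lambda>s. map_pmf (\<lambda>l. (snd (l ! q), sum_list (map snd l))) (traj P Q s (q + Suc j)))"

lemma obs_law_conv:
  "obs_law j q = bind_pmf \<pi> (\<lambda>x. bind_pmf (Q x) (\<lambda>y. map_pmf (Pair y) (map_pmf ((+) y) (conv (sumlaw P Q j x) (sumlaw R Q q x)))))"
proof -
  have "bind_pmf (sumlaw R Q q x) (\<lambda>L. bind_pmf (Q x) (\<lambda>y. map_pmf (\<lambda>R. (y, L + y + R)) (sumlaw P Q j x)))
     = bind_pmf (Q x) (\<lambda>y. map_pmf (Pair y) (map_pmf ((+) y) (conv (sumlaw P Q j x) (sumlaw R Q q x))))" for x
    by (subst bind_commute_pmf, subst conv_commute, simp only: conv_def map_bind_pmf map_pmf_comp)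
       (intro bind_pmf_cong map_pmf_cong refl, simp)
  then show ?thesis unfolding obs_law_def observation_and_sum_law[OF fwd.stat] by simp
qed

lemma map_fst_obs_law: "map_pmf fst (obs_law j q) = bind_pmf \<pi> Q"
  by (simp add: obs_law_conv map_bind_pmf map_pmf_comp map_pmf_const bind_return_pmf')

lemma map_snd_obs_law: "map_pmf snd (obs_law j q) = W_law \<pi> P Q (q + Suc j)"
  by (simp add: obs_law_def W_law_def map_bind_pmf map_pmf_comp)

lemma integrable_square_W_law: "integrable (measure_pmf (W_law \<pi> P Q n)) (\<lambda>w. (real_of_int w)\<^sup>2)"
proof (rule integrable_pmfI)
  have "W_law \<pi> P Q n = bind_pmf \<pi> (sumlaw P Q n)" by (simp add: W_law_def sumlaw_traj[abs_def])
  then have "(\<integral>\<^sup>+w. ennreal \<bar>(real_of_int w)\<^sup>2\<bar> \<partial>W_law \<pi> P Q n) \<le> 4 ^ n * ennreal (2 * \<theta>\<^sup>2)"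
    using fwd.supp
    by simp (intro nn_integral_le_const_pmf fwd.nn_integral_square_sumlaw second_moment, auto)
  also have "\<dots> < \<infinity>" by (simp add: ennreal_mult_less_top power_less_top_ennreal)
  finally show "(\<integral>\<^sup>+w. ennreal \<bar>(real_of_int w)\<^sup>2\<bar> \<partial>W_law \<pi> P Q n) < \<infinity>" .
qed

lemma integrable_square_obs: "integrable (measure_pmf (bind_pmf \<pi> Q)) (\<lambda>y. (real_of_int y)\<^sup>2)"
proof (rule integrable_pmfI)
  have "(\<integral>\<^sup>+w. ennreal \<bar>(real_of_int w)\<^sup>2\<bar> \<partial>bind_pmf \<pi> Q) \<le> ennreal (2 * \<theta>\<^sup>2)"
    using fwd.supp by simp (intro nn_integral_le_const_pmf second_moment, auto)
  then show "(\<integral>\<^sup>+w. ennreal \<bar>(real_of_int w)\<^sup>2\<bar> \<partial>bind_pmf \<pi> Q) < \<infinity>" by (simp add: order_le_less_trans)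
qed

text \<open>The two central observations together with the totals before and after the exchange.
  Both totals share the remainder \<open>w\<close>, whose law depends on the segment through its
  lengths alone.\<close>

definition pair_law :: "nat \<Rightarrow> nat \<Rightarrow> ((int \<times> int) \<times> int \<times> int) pmf" where
  "pair_law j q = bind_pmf (seg j q) (\<lambda>z. map_pmf (\<lambda>w. (fst z, seg_fst z + w, seg_snd z + w))
     (RL (j - length (fst (snd z))) (q - length (snd (snd z)))))"

lemma pair_law_obs: "map_pmf (\<lambda>t. (fst (fst t), fst (snd t))) (pair_law j q) = obs_law j q"
proof -
  define F where "F x y = map_pmf (Pair y) (map_pmf ((+) y) (conv (sumlaw P Q j x) (sumlaw R Q q x)))" for x and y :: int
  have F: "bind_pmf (meet P Q j s) (\<lambda>a. bind_pmf (meet R Q q s) (\<lambda>b. map_pmf (\<lambda>w. (fst p, fst p + sum_list (map fst a) + sum_list (map fst b) + w))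
       (RL (j - length a) (q - length b)))) = F (fst s) (fst p)" for s p
    using arg_cong[OF meet_RL_fst[of j s q s "fst p"], of "map_pmf (Pair (fst p))"]
    by (simp add: F_def map_bind_pmf map_pmf_comp)
  have "map_pmf (\<lambda>t. (fst (fst t), fst (snd t))) (pair_law j q)
     = bind_pmf (pair_pmf \<pi> \<pi>) (\<lambda>s. bind_pmf (pair_pmf (Q (fst s)) (Q (snd s))) (\<lambda>p. F (fst s) (fst p)))"
    unfolding F[symmetric]
    by (simp add: pair_law_def seg_def seg_fst_def incs_def map_bind_pmf map_pmf_comp bind_assoc_pmf bind_map_pmf add.assoc)
  also have "\<dots> = bind_pmf \<pi> (\<lambda>x. bind_pmf (Q x) (F x))"
    using bind_pair_pmf_fst[of \<pi> \<pi> "\<lambda>x. bind_pmf (Q x) (F x)"] by (simp add: bind_pair_pmf_fst)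
  finally show ?thesis unfolding obs_law_conv F_def .
qed

text \<open>The second central observation belongs to the independent copy, and by
  \<open>meet_RL_fst\<close> the first total forgets that copy.\<close>

lemma pair_law_indep: "map_pmf (\<lambda>t. (snd (fst t), fst (snd t))) (pair_law j q)
   = bind_pmf (bind_pmf \<pi> Q) (\<lambda>y. map_pmf (Pair y) (W_law \<pi> P Q (q + Suc j)))"
proof -
  define F where "F x y y' = map_pmf (Pair y') (map_pmf ((+) y) (conv (sumlaw P Q j x) (sumlaw R Q q x)))" for x and y y' :: int
  have F: "bind_pmf (meet P Q j s) (\<lambda>a. bind_pmf (meet R Q q s) (\<lambda>b. map_pmf (\<lambda>w. (snd p, fst p + sum_list (map fst a) + sum_list (map fst b) + w))
       (RL (j - length a) (q - length b)))) = F (fst s) (fst p) (snd p)" for s p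
    using arg_cong[OF meet_RL_fst[of j s q s "fst p"], of "map_pmf (Pair (snd p))"]
    by (simp add: F_def map_bind_pmf map_pmf_comp)
  have "map_pmf (\<lambda>t. (snd (fst t), fst (snd t))) (pair_law j q)
     = bind_pmf (pair_pmf \<pi> \<pi>) (\<lambda>s. bind_pmf (pair_pmf (Q (fst s)) (Q (snd s))) (\<lambda>p. F (fst s) (fst p) (snd p)))"
    unfolding F[symmetric]
    by (simp add: pair_law_def seg_def seg_fst_def incs_def map_bind_pmf map_pmf_comp bind_assoc_pmf bind_map_pmf add.assoc)
  also have "\<dots> = bind_pmf \<pi> (\<lambda>x. bind_pmf \<pi> (\<lambda>x'. bind_pmf (Q x) (\<lambda>y. bind_pmf (Q x') (\<lambda>y'. F x y y'))))"
    by (simp add: pair_pmf_def bind_assoc_pmf bind_return_pmf)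
  also have "\<dots> = bind_pmf \<pi> (\<lambda>x. bind_pmf \<pi> (\<lambda>x'. bind_pmf (Q x') (\<lambda>y'. bind_pmf (Q x) (\<lambda>y. F x y y'))))"
    by (intro bind_pmf_cong refl bind_commute_pmf)
  also have "\<dots> = bind_pmf \<pi> (\<lambda>x. bind_pmf (bind_pmf \<pi> Q) (\<lambda>y'. bind_pmf (Q x) (\<lambda>y. F x y y')))"
    by (simp add: bind_assoc_pmf)
  also have "\<dots> = bind_pmf (bind_pmf \<pi> Q) (\<lambda>y'. bind_pmf \<pi> (\<lambda>x. bind_pmf (Q x) (\<lambda>y. F x y y')))"
    by (rule bind_commute_pmf)
  finally show ?thesis unfolding W_law_conv F_def map_bind_pmf .
qed

text \<open>Exchanging the copies preserves the law of the segment and its lengths, hence also the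
  shared remainder.\<close>

lemma pair_law_swap: "map_pmf (\<lambda>t. (prod.swap (fst t), prod.swap (snd t))) (pair_law j q) = pair_law j q"
proof -
  define sw where "sw z = (prod.swap (fst z), map prod.swap (fst (snd z)), map prod.swap (snd (snd z)))"
    for z :: "(int \<times> int) \<times> (int \<times> int) list \<times> (int \<times> int) list"
  define F where "F s p a = map_pmf (\<lambda>b. (p, a, b)) (meet R Q q s)" for s and p :: "int \<times> int" and a :: "(int \<times> int) list"
  have F: "map_pmf sw (F s p a) = F (prod.swap s) (prod.swap p) (map prod.swap a)" for s p a
    unfolding F_def meet_swap[symmetric] by (simp add: map_pmf_comp sw_def)
  have "map_pmf sw (seg j q) = bind_pmf (pair_pmf \<pi> \<pi>) (\<lambda>s. bind_pmf (pair_pmf (Q (fst s)) (Q (snd s))) (\<lambda>p.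
     bind_pmf (meet P Q j s) (\<lambda>a. F (prod.swap s) (prod.swap p) (map prod.swap a))))"
    by (simp add: seg_def map_bind_pmf F_def[symmetric] F)
  also have "\<dots> = bind_pmf (pair_pmf \<pi> \<pi>) (\<lambda>s. bind_pmf (map_pmf prod.swap (pair_pmf (Q (fst s)) (Q (snd s)))) (\<lambda>p.
     bind_pmf (map_pmf (map prod.swap) (meet P Q j s)) (F (prod.swap s) p)))"
    by (simp add: bind_map_pmf)
  also have "\<dots> = bind_pmf (map_pmf prod.swap (pair_pmf \<pi> \<pi>)) (\<lambda>s. bind_pmf (pair_pmf (Q (fst s)) (Q (snd s))) (\<lambda>p.
     bind_pmf (meet P Q j s) (F s p)))"
    unfolding map_swap_pair_pmf[of "Q _"] meet_swap by (simp add: bind_map_pmf)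
  also have "\<dots> = seg j q" unfolding map_swap_pair_pmf seg_def F_def ..
  finally have sw: "map_pmf sw (seg j q) = seg j q" .
  have "map_pmf (\<lambda>t. (prod.swap (fst t), prod.swap (snd t))) (pair_law j q)
     = bind_pmf (map_pmf sw (seg j q)) (\<lambda>z. map_pmf (\<lambda>w. (fst z, seg_fst z + w, seg_snd z + w))
         (RL (j - length (fst (snd z))) (q - length (snd (snd z)))))"
    by (simp add: pair_law_def map_bind_pmf map_pmf_comp bind_map_pmf sw_def seg_fst_def seg_snd_def incs_def comp_def)
  then show ?thesis unfolding sw pair_law_def .
qed

lemma expectation_via_map:
  fixes f :: "'b \<Rightarrow> real"
  shows "expect (map_pmf h p) f = expect p (\<lambda>x. f (h x))"
    and "integrable (measure_pmf (map_pmf h p)) f \<longleftrightarrow> integrable (measure_pmf p) (\<lambda>x. f (h x))"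
  by (simp_all add: integrable_map_pmf_eq)

text \<open>Expanding the product gives four terms. By symmetry they agree in pairs: the matched
  ones equal E{Y_i G(W)}, and the crossed ones factor into E Y_i times E G(W) because the copy is
  independent of W.\<close>

lemma exchange_identity:
  fixes G :: "int \<Rightarrow> real"
  assumes G: "integrable (measure_pmf (W_law \<pi> P Q (q + Suc j))) (\<lambda>w. (G w)\<^sup>2)"
  shows "integrable (measure_pmf (obs_law j q)) (\<lambda>p. real_of_int (fst p) * G (snd p))"
    and "integrable (measure_pmf (pair_law j q))
      (\<lambda>t. (real_of_int (fst (fst t)) - real_of_int (snd (fst t))) * (G (fst (snd t)) - G (snd (snd t))))"
    and "expect (obs_law j q) (\<lambda>p. real_of_int (fst p) * G (snd p))
        - expect (bind_pmf \<pi> Q) real_of_int * expect (W_law \<pi> P Q (q + Suc j)) G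
      = 1 / 2 * expect (pair_law j q)
         (\<lambda>t. (real_of_int (fst (fst t)) - real_of_int (snd (fst t))) * (G (fst (snd t)) - G (snd (snd t))))"
proof -
  let ?J = "pair_law j q" and ?W = "W_law \<pi> P Q (q + Suc j)"
  let ?I = "bind_pmf (bind_pmf \<pi> Q) (\<lambda>y. map_pmf (Pair y) ?W)"
  define f where "f t = real_of_int (fst (fst t))" for t :: "(int \<times> int) \<times> int \<times> int"
  define s where "s t = real_of_int (snd (fst t))" for t :: "(int \<times> int) \<times> int \<times> int"
  define G1 where "G1 t = G (fst (snd t))" for t :: "(int \<times> int) \<times> int \<times> int"
  define G2 where "G2 t = G (snd (snd t))" for t :: "(int \<times> int) \<times> int \<times> int"
  have o: "integrable (measure_pmf (obs_law j q)) (\<lambda>p. (real_of_int (fst p))\<^sup>2)"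
    "integrable (measure_pmf (obs_law j q)) (\<lambda>p. (G (snd p))\<^sup>2)"
    using integrable_square_obs G unfolding map_fst_obs_law[of j q, symmetric] map_snd_obs_law[of j q, symmetric]
    by (simp_all add: integrable_map_pmf_eq)
  then show io: "integrable (measure_pmf (obs_law j q)) (\<lambda>p. real_of_int (fst p) * G (snd p))"
    by (rule integrable_product_pmf)
  have mI: "map_pmf fst ?I = bind_pmf \<pi> Q" "map_pmf snd ?I = ?W"
    by (simp_all add: map_bind_pmf map_pmf_comp map_pmf_const bind_return_pmf')
  have "integrable (measure_pmf ?I) (\<lambda>p. (real_of_int (fst p))\<^sup>2)" "integrable (measure_pmf ?I) (\<lambda>p. (G (snd p))\<^sup>2)"
    using integrable_square_obs G expectation_via_map(2)[of fst ?I "\<lambda>y. (real_of_int y)\<^sup>2"]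
      expectation_via_map(2)[of snd ?I "\<lambda>w. (G w)\<^sup>2"] unfolding mI by simp_all
  then have iI: "integrable (measure_pmf ?I) (\<lambda>p. real_of_int (fst p) * G (snd p))"
    by (rule integrable_product_pmf)
  have swap: "integrable (measure_pmf ?J) (\<lambda>t. h (prod.swap (fst t), prod.swap (snd t))) \<longleftrightarrow> integrable (measure_pmf ?J) h"
    "expect ?J (\<lambda>t. h (prod.swap (fst t), prod.swap (snd t))) = expect ?J h"
    for h :: "_ \<Rightarrow> real"
    using expectation_via_map[of "\<lambda>t. (prod.swap (fst t), prod.swap (snd t))" ?J h] unfolding pair_law_swap by auto
  have e1: "expect ?J (\<lambda>t. f t * G1 t) = expect (obs_law j q) (\<lambda>p. real_of_int (fst p) * G (snd p))"
    and i1: "integrable (measure_pmf ?J) (\<lambda>t. f t * G1 t)"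
    using io unfolding pair_law_obs[of j q, symmetric] by (simp_all add: f_def G1_def integrable_map_pmf_eq)
  have e2: "expect ?J (\<lambda>t. s t * G1 t) = expect ?I (\<lambda>p. real_of_int (fst p) * G (snd p))"
    and i2: "integrable (measure_pmf ?J) (\<lambda>t. s t * G1 t)"
    using iI unfolding pair_law_indep[of j q, symmetric] by (simp_all add: s_def G1_def integrable_map_pmf_eq)
  have e3: "expect ?J (\<lambda>t. s t * G2 t) = expect ?J (\<lambda>t. f t * G1 t)"
    and i3: "integrable (measure_pmf ?J) (\<lambda>t. s t * G2 t)"
    using swap[of "\<lambda>t. s t * G2 t"] i1 by (simp_all add: f_def s_def G1_def G2_def)
  have e4: "expect ?J (\<lambda>t. f t * G2 t) = expect ?J (\<lambda>t. s t * G1 t)"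
    and i4: "integrable (measure_pmf ?J) (\<lambda>t. f t * G2 t)"
    using swap[of "\<lambda>t. f t * G2 t"] i2 by (simp_all add: f_def s_def G1_def G2_def)
  have expand: "(\<lambda>t. (f t - s t) * (G1 t - G2 t)) = (\<lambda>t. (f t * G1 t + s t * G2 t) - (s t * G1 t + f t * G2 t))"
    by (auto simp: algebra_simps)
  have "integrable (measure_pmf ?J) (\<lambda>t. (f t - s t) * (G1 t - G2 t))"
    unfolding expand by (intro Bochner_Integration.integrable_diff Bochner_Integration.integrable_add i1 i2 i3 i4)
  then show "integrable (measure_pmf ?J)
      (\<lambda>t. (real_of_int (fst (fst t)) - real_of_int (snd (fst t))) * (G (fst (snd t)) - G (snd (snd t))))"
    by (simp add: f_def s_def G1_def G2_def)
  have "expect ?J (\<lambda>t. (f t - s t) * (G1 t - G2 t))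
     = 2 * (expect ?J (\<lambda>t. f t * G1 t) - expect ?J (\<lambda>t. s t * G1 t))"
    unfolding expand by (simp add: i1 i2 i3 i4 e3 e4)
  moreover have "expect ?I (\<lambda>p. real_of_int (fst p) * G (snd p))
     = expect (bind_pmf \<pi> Q) real_of_int * expect ?W G"
    by (subst integral_bind_pmf[OF iI]) simp
  ultimately show "expect (obs_law j q) (\<lambda>p. real_of_int (fst p) * G (snd p))
        - expect (bind_pmf \<pi> Q) real_of_int * expect ?W G
      = 1 / 2 * expect ?J
         (\<lambda>t. (real_of_int (fst (fst t)) - real_of_int (snd (fst t))) * (G (fst (snd t)) - G (snd (snd t))))"
    using e1 e2 by (simp add: f_def s_def G1_def G2_def)
qed

lemma expectation_W_times:
  fixes G :: "int \<Rightarrow> real"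
  assumes G: "integrable (measure_pmf (W_law \<pi> P Q n)) (\<lambda>w. (G w)\<^sup>2)"
  shows "expect (W_law \<pi> P Q n) (\<lambda>w. real_of_int w * G w)
     = (\<Sum>q<n. expect (obs_law (n - Suc q) q) (\<lambda>p. real_of_int (fst p) * G (snd p)))"
proof -
  define T where "T = bind_pmf \<pi> (\<lambda>s. traj P Q s n)"
  have W: "W_law \<pi> P Q n = map_pmf (\<lambda>l. sum_list (map snd l)) T"
    by (simp add: W_law_def T_def map_bind_pmf)
  have o: "obs_law (n - Suc q) q = map_pmf (\<lambda>l. (snd (l ! q), sum_list (map snd l))) T" if "q < n" for q
    using that by (simp add: obs_law_def T_def map_bind_pmf)
  have i: "integrable (measure_pmf T) (\<lambda>l. real_of_int (snd (l ! q)) * G (sum_list (map snd l)))" if "q < n" for q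
    using exchange_identity(1)[of q "n - Suc q" G] that G by (simp add: o integrable_map_pmf_eq)
  have "expect (W_law \<pi> P Q n) (\<lambda>w. real_of_int w * G w)
     = expect T (\<lambda>l. real_of_int (sum_list (map snd l)) * G (sum_list (map snd l)))"
    by (simp add: W)
  also have "\<dots> = expect T (\<lambda>l. \<Sum>q<n. real_of_int (snd (l ! q)) * G (sum_list (map snd l)))"
  proof (rule expectation_cong_pmf)
    fix l assume "l \<in> set_pmf T"
    then have l: "length l = n" by (auto simp: T_def length_traj)
    have "real_of_int (sum_list (map snd l)) = (\<Sum>q<n. real_of_int (snd (l ! q)))"
      by (simp add: sum_list_sum_nth l atLeast0LessThan)
    then show "real_of_int (sum_list (map snd l)) * G (sum_list (map snd l)) = (\<Sum>q<n. real_of_int (snd (l ! q)) * G (sum_list (map snd l)))"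
      by (simp add: sum_distrib_right)
  qed
  also have "\<dots> = (\<Sum>q<n. expect T (\<lambda>l. real_of_int (snd (l ! q)) * G (sum_list (map snd l))))"
    by (rule Bochner_Integration.integral_sum) (simp add: i)
  also have "\<dots> = (\<Sum>q<n. expect (obs_law (n - Suc q) q) (\<lambda>p. real_of_int (fst p) * G (snd p)))"
    by (intro sum.cong refl) (simp add: o)
  finally show ?thesis .
qed

end

section \<open>Assembling the Stein estimate\<close>

context markov_sum begin

text \<open>A small \<beta> spreads the sum of \<open>m\<close> observations out, yet its first
  absolute moment is at most 1.26 \<theta> m, with m <= n / 4. This allows errors of order 1 / n to
  be charged to \<theta> \<beta>.\<close>

lemma beta_tilde_lower_bound:
  assumes m: "4 * m \<le> n" and n: "0 < n"
  shows "1.5 \<le> real n * (1.26 * \<theta>) * beta_tilde \<pi> P Q m"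
proof (rule tent_bound_optimized)
  let ?V = "sumlaw P Q m 0"
  have nn: "(\<integral>\<^sup>+v. ennreal \<bar>real_of_int v\<bar> \<partial>?V) \<le> ennreal (real m * (1.26 * \<theta>))"
  proof -
    have "of_nat m * ennreal e = ennreal (real m * e)" if "0 \<le> e" for e
      using that by (simp add: ennreal_mult ennreal_of_nat_eq_real_of_nat)
    from this[of "1.26 * \<theta>"]
    have e: "of_nat m * ennreal (1.26 * \<theta>) = ennreal (real m * (1.26 * \<theta>))" using theta_ge_1 by simp
    have "(\<integral>\<^sup>+p. ennreal \<bar>real_of_int (snd p)\<bar> \<partial>joint_law P Q 0 m) \<le> of_nat m * ennreal (1.26 * \<theta>)"
      by (rule fwd.nn_integral_abs_joint_law[OF first_moment fwd.zero])
    then show ?thesis unfolding e by (simp add: sumlaw_def)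
  qed
  have int: "integrable (measure_pmf ?V) (\<lambda>v. \<bar>real_of_int v\<bar>)"
    by (rule integrable_pmfI) (use nn in \<open>simp add: order_le_less_trans\<close>)
  have le: "expect ?V (\<lambda>v. \<bar>real_of_int v\<bar>) \<le> real m * (1.26 * \<theta>)"
    using abs_integral_le[of "measure_pmf ?V" "\<lambda>v. \<bar>real_of_int v\<bar>" "real m * (1.26 * \<theta>)"] nn theta_ge_1 by simp
  have "pmf ?V v \<le> beta_tilde \<pi> P Q m / 2" for v
    using fwd.pmf_sumlaw_le_beta[of m v] beta_tilde_ge(1)[of m] by simp
  then have "real M - beta_tilde \<pi> P Q m / 2 * (real M)\<^sup>2 \<le> expect ?V (\<lambda>v. \<bar>real_of_int v\<bar>)" for M
    by (rule expectation_abs_ge_of_pmf_le[OF int])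
  also note le
  also have "real m * (1.26 * \<theta>) \<le> real n * (1.26 * \<theta>) / 4"
    using m theta_ge_1 mult_right_mono[of "4 * real m" "real n" "1.26 * \<theta>"] by (simp add: field_simps)
  finally show "real M - beta_tilde \<pi> P Q m / 2 * (real M)\<^sup>2 \<le> real n * (1.26 * \<theta>) / 4" for M .
  show "1 \<le> real n * (1.26 * \<theta>)"
    using mult_mono[of 1 "real n" 1 "1.26 * \<theta>"] n theta_ge_1 by simp
  show "0 \<le> beta_tilde \<pi> P Q m" by (rule beta_tilde_nonneg)
qed

text \<open>With a long remainder, both values are expanded around 0 with slope \<open>d\<close>,
  the mean of \<Delta>g under \<open>RL\<close>; the quadratic errors carry \<beta>, and replacing
  \<open>d\<close> by \<open>c\<close> costs |x - y| times the bound of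
  \<open>RL_compare_W_law\<close>. Here \<open>Suc k\<close> is the length of the segment.\<close>

lemma segment_exchange_bound:
  fixes g :: "int \<Rightarrow> real"
  assumes g: "\<And>w. \<bar>g (w + 1) - g w\<bar> \<le> \<kappa>" and n: "n = q + Suc (k + r)" and m: "4 * m \<le> n"
    and c: "c = expect (W_law \<pi> P Q n) (\<lambda>w. g (w + 1) - g w)"
  shows "\<bar>expect (RL r q) (\<lambda>w. (g (x + w) - c * real_of_int (x + w)) - (g (y + w) - c * real_of_int (y + w)))\<bar>
    \<le> \<kappa> * (beta_tilde \<pi> P Q m * ((real_of_int x)\<^sup>2 + (real_of_int y)\<^sup>2)
       + \<bar>real_of_int x - real_of_int y\<bar> * (beta_tilde \<pi> P Q m * (1.26 * \<theta> * real (Suc k) + 2.16 * \<theta> * T1) + 4 / real n * (real (Suc k) + T1)))"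
proof -
  define \<beta> where "\<beta> = beta_tilde \<pi> P Q m"
  define D where "D w = g (w + 1) - g w" for w
  \<comment> \<open>Subtracting \<open>g w\<close> leaves an integrand bounded by the Lipschitz
    property, so that only bounded functions are averaged under \<open>RL\<close>.\<close>
  define h where "h a = expect (RL r q) (\<lambda>w. g (a + w) - g w)" for a
  define d where "d = expect (RL r q) D"
  define K where "K = \<beta> * (1.26 * \<theta> * real (Suc k) + 2.16 * \<theta> * T1) + 4 / real n * (real (Suc k) + T1)"
  have \<beta>: "0 \<le> \<beta>" by (simp add: \<beta>_def beta_tilde_nonneg)
  have k0: "0 \<le> \<kappa>" using g[of 0] by simp
  have D: "\<bar>D w\<bar> \<le> \<kappa>" for w using g by (simp add: D_def)
  have lip: "\<bar>g a - g b\<bar> \<le> \<kappa> * \<bar>real_of_int a - real_of_int b\<bar>" for a b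
    by (rule int_lipschitz[of g, OF g])
  have lip_shift: "\<bar>g (a + w) - g (b + w)\<bar> \<le> \<kappa> * \<bar>real_of_int a - real_of_int b\<bar>" for a b w
    using lip[of "a + w" "b + w"] by simp
  have ig: "integrable (measure_pmf (RL r q)) (\<lambda>w. g (a + w) - g (b + w))" for a b
    by (rule integrable_bounded_pmf[where B = "\<kappa> * \<bar>real_of_int a - real_of_int b\<bar>"])
       (rule lip_shift)
  have hd: "h a - h b = expect (RL r q) (\<lambda>w. g (a + w) - g (b + w))" for a b
    unfolding h_def using ig[of a 0] ig[of b 0]
    by (subst Bochner_Integration.integral_diff[symmetric]) auto
  have eq: "expect (RL r q) (\<lambda>w. (g (x + w) - c * real_of_int (x + w)) - (g (y + w) - c * real_of_int (y + w)))
     = h x - h y - c * (real_of_int x - real_of_int y)"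
  proof -
    have "(\<lambda>w. (g (x + w) - c * real_of_int (x + w)) - (g (y + w) - c * real_of_int (y + w)))
       = (\<lambda>w. (g (x + w) - g (y + w)) - c * (real_of_int x - real_of_int y))"
      by (auto simp: algebra_simps)
    then show ?thesis using ig[of x y] by (simp add: hd)
  qed
  have cb: "\<bar>c\<bar> \<le> \<kappa>" unfolding c by (rule abs_expectation_le_const[OF g])
  have T: "0 \<le> 1.26 * \<theta> * real (Suc k) + 2.16 * \<theta> * T1" using theta_ge_1 T1_nonneg by simp
  have K0: "0 \<le> \<beta> * (1.26 * \<theta> * real (Suc k) + 2.16 * \<theta> * T1)" using T \<beta> by simp
  have "\<bar>h x - h y - c * (real_of_int x - real_of_int y)\<bar>
     \<le> \<kappa> * (\<beta> * ((real_of_int x)\<^sup>2 + (real_of_int y)\<^sup>2) + \<bar>real_of_int x - real_of_int y\<bar> * K)"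
  proof (cases "m \<le> r \<or> m \<le> q")
    case True
    have h0: "h 0 = 0" by (simp add: h_def)
    have D0: "expect (RL r q) (\<lambda>w. D (0 + w)) = d" by (simp add: d_def)
    have tay: "\<bar>h a - real_of_int a * d\<bar> \<le> \<kappa> * \<beta> * (real_of_int a)\<^sup>2" for a
    proof -
      have "\<bar>h a - h 0 - real_of_int a * d\<bar> \<le> \<kappa> * \<beta> * (real_of_int a)\<^sup>2"
      proof (rule discrete_taylor)
        fix a
        have "h (a + 1) - h a = expect (RL r q) (\<lambda>w. D (a + w))"
          unfolding hd D_def by (simp add: add_ac)
        then show "\<bar>h (a + 1) - h a - d\<bar> \<le> \<kappa> * \<beta> * \<bar>real_of_int a\<bar>"
          using RL_smooth[of D, OF D True, of a 0] unfolding D0 \<beta>_def by simp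
      qed (use k0 \<beta> in simp)
      then show ?thesis by (simp add: h0)
    qed
    have "\<bar>d - c\<bar> \<le> \<kappa> * (\<beta> * (1.26 * \<theta> * real (Suc k) + 2.16 * \<theta> * T1) + 4 / real n * (real k + T1))"
      using RL_compare_W_law[of D, OF D n m] unfolding d_def c D_def[symmetric] \<beta>_def by simp
    also have "\<dots> \<le> \<kappa> * K"
      unfolding K_def using k0 by (intro mult_left_mono add_left_mono) auto
    finally have dc: "\<bar>d - c\<bar> \<le> \<kappa> * K" .
    have "h x - h y - c * (real_of_int x - real_of_int y)
       = (h x - real_of_int x * d) - (h y - real_of_int y * d) + (real_of_int x - real_of_int y) * (d - c)"
      by (simp add: algebra_simps)
    also have "\<bar>\<dots>\<bar> \<le> \<bar>h x - real_of_int x * d\<bar> + \<bar>h y - real_of_int y * d\<bar> + \<bar>real_of_int x - real_of_int y\<bar> * \<bar>d - c\<bar>"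
      by (simp add: abs_mult[symmetric])
    also have "\<dots> \<le> \<kappa> * \<beta> * (real_of_int x)\<^sup>2 + \<kappa> * \<beta> * (real_of_int y)\<^sup>2 + \<bar>real_of_int x - real_of_int y\<bar> * (\<kappa> * K)"
      by (intro add_mono tay mult_left_mono dc) auto
    also have "\<dots> = \<kappa> * (\<beta> * ((real_of_int x)\<^sup>2 + (real_of_int y)\<^sup>2) + \<bar>real_of_int x - real_of_int y\<bar> * K)"
      by (simp add: algebra_simps)
    finally show ?thesis .
  next
    case False
    then have "r < m" "q < m" by auto
    \<comment> \<open>If both remainders are short, at least half of the window lies in the segment.
      Then the factor |x - y| is multiplied by at least 2, and the Lipschitz bounds on
      \<open>h\<close> and \<open>c\<close> suffice.\<close>
    then have "n \<le> 2 * Suc k" using m unfolding n by simp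
    then have "real n \<le> 2 * real (Suc k)" by (metis of_nat_le_iff of_nat_mult of_nat_numeral)
    moreover have "0 < real n" using n by simp
    ultimately have "2 \<le> 4 / real n * real (Suc k)" by (simp add: field_simps)
    also have "\<dots> \<le> 4 / real n * (real (Suc k) + T1)"
      using T1_nonneg by (intro mult_left_mono) auto
    also have "\<dots> \<le> K" unfolding K_def using K0 by linarith
    finally have K2: "2 \<le> K" .
    have "\<bar>h x - h y\<bar> \<le> \<kappa> * \<bar>real_of_int x - real_of_int y\<bar>"
      unfolding hd by (intro abs_expectation_le_const lip_shift)
    moreover have "\<bar>c * (real_of_int x - real_of_int y)\<bar> \<le> \<kappa> * \<bar>real_of_int x - real_of_int y\<bar>"
      unfolding abs_mult by (intro mult_right_mono cb) simp
    ultimately have "\<bar>h x - h y - c * (real_of_int x - real_of_int y)\<bar> \<le> \<kappa> * (\<bar>real_of_int x - real_of_int y\<bar> * 2)"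
      by linarith
    also have "\<dots> \<le> \<kappa> * (\<beta> * ((real_of_int x)\<^sup>2 + (real_of_int y)\<^sup>2) + \<bar>real_of_int x - real_of_int y\<bar> * K)"
    proof (intro mult_left_mono k0)
      have "\<bar>real_of_int x - real_of_int y\<bar> * 2 \<le> \<bar>real_of_int x - real_of_int y\<bar> * K"
        by (intro mult_left_mono K2) simp
      moreover have "0 \<le> \<beta> * ((real_of_int x)\<^sup>2 + (real_of_int y)\<^sup>2)" using \<beta> by simp
      ultimately show "\<bar>real_of_int x - real_of_int y\<bar> * 2 \<le> \<beta> * ((real_of_int x)\<^sup>2 + (real_of_int y)\<^sup>2) + \<bar>real_of_int x - real_of_int y\<bar> * K"
        by linarith
    qed
    finally show ?thesis .
  qed
  then show ?thesis unfolding eq K_def \<beta>_def .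
qed

text \<open>Each of the two quadratic terms contributes 3.42 and the linear term 47.151, in total
  below 56.\<close>

lemma pair_law_bound:
  fixes g :: "int \<Rightarrow> real"
  assumes g: "\<And>w. \<bar>g (w + 1) - g w\<bar> \<le> \<kappa>" and n: "n = q + Suc j" and m: "4 * m \<le> n"
    and c: "c = expect (W_law \<pi> P Q n) (\<lambda>w. g (w + 1) - g w)"
    and int: "integrable (measure_pmf (pair_law j q))
      (\<lambda>t. (real_of_int (fst (fst t)) - real_of_int (snd (fst t)))
        * ((g (fst (snd t)) - c * real_of_int (fst (snd t))) - (g (snd (snd t)) - c * real_of_int (snd (snd t)))))"
  shows "\<bar>expect (pair_law j q)
      (\<lambda>t. (real_of_int (fst (fst t)) - real_of_int (snd (fst t)))
        * ((g (fst (snd t)) - c * real_of_int (fst (snd t))) - (g (snd (snd t)) - c * real_of_int (snd (snd t)))))\<bar>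
    \<le> 56 * \<kappa> * beta_tilde \<pi> P Q m * \<zeta> * \<Theta>"
proof -
  define \<beta> where "\<beta> = beta_tilde \<pi> P Q m"
  have \<beta>: "0 \<le> \<beta>" by (simp add: \<beta>_def beta_tilde_nonneg)
  have k0: "0 \<le> \<kappa>" using g[of 0] by simp
  have n0: "0 < real n" using n by simp
  \<comment> \<open>The linear error of \<open>segment_exchange_bound\<close> as an affine function
    of the segment length: \<open>A\<close> is the price per time of the segment, \<open>B\<close>
    that of the meetings in the second coupling.\<close>
  define A where "A = \<beta> * (1.26 * \<theta>) + 4 / real n"
  define B where "B = (\<beta> * (2.16 * \<theta>) + 4 / real n) * T1"
  define K where "K t = A * real t + B" for t :: nat
  have AB: "0 \<le> A" "0 \<le> B" using \<beta> theta_ge_1 T1_nonneg by (auto simp: A_def B_def)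
  define \<Phi> where "\<Phi> z = expect (RL (j - length (fst (snd z))) (q - length (snd (snd z))))
      (\<lambda>w. (g (seg_fst z + w) - c * real_of_int (seg_fst z + w)) - (g (seg_snd z + w) - c * real_of_int (seg_snd z + w)))"
    for z
  have E: "expect (pair_law j q)
      (\<lambda>t. (real_of_int (fst (fst t)) - real_of_int (snd (fst t)))
        * ((g (fst (snd t)) - c * real_of_int (fst (snd t))) - (g (snd (snd t)) - c * real_of_int (snd (snd t)))))
     = expect (seg j q) (\<lambda>z. hd_diff z * \<Phi> z)"
    using integral_bind_pmf[OF int[unfolded pair_law_def]]
    by (simp add: pair_law_def hd_diff_def \<Phi>_def)
  have pt: "\<bar>hd_diff z * \<Phi> z\<bar> \<le> \<kappa> * \<beta> * (\<bar>hd_diff z\<bar> * (real_of_int (seg_fst z))\<^sup>2) + \<kappa> * \<beta> * (\<bar>hd_diff z\<bar> * (real_of_int (seg_snd z))\<^sup>2)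
      + \<kappa> * (\<bar>hd_diff z\<bar> * \<bar>real_of_int (seg_fst z) - real_of_int (seg_snd z)\<bar> * K (length (incs z)))"
    if z: "z \<in> set_pmf (seg j q)" for z
  proof -
    let ?k = "length (fst (snd z)) + length (snd (snd z))"
    have n': "n = (q - length (snd (snd z))) + Suc (?k + (j - length (fst (snd z))))"
      using seg_length[OF z] n by simp
    have len: "length (incs z) = Suc ?k" by (simp add: incs_def)
    have "\<bar>\<Phi> z\<bar> \<le> \<kappa> * (\<beta> * ((real_of_int (seg_fst z))\<^sup>2 + (real_of_int (seg_snd z))\<^sup>2)
       + \<bar>real_of_int (seg_fst z) - real_of_int (seg_snd z)\<bar> * (\<beta> * (1.26 * \<theta> * real (Suc ?k) + 2.16 * \<theta> * T1) + 4 / real n * (real (Suc ?k) + T1)))"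
      unfolding \<Phi>_def \<beta>_def by (rule segment_exchange_bound[OF g n' m c])
    also have "\<beta> * (1.26 * \<theta> * real (Suc ?k) + 2.16 * \<theta> * T1) + 4 / real n * (real (Suc ?k) + T1) = K (length (incs z))"
      unfolding len K_def A_def B_def by (simp add: algebra_simps add_divide_distrib)
    finally have "\<bar>hd_diff z\<bar> * \<bar>\<Phi> z\<bar> \<le> \<bar>hd_diff z\<bar> * (\<kappa> * (\<beta> * ((real_of_int (seg_fst z))\<^sup>2 + (real_of_int (seg_snd z))\<^sup>2)
       + \<bar>real_of_int (seg_fst z) - real_of_int (seg_snd z)\<bar> * K (length (incs z))))"
      by (intro mult_left_mono) auto
    then show ?thesis by (simp add: abs_mult algebra_simps)
  qed
  \<comment> \<open>Length times \<open>K\<close> is quadratic in the length, so \<tau> enters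
    through its first two moments; the product \<open>B * T1\<close> contains T1^2, later bounded by
    \<Theta>.\<close>
  have IK: "(\<integral>\<^sup>+z. of_nat (length (incs z)) * ennreal (K (length (incs z))) \<partial>seg j q) \<le> ennreal (A * \<Theta> + B * T1)"
  proof -
    have "(\<integral>\<^sup>+z. of_nat (length (incs z)) * ennreal (K (length (incs z))) \<partial>seg j q) \<le> (\<integral>\<^sup>+t. of_nat t * ennreal (K t) \<partial>tau)"
    proof (rule nn_integral_seg_length_le[where w = "\<lambda>t. of_nat t * ennreal (K t)"], rule monoI)
      fix x y :: nat assume xy: "x \<le> y"
      have "K x \<le> K y" unfolding K_def using AB xy by (intro add_right_mono mult_left_mono) auto
      then show "of_nat x * ennreal (K x) \<le> of_nat y * ennreal (K y)"
        using xy by (intro mult_mono ennreal_leI) auto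
    qed
    also have "\<dots> = (\<integral>\<^sup>+t. ennreal A * ennreal ((real t)\<^sup>2) + ennreal B * of_nat t \<partial>tau)"
      using AB by (intro nn_integral_cong)
        (simp add: K_def ennreal_mult ennreal_of_nat_eq_real_of_nat power2_eq_square algebra_simps)
    also have "\<dots> = ennreal A * ennreal \<Theta> + ennreal B * ennreal T1"
      by (simp add: nn_integral_add nn_integral_cmult nn_integral_tau_sq nn_integral_tau)
    also have "\<dots> = ennreal (A * \<Theta> + B * T1)" using AB Theta_nonneg T1_nonneg by (simp add: ennreal_mult)
    finally show ?thesis .
  qed
  have "\<bar>expect (seg j q) (\<lambda>z. hd_diff z * \<Phi> z)\<bar>
     \<le> \<kappa> * \<beta> * (3.42 * \<zeta> * \<Theta>) + \<kappa> * \<beta> * (3.42 * \<zeta> * \<Theta>) + \<kappa> * (4.65 * \<theta>\<^sup>2 * (A * \<Theta> + B * T1))"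
  proof (rule abs_integral_le)
    have "(\<integral>\<^sup>+z. ennreal \<bar>hd_diff z * \<Phi> z\<bar> \<partial>seg j q)
       \<le> (\<integral>\<^sup>+z. ennreal (\<kappa> * \<beta>) * ennreal (\<bar>hd_diff z\<bar> * (real_of_int (seg_fst z))\<^sup>2)
          + ennreal (\<kappa> * \<beta>) * ennreal (\<bar>hd_diff z\<bar> * (real_of_int (seg_snd z))\<^sup>2)
          + ennreal \<kappa> * (ennreal (\<bar>hd_diff z\<bar> * \<bar>real_of_int (seg_fst z) - real_of_int (seg_snd z)\<bar>) * ennreal (K (length (incs z)))) \<partial>seg j q)"
    proof (rule nn_integral_mono_pmf)
      fix z assume z: "z \<in> set_pmf (seg j q)"
      have K0: "0 \<le> K t" for t using AB by (simp add: K_def)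
      have "ennreal (\<kappa> * \<beta> * a + \<kappa> * \<beta> * b + \<kappa> * (d * K t)) = ennreal (\<kappa> * \<beta>) * ennreal a + ennreal (\<kappa> * \<beta>) * ennreal b + ennreal \<kappa> * (ennreal d * ennreal (K t))"
        if "0 \<le> a" "0 \<le> b" "0 \<le> d" for a b d t
      proof -
        have kb: "0 \<le> \<kappa> * \<beta>" using k0 \<beta> by simp
        have "ennreal (u * a + u * b + \<kappa> * (d * K t)) = ennreal u * ennreal a + ennreal u * ennreal b + ennreal \<kappa> * (ennreal d * ennreal (K t))" if "0 \<le> u" for u
          using that \<open>0 \<le> a\<close> \<open>0 \<le> b\<close> \<open>0 \<le> d\<close> k0 K0[of t] by (simp add: ennreal_mult)
        from this[OF kb] show ?thesis .
      qed
      from this[of "\<bar>hd_diff z\<bar> * (real_of_int (seg_fst z))\<^sup>2" "\<bar>hd_diff z\<bar> * (real_of_int (seg_snd z))\<^sup>2"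
          "\<bar>hd_diff z\<bar> * \<bar>real_of_int (seg_fst z) - real_of_int (seg_snd z)\<bar>" "length (incs z)"]
      show "ennreal \<bar>hd_diff z * \<Phi> z\<bar> \<le> ennreal (\<kappa> * \<beta>) * ennreal (\<bar>hd_diff z\<bar> * (real_of_int (seg_fst z))\<^sup>2)
          + ennreal (\<kappa> * \<beta>) * ennreal (\<bar>hd_diff z\<bar> * (real_of_int (seg_snd z))\<^sup>2)
          + ennreal \<kappa> * (ennreal (\<bar>hd_diff z\<bar> * \<bar>real_of_int (seg_fst z) - real_of_int (seg_snd z)\<bar>) * ennreal (K (length (incs z))))"
        using ennreal_leI[OF pt[OF z]] by simp
    qed
    also have "\<dots> = ennreal (\<kappa> * \<beta>) * (\<integral>\<^sup>+z. ennreal (\<bar>hd_diff z\<bar> * (real_of_int (seg_fst z))\<^sup>2) \<partial>seg j q)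
          + ennreal (\<kappa> * \<beta>) * (\<integral>\<^sup>+z. ennreal (\<bar>hd_diff z\<bar> * (real_of_int (seg_snd z))\<^sup>2) \<partial>seg j q)
          + ennreal \<kappa> * (\<integral>\<^sup>+z. ennreal (\<bar>hd_diff z\<bar> * \<bar>real_of_int (seg_fst z) - real_of_int (seg_snd z)\<bar>) * ennreal (K (length (incs z))) \<partial>seg j q)"
    proof -
      have "(\<integral>\<^sup>+z. f z + h z + l z \<partial>seg j q) = (\<integral>\<^sup>+z. f z \<partial>seg j q) + (\<integral>\<^sup>+z. h z \<partial>seg j q) + (\<integral>\<^sup>+z. l z \<partial>seg j q)"
        for f h l :: "_ \<Rightarrow> ennreal"
        by (simp add: nn_integral_add)
      moreover have "(\<integral>\<^sup>+z. u * f z \<partial>seg j q) = u * (\<integral>\<^sup>+z. f z \<partial>seg j q)" for u and f :: "_ \<Rightarrow> ennreal"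
        by (rule nn_integral_cmult) simp
      ultimately show ?thesis by simp
    qed
    also have "\<dots> \<le> ennreal (\<kappa> * \<beta>) * ennreal (3.42 * \<zeta> * \<Theta>) + ennreal (\<kappa> * \<beta>) * ennreal (3.42 * \<zeta> * \<Theta>)
          + ennreal \<kappa> * (ennreal (4.65 * \<theta>\<^sup>2) * ennreal (A * \<Theta> + B * T1))"
      by (intro add_mono mult_left_mono seg_square_moments
          order_trans[OF seg_product_moment[where K = "\<lambda>t. ennreal (K t)"]] IK) auto
    also have "\<dots> = ennreal (\<kappa> * \<beta> * (3.42 * \<zeta> * \<Theta>) + \<kappa> * \<beta> * (3.42 * \<zeta> * \<Theta>) + \<kappa> * (4.65 * \<theta>\<^sup>2 * (A * \<Theta> + B * T1)))"
    proof -
      have lin: "ennreal u * ennreal v + ennreal u' * ennreal v' + ennreal w * (ennreal x * ennreal y) = ennreal (u * v + u' * v' + w * (x * y))"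
        if "0 \<le> u" "0 \<le> v" "0 \<le> u'" "0 \<le> v'" "0 \<le> w" "0 \<le> x" "0 \<le> y" for u v u' v' w x y
        using that by (simp add: ennreal_mult)
      show ?thesis by (rule lin) (use k0 \<beta> zeta_ge_1 Theta_nonneg AB T1_nonneg in simp_all)
    qed
    finally show "(\<integral>\<^sup>+z. ennreal \<bar>hd_diff z * \<Phi> z\<bar> \<partial>seg j q)
       \<le> ennreal (\<kappa> * \<beta> * (3.42 * \<zeta> * \<Theta>) + \<kappa> * \<beta> * (3.42 * \<zeta> * \<Theta>) + \<kappa> * (4.65 * \<theta>\<^sup>2 * (A * \<Theta> + B * T1)))" .
    show "0 \<le> \<kappa> * \<beta> * (3.42 * \<zeta> * \<Theta>) + \<kappa> * \<beta> * (3.42 * \<zeta> * \<Theta>) + \<kappa> * (4.65 * \<theta>\<^sup>2 * (A * \<Theta> + B * T1))"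
      using k0 \<beta> zeta_ge_1 Theta_nonneg AB T1_nonneg by simp
  qed
  also have "\<dots> \<le> 56 * \<kappa> * \<beta> * \<zeta> * \<Theta>"
  proof -
    \<comment> \<open>4 * 1.26 / 1.5 = 3.36 converts 4 / n into \<theta> \<beta>. Adding 1.26 and
      2.16 gives 4.62 and 5.52, and 4.65 * (4.62 + 5.52) = 47.151.\<close>
    have "1.5 \<le> real n * (1.26 * \<theta>) * \<beta>" unfolding \<beta>_def by (rule beta_tilde_lower_bound[OF m]) (use n in simp)
    then have "4 / real n \<le> 3.36 * (\<theta> * \<beta>)" using n0 by (simp add: field_simps)
    moreover have "\<beta> * (1.26 * \<theta>) = 1.26 * (\<theta> * \<beta>)" "\<beta> * (2.16 * \<theta>) = 2.16 * (\<theta> * \<beta>)" by simp_all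
    ultimately have A': "A \<le> 4.62 * (\<theta> * \<beta>)" and B0: "\<beta> * (2.16 * \<theta>) + 4 / real n \<le> 5.52 * (\<theta> * \<beta>)"
      unfolding A_def by linarith+
    have B': "B \<le> 5.52 * (\<theta> * \<beta>) * T1"
      unfolding B_def by (intro mult_right_mono B0 T1_nonneg)
    have "A * \<Theta> + B * T1 \<le> 4.62 * (\<theta> * \<beta>) * \<Theta> + 5.52 * (\<theta> * \<beta>) * T1 * T1"
      by (intro add_mono mult_right_mono A' B' Theta_nonneg T1_nonneg)
    also have "\<dots> \<le> 4.62 * (\<theta> * \<beta>) * \<Theta> + 5.52 * (\<theta> * \<beta>) * \<Theta>"
    proof -
      have "5.52 * (\<theta> * \<beta>) * (T1 * T1) \<le> 5.52 * (\<theta> * \<beta>) * \<Theta>"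
        using T1_sq_le theta_ge_1 \<beta> by (intro mult_left_mono) (auto simp: power2_eq_square)
      then show ?thesis by (simp only: mult.assoc add_le_cancel_left)
    qed
    finally have "A * \<Theta> + B * T1 \<le> 10.14 * (\<theta> * \<beta> * \<Theta>)" by (simp add: mult_ac)
    then have "4.65 * \<theta>\<^sup>2 * (A * \<Theta> + B * T1) \<le> 4.65 * \<theta>\<^sup>2 * (10.14 * (\<theta> * \<beta> * \<Theta>))"
      by (intro mult_left_mono) auto
    also have "\<dots> = 47.151 * (\<beta> * \<zeta> * \<Theta>)"
      unfolding theta_cube[symmetric] by (simp add: power2_eq_square power3_eq_cube)
    finally have xy: "\<kappa> * (4.65 * \<theta>\<^sup>2 * (A * \<Theta> + B * T1)) \<le> \<kappa> * (47.151 * (\<beta> * \<zeta> * \<Theta>))"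
      by (intro mult_left_mono k0)
    define x where "x = \<kappa> * (\<beta> * \<zeta> * \<Theta>)"
    define y where "y = \<kappa> * (4.65 * \<theta>\<^sup>2 * (A * \<Theta> + B * T1))"
    have "0 \<le> x" unfolding x_def using k0 \<beta> zeta_ge_1 Theta_nonneg by simp
    moreover have "y \<le> 47.151 * x" using xy unfolding x_def y_def by simp
    ultimately have "3.42 * x + 3.42 * x + y \<le> 56 * x" by simp
    moreover have "\<kappa> * \<beta> * (3.42 * \<zeta> * \<Theta>) = 3.42 * x" "56 * \<kappa> * \<beta> * \<zeta> * \<Theta> = 56 * x"
      by (simp_all add: x_def)
    ultimately show ?thesis unfolding y_def[symmetric] by (simp only:)
  qed
  finally show ?thesis unfolding E \<beta>_def .
qed

text \<open>The covariance of W with G(W) splits into \<open>n\<close> single-observation terms; the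
  exchange identity halves the bound 56 for each.\<close>

lemma stein_bound:
  fixes g :: "int \<Rightarrow> real"
  assumes g: "\<And>w. \<bar>g (w + 1) - g w\<bar> \<le> \<kappa>" and m: "4 * m \<le> n"
  defines "W \<equiv> W_law \<pi> P Q n"
  defines "\<mu> \<equiv> expect W real_of_int"
  shows "\<bar>measure_pmf.variance W real_of_int * expect W (\<lambda>w. g (w + 1) - g w)
     - expect W (\<lambda>w. (real_of_int w - \<mu>) * g w)\<bar> \<le> 28 * real n * \<kappa> * beta_tilde \<pi> P Q m * \<zeta> * \<Theta>"
proof -
  define c where "c = expect W (\<lambda>w. g (w + 1) - g w)"
  define G where "G w = g w - c * real_of_int w" for w
  define a where "a = expect (bind_pmf \<pi> Q) real_of_int"
  have k0: "0 \<le> \<kappa>" using g[of 0] by simp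
  have w2: "integrable (measure_pmf W) (\<lambda>w. (real_of_int w)\<^sup>2)" unfolding W_def by (rule integrable_square_W_law)
  have one2: "integrable (measure_pmf W) (\<lambda>w. (1::real)\<^sup>2)" by simp
  have w1: "integrable (measure_pmf W) real_of_int"
    using integrable_product_pmf[OF w2 one2] by simp
  \<comment> \<open>Both \<open>g\<close> and \<open>G\<close> grow at most linearly, so the second
    moment of W makes their squares and all products below integrable.\<close>
  have sq: "integrable (measure_pmf W) (\<lambda>w. (f w)\<^sup>2)" if f: "\<And>w. \<bar>f w\<bar> \<le> A + B * \<bar>real_of_int w\<bar>" for f A B
  proof (rule Bochner_Integration.integrable_bound)
    show "integrable (measure_pmf W) (\<lambda>w. 2 * A\<^sup>2 + 2 * B\<^sup>2 * (real_of_int w)\<^sup>2)" using w2 by simp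
    show "AE w in measure_pmf W. norm ((f w)\<^sup>2) \<le> norm (2 * A\<^sup>2 + 2 * B\<^sup>2 * (real_of_int w)\<^sup>2)"
    proof (rule AE_I2)
      fix w
      have "(f w)\<^sup>2 \<le> (A + B * \<bar>real_of_int w\<bar>)\<^sup>2" using f[of w] by (metis abs_ge_zero order_trans power2_abs power_mono)
      also have "\<dots> \<le> 2 * A\<^sup>2 + 2 * (B * \<bar>real_of_int w\<bar>)\<^sup>2"
      proof -
        have "0 \<le> (A - B * \<bar>real_of_int w\<bar>)\<^sup>2" by simp
        then show ?thesis by (simp add: power2_eq_square algebra_simps)
      qed
      also have "\<dots> = 2 * A\<^sup>2 + 2 * B\<^sup>2 * (real_of_int w)\<^sup>2" by (simp add: power_mult_distrib)
      finally show "norm ((f w)\<^sup>2) \<le> norm (2 * A\<^sup>2 + 2 * B\<^sup>2 * (real_of_int w)\<^sup>2)" by simp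
    qed
  qed simp
  have gb: "\<bar>g w\<bar> \<le> \<bar>g 0\<bar> + \<kappa> * \<bar>real_of_int w\<bar>" for w
    using int_lipschitz[of g, OF g, of w 0] by simp
  have g2: "integrable (measure_pmf W) (\<lambda>w. (g w)\<^sup>2)" by (rule sq[OF gb])
  have Gb: "\<bar>G w\<bar> \<le> \<bar>g 0\<bar> + (\<kappa> + \<bar>c\<bar>) * \<bar>real_of_int w\<bar>" for w
  proof -
    have "\<bar>G w\<bar> \<le> \<bar>g w\<bar> + \<bar>c\<bar> * \<bar>real_of_int w\<bar>" unfolding G_def abs_mult[symmetric] by (rule abs_triangle_ineq4)
    with gb[of w] show ?thesis by (simp add: distrib_right)
  qed
  have G2: "integrable (measure_pmf W) (\<lambda>w. (G w)\<^sup>2)" by (rule sq[OF Gb])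
  have G1: "integrable (measure_pmf W) G" using integrable_product_pmf[OF G2 one2] by simp
  have g1: "integrable (measure_pmf W) g" using integrable_product_pmf[OF g2 one2] by simp
  have wG: "integrable (measure_pmf W) (\<lambda>w. real_of_int w * G w)" by (rule integrable_product_pmf[OF w2 G2])
  have wg: "integrable (measure_pmf W) (\<lambda>w. real_of_int w * g w)" by (rule integrable_product_pmf[OF w2 g2])
  have nq: "n = q + Suc (n - Suc q)" if "q < n" for q using that by simp
  have mean: "\<mu> = real n * a"
  proof -
    have "\<mu> = expect W (\<lambda>w. real_of_int w * 1)" by (simp add: \<mu>_def)
    also have "\<dots> = (\<Sum>q<n. expect (obs_law (n - Suc q) q) (\<lambda>p. real_of_int (fst p) * 1))"
      unfolding W_def by (rule expectation_W_times) simp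
    also have "\<dots> = (\<Sum>q<n. a)"
    proof (rule sum.cong[OF refl])
      fix q
      show "expect (obs_law (n - Suc q) q) (\<lambda>p. real_of_int (fst p) * 1) = a"
        unfolding a_def map_fst_obs_law[of "n - Suc q" q, symmetric] by simp
    qed
    finally show ?thesis by simp
  qed
  have var: "measure_pmf.variance W real_of_int = expect W (\<lambda>w. (real_of_int w - \<mu>) * real_of_int w)"
  proof -
    have "measure_pmf.variance W real_of_int = expect W (\<lambda>w. (real_of_int w)\<^sup>2) - \<mu>\<^sup>2"
      unfolding \<mu>_def by (rule measure_pmf.variance_eq[OF w1 w2])
    also have "\<dots> = expect W (\<lambda>w. (real_of_int w)\<^sup>2 - \<mu> * real_of_int w)"
      using w1 w2 by (simp add: \<mu>_def power2_eq_square)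
    also have "\<dots> = expect W (\<lambda>w. (real_of_int w - \<mu>) * real_of_int w)"
      by (simp add: power2_eq_square left_diff_distrib)
    finally show ?thesis .
  qed
  have "expect W (\<lambda>w. (real_of_int w - \<mu>) * G w)
     = expect W (\<lambda>w. (real_of_int w - \<mu>) * g w) - c * measure_pmf.variance W real_of_int"
  proof -
    have i1: "integrable (measure_pmf W) (\<lambda>w. (real_of_int w - \<mu>) * g w)"
      using wg g1 by (simp add: left_diff_distrib)
    have i2: "integrable (measure_pmf W) (\<lambda>w. (real_of_int w - \<mu>) * real_of_int w)"
      using w2 w1 by (simp add: left_diff_distrib power2_eq_square)
    have "(\<lambda>w. (real_of_int w - \<mu>) * G w) = (\<lambda>w. (real_of_int w - \<mu>) * g w - c * ((real_of_int w - \<mu>) * real_of_int w))"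
      by (auto simp: G_def algebra_simps)
    then show ?thesis unfolding var using i1 i2 by simp
  qed
  then have eq: "measure_pmf.variance W real_of_int * c - expect W (\<lambda>w. (real_of_int w - \<mu>) * g w)
     = - expect W (\<lambda>w. (real_of_int w - \<mu>) * G w)" by simp
  have "expect W (\<lambda>w. (real_of_int w - \<mu>) * G w)
     = expect W (\<lambda>w. real_of_int w * G w) - \<mu> * expect W G"
    using wG G1 by (simp add: left_diff_distrib)
  also have "\<dots> = (\<Sum>q<n. expect (obs_law (n - Suc q) q) (\<lambda>p. real_of_int (fst p) * G (snd p)) - a * expect W G)"
    using expectation_W_times[OF G2[unfolded W_def]] by (simp add: W_def mean sum_subtractf)
  also have "\<bar>\<dots>\<bar> \<le> (\<Sum>q<n. 28 * \<kappa> * beta_tilde \<pi> P Q m * \<zeta> * \<Theta>)"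
  proof (rule order_trans[OF sum_abs], rule sum_mono)
    fix q assume "q \<in> {..<n}"
    then have n: "n = q + Suc (n - Suc q)" using nq by simp
    have G2': "integrable (measure_pmf (W_law \<pi> P Q (q + Suc (n - Suc q)))) (\<lambda>w. (G w)\<^sup>2)"
      using G2 unfolding W_def n[symmetric] .
    note ex = exchange_identity(2,3)[OF G2']
    have "\<bar>expect (pair_law (n - Suc q) q)
      (\<lambda>t. (real_of_int (fst (fst t)) - real_of_int (snd (fst t))) * (G (fst (snd t)) - G (snd (snd t))))\<bar>
        \<le> 56 * \<kappa> * beta_tilde \<pi> P Q m * \<zeta> * \<Theta>"
      unfolding G_def by (rule pair_law_bound[OF g n m c_def[unfolded W_def] ex(1)[unfolded G_def]])
    then show "\<bar>expect (obs_law (n - Suc q) q) (\<lambda>p. real_of_int (fst p) * G (snd p)) - a * expect W G\<bar>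
      \<le> 28 * \<kappa> * beta_tilde \<pi> P Q m * \<zeta> * \<Theta>"
      using ex(2) unfolding a_def W_def n[symmetric] by simp
  qed
  also have "\<dots> = 28 * real n * \<kappa> * beta_tilde \<pi> P Q m * \<zeta> * \<Theta>" by simp
  finally show ?thesis unfolding c_def[symmetric] eq by simp
qed

end

theorem theorem4p2:
  fixes K :: nat and P :: "nat \<Rightarrow> nat pmf" and Q :: "nat \<Rightarrow> int pmf"
    and \<pi> :: "nat pmf" and Z :: "nat pmf" and n :: nat
    and \<rho> C Cbar :: real
  defines "E \<equiv> {0..K}"
  assumes kernel: "\<And>k. k \<in> E \<Longrightarrow> set_pmf (P k) \<subseteq> E"
    and irred: "irreducible_on E P"
    and aper: "aperiodic_on E P"
    and stat_supp: "set_pmf \<pi> \<subseteq> E"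
    and stationary: "bind_pmf \<pi> P = \<pi>"
    and Y_var: "\<And>k. k \<in> E \<Longrightarrow> integrable (measure_pmf (Q k)) (\<lambda>y. (real_of_int y)\<^sup>2)"
    and strong_aper: "strongly_aperiodic (excursion_sum_pmf P Q)"
    and Z_pos: "0 \<notin> set_pmf Z"
    and Z_cube: "integrable (measure_pmf Z) (\<lambda>z. (real z) ^ 3)"
    and Z_dom: "\<And>r l. l \<in> E \<Longrightarrow>
        max (measure_pmf.prob (Q l) {y. y \<ge> int r}) (measure_pmf.prob (Q l) {y. y \<le> - int r})
          \<le> measure_pmf.prob Z {z. z \<ge> r}"
    and rho: "\<rho> > 1"
    and C: "\<And>m s. s \<in> E \<times> E \<Longrightarrow> avoid (pair_kernel P) (0, 0) m s \<le> C * \<rho> powr (- real m)"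
    and Cbar: "\<And>m s. s \<in> E \<times> E \<Longrightarrow>
        avoid (pair_kernel (rev_kernel \<pi> P)) (0, 0) m s \<le> Cbar * \<rho> powr (- real m)"
    and varpos: "measure_pmf.variance (W_law \<pi> P Q n) real_of_int > 0"
  shows "tv_norm_TP (W_law \<pi> P Q n)
            (measure_pmf.expectation (W_law \<pi> P Q n) real_of_int)
            (measure_pmf.variance (W_law \<pi> P Q n) real_of_int)
         \<le> 4 * (1 + 14 * real n
                 * (beta_tilde \<pi> P Q (nat \<lfloor>real n / 4\<rfloor>)
                    + max C Cbar * real n * \<rho> powr (- (real n / 4)))
                 * E_tau_sq \<pi> P E
                 * measure_pmf.expectation Z (\<lambda>z. (real z) ^ 3))
             / measure_pmf.variance (W_law \<pi> P Q n) real_of_int"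
proof -
  \<comment> \<open>Positive stationary mass makes the reversed kernel a genuine law on
    \<open>E\<close>, as the second instance of \<open>stationary_kernel\<close> requires.\<close>
  have pos: "0 < pmf \<pi> k" if "k \<in> E" for k
    by (rule stationary_pos[OF irred stat_supp stationary that])
  interpret markov_sum E Q Z P \<pi> C Cbar \<rho>
  proof unfold_locales
    show "set_pmf (rev_kernel \<pi> P x) \<subseteq> E" if "x \<in> E" for x
      using set_rev_kernel[OF stationary pos[OF that]] stat_supp by blast
    show "bind_pmf \<pi> (rev_kernel \<pi> P) = \<pi>" by (rule rev_kernel_stationary[OF stationary])
    show "0 \<in> E" "finite E" by (simp_all add: E_def)
  qed (fact kernel stat_supp stationary Z_pos Z_cube Z_dom rho C Cbar)+
  define m where "m = nat \<lfloor>real n / 4\<rfloor>"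
  define s2 where "s2 = measure_pmf.variance (W_law \<pi> P Q n) real_of_int"
  define \<phi> where "\<phi> = beta_tilde \<pi> P Q m + max C Cbar * real n * \<rho> powr (- (real n / 4))"
  have m: "4 * m \<le> n" unfolding m_def by linarith
  have s2: "0 < s2" using varpos by (simp add: s2_def)
  have "tv_norm_TP (W_law \<pi> P Q n) (expect (W_law \<pi> P Q n) real_of_int) s2
     \<le> 4 / s2 + 2 * (28 * real n * (1 / s2) * beta_tilde \<pi> P Q m * \<zeta> * \<Theta>)"
    \<comment> \<open>The Stein solutions have increments at most 1 / s2, so
      \<open>stein_bound\<close> is applied with \<kappa> = 1 / s2.\<close>
    by (rule tv_norm_TP_le_stein[OF integrable_square_W_law s2_def s2 refl], unfold s2_def)
       (rule stein_bound[OF _ m], simp)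
  also have "\<dots> = 4 / s2 + 56 / s2 * real n * (\<zeta> * \<Theta>) * beta_tilde \<pi> P Q m" by simp
  also have "\<dots> \<le> 4 / s2 + 56 / s2 * real n * (\<zeta> * \<Theta>) * \<phi>"
  proof (intro add_left_mono mult_left_mono)
    \<comment> \<open>\<open>avoid\<close> equals 1 at m = 0, so the decay hypothesis there gives C
      >= 1 and the geometric term of \<phi> is nonnegative.\<close>
    have "0 \<le> C" using C[of "(0, 0)" 0] rho by (auto simp: E_def)
    then have "0 \<le> max C Cbar * real n * \<rho> powr (- (real n / 4))" by simp
    then show "beta_tilde \<pi> P Q m \<le> \<phi>" by (simp add: \<phi>_def)
    show "0 \<le> 56 / s2 * real n * (\<zeta> * \<Theta>)" using s2 zeta_ge_1 Theta_nonneg by simp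
  qed
  also have "\<dots> = 4 * (1 + 14 * real n * \<phi> * \<Theta> * \<zeta>) / s2"
    by (simp add: add_divide_distrib distrib_left mult_ac)
  finally show ?thesis unfolding \<phi>_def \<Theta>_def \<zeta>_def m_def s2_def .
qed

end
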